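(* Let $G$ be a countable amenable group acting continuously on a compact metrizable space $X$. Let $\Sigma$ be a sofic approximation sequence for $G$ and let $f$ be a real valued continuous function on $X$. Then $P_{\Sigma}(f,X,G)=P(f,X,G)$, where $P_\Sigma(f,X,G)$ is the sofic topological pressure of $f$ with respect to $\Sigma$ and $P(f,X,G)$ is the classical (amenable) topological pressure of $f$.
   Context: **Sofic approximation sequences.** For $d\in\mathbb{N}$ write $[d]=\{1,\dots,d\}$ and $\mathrm{Sym}(d)$ for the permutation group of $[d]$. A sofic approximation sequence for a countable group $G$ is a sequence $\Sigma=\{\sigma_i:G\to\mathrm{Sym}(d_i)\}_{i\in\mathbb{N}}$ of maps (not necessarily homomorphisms; $d_i\in\mathbb{N}$; $\sigma_{i,s}=\sigma_i(s)$) such that (1) $\lim_{i}\frac{1}{d_i}|\{a\in[d_i]:\sigma_{i,s}\sigma_{i,t}(a)=\sigma_{i,st}(a)\}|=1$ for all $s,t\in G$; (2) $\lim_i\frac1{d_i}|\{a\in[d_i]:\sigma_{i,s}(a)\ne\sigma_{i,t}(a)\}|=1$ for all distinct $s,t\in G$; (3) $\lim_i d_i=\infty$. The action is written $x\mapsto sx=\alpha_s(x)$. **Sofic topological pressure.** Let $\rho$ be a compatible metric on $X$. For maps $\varphi,\psi:[d]\to X$ put $\rho_2(\varphi,\psi)=\big(\frac1d\sum_{a=1}^d\rho(\varphi(a),\psi(a))^2\big)^{1/2}$ and $\rho_\infty(\varphi,\psi)=\max_{1\le a\le d}\rho(\varphi(a),\psi(a))$. For a nonempty finite $F\subset G$,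 $\delta>0$ and $\sigma:G\to\mathrm{Sym}(d)$, let $\mathrm{Map}(\rho,F,\delta,\sigma)$ be the set of all $\varphi:[d]\to X$ with $\max_{s\in F}\rho_2(\alpha_s\circ\varphi,\varphi\circ\sigma_s)<\delta$. A subset $A$ of a (pseudo)metric space $(Y,d_Y)$ is $(d_Y,\varepsilon)$-separated if $d_Y(x,y)\ge\varepsilon$ for all distinct $x,y\in A$. For $\varepsilon>0$ let $$M^\varepsilon_{\Sigma,\infty}(f,X,G,\rho,F,\delta,\sigma)=\sup_{\mathcal{E}}\sum_{\varphi\in\mathcal{E}}\exp\Big(\sum_{a=1}^d f(\varphi(a))\Big),$$ with $\mathcal{E}$ running over the $(\rho_\infty,\varepsilon)$-separated subsets of $\mathrm{Map}(\rho,F,\delta,\sigma)$. Define $$P_{\Sigma,\infty}(f,X,G,\rho)=\sup_{\varepsilon>0}\ \inf_{F}\ \inf_{\delta>0}\ \limsup_{i\to\infty}\frac1{d_i}\log M^\varepsilon_{\Sigma,\infty}(f,X,G,\rho,F,\delta,\sigma_i)\in[-\infty,+\infty],$$ $F$ running over nonempty finite subsets of $G$, with $\log 0=-\infty$ (so the limsup is $-\infty$ if $\mathrm{Map}(\rho,F,\delta,\sigma_i)=\emptyset$ for all large $i$). This value does not depend on the compatible metric $\rho$ and is denoted $P_\Sigma(f,X,G)$. **Amenable topological pressure.** $G$ is amenable if it has a Følner sequence: nonempty finite sets $F_n\subset G$ with $|sF_n\Delta F_n|/|F_n|\to0$ for all $s\in G$. Let $\rho$ be a compatible metric on $X$. For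 a nonempty finite $F\subset G$ and $\delta>0$, an open cover $\mathcal{U}$ of $X$ is of order $(F,\delta)$ if $\max_{s\in F}\rho(sx,sy)<\delta$ for all $U\in\mathcal{U}$ and $x,y\in U$. Put $$P_1(F,f,\delta)=\inf_{\mathcal{U}}\sum_{U\in\mathcal{U}}\sup_{x\in U}\exp\Big(\sum_{s\in F}f(sx)\Big),$$ $\mathcal{U}$ running over finite open covers of order $(F,\delta)$. For each $\delta>0$ the quantities $\frac1{|F|}\log P_1(F,f,\delta)$ converge (Ornstein–Weiss) to a number $p_1(f,\delta)$ as $F$ becomes more and more left invariant, i.e. for every $\varepsilon>0$ there are a nonempty finite $K\subset G$ and $\delta'>0$ such that $|\frac1{|F|}\log P_1(F,f,\delta)-p_1(f,\delta)|<\varepsilon$ for every nonempty finite $F\subset G$ with $|KF\Delta F|\le\delta'|F|$. Then $P(f,X,G)=\sup_{\delta>0}p_1(f,\delta)$, which does not depend on $\rho$. Equivalently, for any Følner sequence $\{F_n\}$, $P(f,X,G)=\sup_{\varepsilon>0}\limsup_{n}\frac1{|F_n|}\log\sup_{\mathcal{D}}\sum_{x\in\mathcal{D}}\exp(\sum_{s\in F_n}f(sx))$, with $\mathcal{D}$ running over the $(\rho_{F_n},\varepsilon)$-separated subsets of $X$, where $\rho_F(x,y)=\max_{s\in F}\rho(sx,sy)$. *)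

theory Defs
  imports
    "HOL-Analysis.Analysis"
    "HOL-Algebra.Group_Action"
    "HOL-Algebra.Sym_Groups"
begin

(* The two pressures are functions of the metric, as in their definitions; that they do not
   depend on it is expressed by quantifying over compatible metrics. *)
definition compatible_metric :: "'x topology \<Rightarrow> ('x \<Rightarrow> 'x \<Rightarrow> real) \<Rightarrow> bool" where
  "compatible_metric X \<rho> \<longleftrightarrow>
     Metric_space (topspace X) \<rho> \<and> Metric_space.mtopology (topspace X) \<rho> = X"

(* group_action makes each \<alpha> s an extensional bijection of topspace X. *)
definition continuous_action ::
  "('g, 'r) monoid_scheme \<Rightarrow> 'x topology \<Rightarrow> ('g \<Rightarrow> 'x \<Rightarrow> 'x) \<Rightarrow> bool" where
  "continuous_action G X \<alpha> \<longleftrightarrow>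
     group_action G (topspace X) \<alpha> \<and> (\<forall>s\<in>carrier G. continuous_map X X (\<alpha> s))"

definition elog :: "ennreal \<Rightarrow> ereal" where
  "elog x = (if x = 0 then -\<infinity> else if x = \<infinity> then \<infinity> else ereal (ln (enn2real x)))"

definition nonempty_finite_subsets :: "('g, 'r) monoid_scheme \<Rightarrow> 'g set set" where
  "nonempty_finite_subsets G = {F. F \<subseteq> carrier G \<and> finite F \<and> F \<noteq> {}}"


section \<open>Sofic pressure\<close>

definition sofic_approximation_sequence ::
  "('g, 'r) monoid_scheme \<Rightarrow> (nat \<Rightarrow> nat) \<Rightarrow> (nat \<Rightarrow> 'g \<Rightarrow> nat \<Rightarrow> nat) \<Rightarrow> bool" where
  "sofic_approximation_sequence G d \<sigma> \<longleftrightarrow>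
     (\<forall>i. \<forall>s\<in>carrier G. \<sigma> i s \<in> carrier (sym_group (d i))) \<and>
     (\<forall>s\<in>carrier G. \<forall>t\<in>carrier G.
        (\<lambda>i. 1 / real (d i) * real (card {a\<in>{1..d i}. \<sigma> i s (\<sigma> i t a) = \<sigma> i (s \<otimes>\<^bsub>G\<^esub> t) a}))
          \<longlonglongrightarrow> 1) \<and>
     (\<forall>s\<in>carrier G. \<forall>t\<in>carrier G. s \<noteq> t \<longrightarrow>
        (\<lambda>i. 1 / real (d i) * real (card {a\<in>{1..d i}. \<sigma> i s a \<noteq> \<sigma> i t a})) \<longlonglongrightarrow> 1) \<and>
     filterlim d at_top sequentially"

definition rho_2 :: "('x \<Rightarrow> 'x \<Rightarrow> real) \<Rightarrow> nat \<Rightarrow> (nat \<Rightarrow> 'x) \<Rightarrow> (nat \<Rightarrow> 'x) \<Rightarrow> real" where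
  "rho_2 \<rho> d \<phi> \<psi> = sqrt (1 / real d * (\<Sum>a=1..d. (\<rho> (\<phi> a) (\<psi> a))\<^sup>2))"

definition rho_inf :: "('x \<Rightarrow> 'x \<Rightarrow> real) \<Rightarrow> nat \<Rightarrow> (nat \<Rightarrow> 'x) \<Rightarrow> (nat \<Rightarrow> 'x) \<Rightarrow> real" where
  "rho_inf \<rho> d \<phi> \<psi> = (MAX a\<in>{1..d}. \<rho> (\<phi> a) (\<psi> a))"

definition separated :: "('y \<Rightarrow> 'y \<Rightarrow> real) \<Rightarrow> real \<Rightarrow> 'y set \<Rightarrow> bool" where
  "separated dY \<epsilon> A \<longleftrightarrow> (\<forall>x\<in>A. \<forall>y\<in>A. x \<noteq> y \<longrightarrow> dY x y \<ge> \<epsilon>)"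

definition sofic_Map ::
  "'x topology \<Rightarrow> ('g \<Rightarrow> 'x \<Rightarrow> 'x) \<Rightarrow> ('x \<Rightarrow> 'x \<Rightarrow> real) \<Rightarrow> 'g set \<Rightarrow> real
     \<Rightarrow> nat \<Rightarrow> ('g \<Rightarrow> nat \<Rightarrow> nat) \<Rightarrow> (nat \<Rightarrow> 'x) set" where
  "sofic_Map X \<alpha> \<rho> F \<delta> d \<sigma> =
     {\<phi> \<in> {1..d} \<rightarrow>\<^sub>E topspace X. (MAX s\<in>F. rho_2 \<rho> d (\<alpha> s \<circ> \<phi>) (\<phi> \<circ> \<sigma> s)) < \<delta>}"

(* For compact X every separated set of maps is finite, so the plain sum loses nothing. *)
definition sofic_M ::
  "('x \<Rightarrow> real) \<Rightarrow> 'x topology \<Rightarrow> ('g \<Rightarrow> 'x \<Rightarrow> 'x) \<Rightarrow> ('x \<Rightarrow> 'x \<Rightarrow> real) \<Rightarrow> real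
     \<Rightarrow> 'g set \<Rightarrow> real \<Rightarrow> nat \<Rightarrow> ('g \<Rightarrow> nat \<Rightarrow> nat) \<Rightarrow> ennreal" where
  "sofic_M f X \<alpha> \<rho> \<epsilon> F \<delta> d \<sigma> =
     (SUP E \<in> {E. E \<subseteq> sofic_Map X \<alpha> \<rho> F \<delta> d \<sigma> \<and> separated (rho_inf \<rho> d) \<epsilon> E}.
        \<Sum>\<phi>\<in>E. ennreal (exp (\<Sum>a=1..d. f (\<phi> a))))"

definition sofic_pressure ::
  "(nat \<Rightarrow> nat) \<Rightarrow> (nat \<Rightarrow> 'g \<Rightarrow> nat \<Rightarrow> nat) \<Rightarrow> ('x \<Rightarrow> real) \<Rightarrow> 'x topology
     \<Rightarrow> ('g, 'r) monoid_scheme \<Rightarrow> ('g \<Rightarrow> 'x \<Rightarrow> 'x) \<Rightarrow> ('x \<Rightarrow> 'x \<Rightarrow> real) \<Rightarrow> ereal" where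
  "sofic_pressure d \<sigma> f X G \<alpha> \<rho> =
     (SUP \<epsilon> \<in> {0<..}. INF F \<in> nonempty_finite_subsets G. INF \<delta> \<in> {0<..}.
        limsup (\<lambda>i. ereal (1 / real (d i)) * elog (sofic_M f X \<alpha> \<rho> \<epsilon> F \<delta> (d i) (\<sigma> i))))"


section \<open>Amenable pressure\<close>

definition Folner_sequence :: "('g, 'r) monoid_scheme \<Rightarrow> (nat \<Rightarrow> 'g set) \<Rightarrow> bool" where
  "Folner_sequence G Fn \<longleftrightarrow>
     (\<forall>n. Fn n \<in> nonempty_finite_subsets G) \<and>
     (\<forall>s\<in>carrier G.
        (\<lambda>n. real (card (sym_diff (s <#\<^bsub>G\<^esub> Fn n) (Fn n))) / real (card (Fn n))) \<longlonglongrightarrow> 0)"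

definition amenable :: "('g, 'r) monoid_scheme \<Rightarrow> bool" where
  "amenable G \<longleftrightarrow> (\<exists>Fn. Folner_sequence G Fn)"

(* The filter along which a nonempty finite set F becomes more and more left invariant. *)
definition left_invariant_filter :: "('g, 'r) monoid_scheme \<Rightarrow> 'g set filter" where
  "left_invariant_filter G =
     (INF (K, \<delta>) \<in> nonempty_finite_subsets G \<times> {0<..}.
        principal {F \<in> nonempty_finite_subsets G.
          real (card (sym_diff (K <#>\<^bsub>G\<^esub> F) F)) \<le> \<delta> * real (card F)})"

definition cover_of_order ::
  "'x topology \<Rightarrow> ('g \<Rightarrow> 'x \<Rightarrow> 'x) \<Rightarrow> ('x \<Rightarrow> 'x \<Rightarrow> real) \<Rightarrow> 'g set \<Rightarrow> real \<Rightarrow> 'x set set \<Rightarrow> bool" where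
  "cover_of_order X \<alpha> \<rho> F \<delta> \<U> \<longleftrightarrow>
     (\<forall>U\<in>\<U>. openin X U) \<and> \<Union>\<U> = topspace X \<and>
     (\<forall>U\<in>\<U>. \<forall>x\<in>U. \<forall>y\<in>U. (MAX s\<in>F. \<rho> (\<alpha> s x) (\<alpha> s y)) < \<delta>)"

(* The supremum is taken in ennreal, so the empty set, if it belongs to a cover,
   contributes 0 to the sum. *)
definition amenable_P1 ::
  "'x topology \<Rightarrow> ('g \<Rightarrow> 'x \<Rightarrow> 'x) \<Rightarrow> ('x \<Rightarrow> 'x \<Rightarrow> real) \<Rightarrow> 'g set \<Rightarrow> ('x \<Rightarrow> real) \<Rightarrow> real \<Rightarrow> ennreal" where
  "amenable_P1 X \<alpha> \<rho> F f \<delta> =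
     (INF \<U> \<in> {\<U>. finite \<U> \<and> cover_of_order X \<alpha> \<rho> F \<delta> \<U>}.
        \<Sum>U\<in>\<U>. SUP x\<in>U. ennreal (exp (\<Sum>s\<in>F. f (\<alpha> s x))))"

(* The limit exists for amenable G by the Ornstein-Weiss lemma. *)
definition amenable_p1 ::
  "('x \<Rightarrow> real) \<Rightarrow> 'x topology \<Rightarrow> ('g, 'r) monoid_scheme \<Rightarrow> ('g \<Rightarrow> 'x \<Rightarrow> 'x) \<Rightarrow> ('x \<Rightarrow> 'x \<Rightarrow> real)
     \<Rightarrow> real \<Rightarrow> ereal" where
  "amenable_p1 f X G \<alpha> \<rho> \<delta> =
     Lim (left_invariant_filter G)
       (\<lambda>F. ereal (1 / real (card F)) * elog (amenable_P1 X \<alpha> \<rho> F f \<delta>))"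

definition amenable_pressure ::
  "('x \<Rightarrow> real) \<Rightarrow> 'x topology \<Rightarrow> ('g, 'r) monoid_scheme \<Rightarrow> ('g \<Rightarrow> 'x \<Rightarrow> 'x) \<Rightarrow> ('x \<Rightarrow> 'x \<Rightarrow> real)
     \<Rightarrow> ereal" where
  "amenable_pressure f X G \<alpha> \<rho> = (SUP \<delta> \<in> {0<..}. amenable_p1 f X G \<alpha> \<rho> \<delta>)"

end

theory Submission
  imports Defs
begin

text \<open>
  Both pressures measure how many orbit patterns a finite piece of the group can see, weighted
  by \<open>f\<close>. For finite \<open>F\<close> let \<open>lnP \<delta> F\<close> be the logarithm of the optimal weighted cover of order
  \<open>(F, \<delta>)\<close> and \<open>avg \<delta> F = lnP \<delta> F / |F|\<close>; the amenable pressure is made of the limits \<open>p1 \<delta>\<close> of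
  \<open>avg \<delta>\<close>. The quantity \<open>lnP \<delta>\<close> is subadditive over disjoint unions (\<open>lnP_union\<close>), does not grow
  under right translation (\<open>lnP_translate\<close>), and grows by at most a constant per removed element
  (\<open>lnP_subset\<close>).

  The link between Folner sets and sofic approximations is the quasi-tiling theorem of Ornstein
  and Weiss. It needs very little of an action, so it is proved once for \<open>approx_action\<close>: a
  finite set \<open>D\<close> with maps \<open>\<sigma> s\<close> that look like a free action at most points. A Folner set under
  left multiplication is one example (\<open>Folner_approx_action\<close>), and \<open>{1..d}\<close> with a good sofic
  approximation is another (\<open>sofic_good_approx_action\<close>). By \<open>quasi_tiling_exists\<close>, \<open>D\<close> is
  covered, up to a small proportion, by disjoint tiles \<open>T c = {\<sigma> s c | s \<in> T}\<close> with \<open>T\<close> from a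
  finite family of shapes that can be fixed beforehand, and the shapes inherit any property that
  arbitrarily invariant sets and all their large subsets have.

  This is used three times. First, in a Folner set it shows that \<open>avg \<delta>\<close> of every sufficiently
  invariant set is at most a value taken frequently, so \<open>avg \<delta>\<close> converges
  (\<open>frequently_below_imp_eventually\<close>, \<open>avg_converges\<close>).

  Secondly, for the upper bound (\<open>sofic_M_upper\<close>), let \<open>\<phi>\<close> be an approximately equivariant map.
  On a tile \<open>T c\<close> it is nearly \<open>s \<mapsto> s (\<phi> c)\<close>, so up to \<open>\<epsilon>\<close> it is determined there by the member
  of an optimal cover of order \<open>(T, \<epsilon>/4)\<close> that contains \<open>\<phi> c\<close>. Members of a separated set of
  maps thus have distinct codes, and the weights of all codes add up to at most about the
  product of the \<open>exp (lnP (\<epsilon>/4) T)\<close> over the tiles, that is \<open>exp (d * p1 (\<epsilon>/4))\<close>. Equivariance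
  may fail at a small set of points depending on \<open>\<phi>\<close>; there are few such sets
  (\<open>card_small_subsets\<close>), and each is treated separately.

  Thirdly, for the lower bound (\<open>sofic_M_lower\<close>), choose independently for each tile \<open>T c\<close> a
  point \<open>x\<close> of a maximal separated set for the metric \<open>max {\<rho> (s x) (s y) | s \<in> T}\<close>, and put
  \<open>\<phi> (\<sigma> s c) = s x\<close>. Different choices give separated maps, and equivariance fails only at the
  boundaries of the tiles and off the tiles, which is a small proportion because the shapes are
  almost invariant.
\<close>

section \<open>Quasi-tilings of approximate actions\<close>

text \<open>
  The points of \<open>D0\<close> are those at which \<open>\<sigma>\<close> behaves like a free action as far as \<open>L\<close> can tell.
  The last clause is the cancellation \<open>s c' = t c \<Longrightarrow> c' = (s\<inverse> t) c\<close>; it is all of the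
  multiplicative structure that the tiling argument uses, and it does not ask \<open>\<sigma>\<close> to map \<open>D\<close> to
  itself, so that left multiplication on a Folner set qualifies.
\<close>

definition approx_action ::
  "('g, 'r) monoid_scheme \<Rightarrow> 'g set \<Rightarrow> 'd set \<Rightarrow> 'd set \<Rightarrow> ('g \<Rightarrow> 'd \<Rightarrow> 'd) \<Rightarrow> bool" where
  "approx_action G L D D0 \<sigma> \<longleftrightarrow>
     finite D \<and> D0 \<subseteq> D \<and>
     (\<forall>c\<in>D0. \<forall>s\<in>L. \<sigma> s c \<in> D) \<and>
     (\<forall>c\<in>D0. inj_on (\<lambda>s. \<sigma> s c) L) \<and>
     (\<forall>c\<in>D0. \<forall>c'\<in>D0. \<forall>s\<in>L. \<forall>t\<in>L. \<sigma> s c' = \<sigma> t c \<longrightarrow> c' = \<sigma> (inv\<^bsub>G\<^esub> s \<otimes>\<^bsub>G\<^esub> t) c)"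

definition tile :: "('g \<Rightarrow> 'd \<Rightarrow> 'd) \<Rightarrow> 'd \<times> 'g set \<Rightarrow> 'd set" where
  "tile \<sigma> p = (\<lambda>s. \<sigma> s (fst p)) ` snd p"

lemma card_tile:
  assumes "approx_action G L D D0 \<sigma>" "fst p \<in> D0" "snd p \<subseteq> L"
  shows "card (tile \<sigma> p) = card (snd p)"
proof -
  have "inj_on (\<lambda>s. \<sigma> s (fst p)) (snd p)"
    using assms by (auto simp: approx_action_def intro: inj_on_subset)
  then show ?thesis by (simp add: tile_def card_image)
qed

text \<open>
  Cancellation with \<open>t = s\<close> makes both points equal to \<open>\<sigma> (s\<inverse> s)\<close> of the second one.
\<close>

lemma approx_action_same_element:
  assumes "approx_action G L D D0 \<sigma>" "c \<in> D0" "c' \<in> D0" "s \<in> L" "\<sigma> s c' = \<sigma> s c"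
  shows "c' = c"
proof -
  have "c' = \<sigma> (inv\<^bsub>G\<^esub> s \<otimes>\<^bsub>G\<^esub> s) c" "c = \<sigma> (inv\<^bsub>G\<^esub> s \<otimes>\<^bsub>G\<^esub> s) c"
    using assms unfolding approx_action_def by blast+
  then show ?thesis by simp
qed

text \<open>
  Counting the pairs \<open>(c, s)\<close> with \<open>\<sigma> s c \<in> B\<close>: each \<open>c\<close> has at least \<open>\<eta> |F|\<close> of them, while
  each of the \<open>|F|\<close> elements \<open>s\<close> has at most \<open>|B|\<close> of them, because \<open>\<sigma> s\<close> is injective on good
  points.
\<close>

lemma double_count_hits:
  assumes act: "approx_action G L D D0 \<sigma>" and F: "F \<subseteq> L" "finite F"
    and D1: "D1 \<subseteq> D0" and B: "finite B"
    and hits: "\<And>c. c \<in> D1 \<Longrightarrow> \<eta> * real (card F) \<le> real (card {s\<in>F. \<sigma> s c \<in> B})"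
    and ne: "F \<noteq> {}"
  shows "\<eta> * real (card D1) \<le> real (card B)"
proof -
  have finD1: "finite D1"
    using act D1 unfolding approx_action_def by (meson finite_subset)
  have "(\<Sum>c\<in>D1. card {s\<in>F. \<sigma> s c \<in> B}) = (\<Sum>s\<in>F. card {c\<in>D1. \<sigma> s c \<in> B})"
    by (rule sum_multicount_gen) (use finD1 F in auto)
  also have "\<dots> \<le> (\<Sum>s\<in>F. card B)"
  proof (rule sum_mono)
    fix s assume s: "s \<in> F"
    have "inj_on (\<sigma> s) {c\<in>D1. \<sigma> s c \<in> B}"
      using approx_action_same_element[OF act] D1 F s by (intro inj_onI) blast
    then show "card {c\<in>D1. \<sigma> s c \<in> B} \<le> card B"
      using B by (metis (no_types, lifting) card_inj_on_le image_subsetI mem_Collect_eq)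
  qed
  finally have "(\<Sum>c\<in>D1. card {s\<in>F. \<sigma> s c \<in> B}) \<le> card F * card B" by simp
  then have "real (\<Sum>c\<in>D1. card {s\<in>F. \<sigma> s c \<in> B}) \<le> real (card F * card B)"
    by (rule of_nat_mono)
  then have "(\<Sum>c\<in>D1. real (card {s\<in>F. \<sigma> s c \<in> B})) \<le> real (card F) * real (card B)"
    by simp
  moreover have "(\<Sum>c\<in>D1. \<eta> * real (card F)) \<le> (\<Sum>c\<in>D1. real (card {s\<in>F. \<sigma> s c \<in> B}))"
    by (rule sum_mono) (rule hits)
  ultimately have "real (card F) * (\<eta> * real (card D1)) \<le> real (card F) * real (card B)"
    by (simp add: algebra_simps)
  moreover have "real (card F) > 0" using F ne by (simp add: card_gt_0_iff)
  ultimately show ?thesis by (simp only: mult_le_cancel_left_pos)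
qed

text \<open>
  \<open>A\<close> is what earlier tiles cover. A tile is a translate of \<open>F\<close> from which the already covered
  points are removed, so the covered region is also the union of the full translates of \<open>F\<close>.
  This is what the last condition keeps: the boundary of the covered region is then controlled
  by the boundaries of full shapes, and these are small by invariance.
\<close>

definition tile_packing where
  "tile_packing \<sigma> D0 \<eta> F A \<T> \<longleftrightarrow>
     disjoint_family_on (tile \<sigma>) \<T> \<and>
     (\<forall>p\<in>\<T>. fst p \<in> D0 \<and> snd p \<subseteq> F \<and> (1 - \<eta>) * real (card F) \<le> real (card (snd p)) \<and>
        tile \<sigma> p \<inter> A = {} \<and> tile \<sigma> (fst p, F) \<subseteq> A \<union> \<Union>(tile \<sigma> ` \<T>))"

text \<open>
  In a maximal packing every translate of \<open>F\<close> hits the covered region in at least the proportion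
  \<open>\<eta>\<close>; otherwise its uncovered part could be added as a further tile.
\<close>

lemma maximal_tile_packing:
  assumes act: "approx_action G L D D0 \<sigma>" and F: "F \<subseteq> L" "finite F" "F \<noteq> {}"
    and \<eta>: "0 < \<eta>" "\<eta> < 1"
  obtains \<T> where "tile_packing \<sigma> D0 \<eta> F A \<T>" "finite \<T>"
    "\<And>c. c \<in> D0 \<Longrightarrow> \<eta> * real (card F) \<le> real (card {s\<in>F. \<sigma> s c \<in> A \<union> \<Union>(tile \<sigma> ` \<T>)})"
proof -
  define \<P> where "\<P> = {\<T>. tile_packing \<sigma> D0 \<eta> F A \<T>}"
  have finD: "finite D0" using act unfolding approx_action_def by (meson finite_subset)
  have "\<P> \<subseteq> Pow (D0 \<times> Pow F)"
    unfolding \<P>_def tile_packing_def by (force simp: mem_Times_iff)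
  then have "finite \<P>" using finD F by (meson finite_Pow_iff finite_SigmaI finite_subset)
  moreover have "{} \<in> \<P>" by (simp add: \<P>_def tile_packing_def disjoint_family_on_def)
  ultimately obtain \<T> where T: "\<T> \<in> \<P>" and max: "\<And>\<T>'. \<T>' \<in> \<P> \<Longrightarrow> \<T> \<subseteq> \<T>' \<Longrightarrow> \<T> = \<T>'"
    using finite_has_maximal[of \<P>] by blast
  have finT: "finite \<T>"
    using T \<open>\<P> \<subseteq> Pow (D0 \<times> Pow F)\<close> finD F by (meson finite_Pow_iff finite_SigmaI finite_subset in_mono PowD)
  define A' where "A' = A \<union> \<Union>(tile \<sigma> ` \<T>)"
  have "\<eta> * real (card F) \<le> real (card {s\<in>F. \<sigma> s c \<in> A'})" if c: "c \<in> D0" for c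
  proof (rule ccontr)
    assume "\<not> ?thesis"
    then have less: "real (card {s\<in>F. \<sigma> s c \<in> A'}) < \<eta> * real (card F)" by simp
    define p where "p = (c, {s\<in>F. \<sigma> s c \<notin> A'})"
    have "card F = card {s\<in>F. \<sigma> s c \<in> A'} + card {s\<in>F. \<sigma> s c \<notin> A'}"
      using F by (subst card_Un_disjoint[symmetric]) (auto intro: arg_cong[where f = card])
    then have big: "(1 - \<eta>) * real (card F) < real (card (snd p))"
      using less by (simp add: p_def algebra_simps)
    then have "card (snd p) \<noteq> 0" using \<eta> by (smt (verit) mult_nonneg_nonneg of_nat_0 of_nat_0_le_iff)
    then obtain s where s: "s \<in> F" "\<sigma> s c \<notin> A'" unfolding p_def by (metis (mono_tags, lifting) card.empty empty_Collect_eq snd_conv)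
    have disj: "tile \<sigma> p \<inter> A' = {}" by (auto simp: p_def tile_def)
    have "\<sigma> s c \<in> tile \<sigma> p" using s by (simp add: p_def tile_def)
    then have "p \<notin> \<T>" using disj by (auto simp: A'_def)
    moreover have "tile_packing \<sigma> D0 \<eta> F A (insert p \<T>)"
    proof -
      have "disjoint_family_on (tile \<sigma>) (insert p \<T>)"
        using T disj \<open>p \<notin> \<T>\<close> unfolding \<P>_def tile_packing_def A'_def
        by (subst disjoint_family_on_insert) (auto; blast)+
      moreover have "fst q \<in> D0 \<and> snd q \<subseteq> F \<and> (1 - \<eta>) * real (card F) \<le> real (card (snd q)) \<and>
        tile \<sigma> q \<inter> A = {} \<and> tile \<sigma> (fst q, F) \<subseteq> A \<union> \<Union>(tile \<sigma> ` insert p \<T>)"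
        if "q \<in> insert p \<T>" for q
      proof (cases "q = p")
        case True
        then show ?thesis
          using c big disj by (auto simp: p_def A'_def tile_def)
      next
        case False
        then show ?thesis using that T unfolding \<P>_def tile_packing_def by auto
      qed
      ultimately show ?thesis unfolding tile_packing_def by blast
    qed
    ultimately show False using max[of "insert p \<T>"] by (auto simp: \<P>_def)
  qed
  then show thesis using that[of \<T>] T finT by (simp add: \<P>_def A'_def)
qed

text \<open>
  The greedy construction of Ornstein and Weiss, starting with the head of the list, which is
  almost invariant under all later shapes. If \<open>A\<close> is covered so far, then each point outside
  \<open>A\<close>, up to bad points and the boundary of \<open>A\<close>, has a translate of the next shape that avoids
  \<open>A\<close>; in a maximal packing this translate has a proportion \<open>\<eta>\<close> of newly covered points, so by
  double counting the new tiles cover a proportion \<open>\<eta>\<close> of what was left. The uncovered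
  proportion therefore decays like \<open>(1 - \<eta>)^n\<close>, up to the error \<open>2 \<kappa>\<close> from the boundary and the
  bad points.
\<close>

lemma quasi_tiling_by_shapes:
  fixes G (structure)
  assumes act: "approx_action G L D D0 \<sigma>"
    and \<eta>: "0 < \<eta>" "\<eta> \<le> 1/2" and \<kappa>: "0 \<le> \<kappa>"
    and shapes: "\<And>F. F \<in> set \<F> \<Longrightarrow> F \<subseteq> L \<and> finite F \<and> F \<noteq> {}"
    and inv: "sorted_wrt (\<lambda>F F'. real (card ((set_inv F' <#> F) - F)) \<le> \<kappa> * real (card F)) \<F>"
    and fin_inv: "\<And>F F'. F \<in> set \<F> \<Longrightarrow> F' \<in> set \<F> \<Longrightarrow> finite (set_inv F' <#> F)"
  shows "\<exists>\<T>. finite \<T> \<and> disjoint_family_on (tile \<sigma>) \<T> \<and>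
     (\<forall>p\<in>\<T>. fst p \<in> D0 \<and> (\<exists>F\<in>set \<F>. snd p \<subseteq> F \<and> (1 - \<eta>) * real (card F) \<le> real (card (snd p)) \<and>
        tile \<sigma> (fst p, F) \<subseteq> \<Union>(tile \<sigma> ` \<T>))) \<and>
     real (card (D - \<Union>(tile \<sigma> ` \<T>))) \<le>
       (1 - \<eta>) ^ length \<F> * real (card D) + 2 * \<kappa> * real (card D) + real (card (D - D0))"
  using shapes inv fin_inv
proof (induction \<F> rule: rev_induct)
  case Nil
  show ?case
    by (rule exI[of _ "{}"]) (use \<kappa> in \<open>auto simp: disjoint_family_on_def\<close>)
next
  case (snoc F \<F>)
  have finD: "finite D" and D0: "D0 \<subseteq> D" using act unfolding approx_action_def by auto
  define b where "b = 2 * \<kappa> * real (card D) + real (card (D - D0))"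
  obtain \<T> where finT: "finite \<T>" and disT: "disjoint_family_on (tile \<sigma>) \<T>"
    and T: "\<And>p. p \<in> \<T> \<Longrightarrow> fst p \<in> D0 \<and> (\<exists>F\<in>set \<F>. snd p \<subseteq> F \<and>
        (1 - \<eta>) * real (card F) \<le> real (card (snd p)) \<and> tile \<sigma> (fst p, F) \<subseteq> \<Union>(tile \<sigma> ` \<T>))"
    and unc: "real (card (D - \<Union>(tile \<sigma> ` \<T>))) \<le> (1 - \<eta>) ^ length \<F> * real (card D) + b"
  proof -
    have 1: "\<And>F'. F' \<in> set \<F> \<Longrightarrow> F' \<subseteq> L \<and> finite F' \<and> F' \<noteq> {}"
      using snoc.prems(1) by simp
    have 2: "sorted_wrt (\<lambda>F F'. real (card ((set_inv F' <#> F) - F)) \<le> \<kappa> * real (card F)) \<F>"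
      using snoc.prems(2) by (simp add: sorted_wrt_append)
    have 3: "\<And>F F'. F \<in> set \<F> \<Longrightarrow> F' \<in> set \<F> \<Longrightarrow> finite (set_inv F' <#> F)"
      using snoc.prems(3) by simp
    from snoc.IH[OF 1 2 3] show thesis using that by (auto simp: b_def add.assoc)
  qed
  define A where "A = \<Union>(tile \<sigma> ` \<T>)"
  have F: "F \<subseteq> L" "finite F" "F \<noteq> {}" using snoc.prems by auto
  obtain \<T>' where pack: "tile_packing \<sigma> D0 \<eta> F A \<T>'" and finT': "finite \<T>'"
    and hits: "\<And>c. c \<in> D0 \<Longrightarrow> \<eta> * real (card F) \<le> real (card {s\<in>F. \<sigma> s c \<in> A \<union> \<Union>(tile \<sigma> ` \<T>')})"
    by (rule maximal_tile_packing[OF act F, of \<eta> A]) (use \<eta> in auto)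
  define A' where "A' = A \<union> \<Union>(tile \<sigma> ` \<T>')"
  obtain sh where sh: "\<And>p. p \<in> \<T> \<Longrightarrow> sh p \<in> set \<F> \<and> snd p \<subseteq> sh p \<and>
        (1 - \<eta>) * real (card (sh p)) \<le> real (card (snd p)) \<and> tile \<sigma> (fst p, sh p) \<subseteq> A"
    using T unfolding A_def by metis
  have snd_L: "snd p \<subseteq> L" if "p \<in> \<T>" for p using sh[OF that] snoc.prems(1) by fastforce
  have tileD: "tile \<sigma> p \<subseteq> D" if "fst p \<in> D0" "snd p \<subseteq> L" for p
    using act that unfolding approx_action_def tile_def by blast
  have AD: "A \<subseteq> D" unfolding A_def using T snd_L tileD by blast
  have A'D: "A' \<subseteq> D" unfolding A'_def using AD pack F tileD unfolding tile_packing_def by blast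
  have finA: "finite A" and finA': "finite A'" using AD A'D finD finite_subset by blast+
  have sum_shapes: "(\<Sum>p\<in>\<T>. real (card (sh p))) \<le> 2 * real (card D)"
  proof -
    have "(\<Sum>p\<in>\<T>. real (card (sh p))) \<le> (\<Sum>p\<in>\<T>. 2 * real (card (tile \<sigma> p)))"
    proof (rule sum_mono)
      fix p assume p: "p \<in> \<T>"
      \<comment> \<open>Trimming removes at most half of a shape, so the shapes have total size at most
        \<open>2 |D|\<close>.\<close>
      have "(1/2) * real (card (sh p)) \<le> (1 - \<eta>) * real (card (sh p))"
        using \<eta> by (intro mult_right_mono) auto
      then show "real (card (sh p)) \<le> 2 * real (card (tile \<sigma> p))"
        using sh[OF p] card_tile[OF act, of p] T[OF p] snd_L[OF p] by simp
    qed
    also have "\<dots> = 2 * real (\<Sum>p\<in>\<T>. card (tile \<sigma> p))" by (simp add: sum_distrib_left)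
    also have "(\<Sum>p\<in>\<T>. card (tile \<sigma> p)) = card A"
      unfolding A_def using finT disT finA
      by (intro card_UN_disjoint[symmetric]) (auto simp: A_def disjoint_family_on_def intro: finite_subset)
    also have "card A \<le> card D" using AD finD by (rule card_mono[rotated])
    finally show ?thesis by simp
  qed
  \<comment> \<open>A point outside \<open>A\<close> whose translate meets a tile \<open>sh p\<close> lies, by cancellation, in
    \<open>F\<inverse> sh p - sh p\<close> translated to the centre of that tile, and invariance bounds the size of
    this set.\<close>
  define Bd where "Bd = {c \<in> D0 - A. \<exists>s\<in>F. \<sigma> s c \<in> A}"
  have "Bd \<subseteq> (\<Union>p\<in>\<T>. (\<lambda>g. \<sigma> g (fst p)) ` ((set_inv F <#> sh p) - sh p))"
  proof
    fix c assume "c \<in> Bd"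
    then obtain s where c: "c \<in> D0" "c \<notin> A" and s: "s \<in> F" "\<sigma> s c \<in> A" unfolding Bd_def by auto
    then obtain p t where p: "p \<in> \<T>" and t: "t \<in> snd p" "\<sigma> s c = \<sigma> t (fst p)"
      unfolding A_def tile_def by auto
    have tL: "t \<in> L" using t(1) snd_L[OF p] by blast
    have ceq: "c = \<sigma> (inv s \<otimes> t) (fst p)"
      using act c(1) T[OF p] s F t(2) tL unfolding approx_action_def by blast
    have "inv s \<otimes> t \<in> set_inv F <#> sh p"
      using s t sh[OF p] unfolding set_mult_def SET_INV_def by blast
    moreover have "inv s \<otimes> t \<notin> sh p"
      using sh[OF p] c(2) ceq unfolding tile_def by auto
    ultimately show "c \<in> (\<Union>p\<in>\<T>. (\<lambda>g. \<sigma> g (fst p)) ` ((set_inv F <#> sh p) - sh p))"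
      using p ceq by blast
  qed
  moreover have fin_sh: "finite (set_inv F <#> sh p)" if "p \<in> \<T>" for p
    using snoc.prems(3) sh[OF that] by auto
  ultimately have "card Bd \<le> card (\<Union>p\<in>\<T>. (\<lambda>g. \<sigma> g (fst p)) ` ((set_inv F <#> sh p) - sh p))"
    using finT by (intro card_mono) auto
  also have "\<dots> \<le> (\<Sum>p\<in>\<T>. card ((\<lambda>g. \<sigma> g (fst p)) ` ((set_inv F <#> sh p) - sh p)))"
    by (rule card_UN_le[OF finT])
  also have "\<dots> \<le> (\<Sum>p\<in>\<T>. card ((set_inv F <#> sh p) - sh p))"
    by (intro sum_mono card_image_le finite_Diff fin_sh)
  finally have "real (card Bd) \<le> real (\<Sum>p\<in>\<T>. card ((set_inv F <#> sh p) - sh p))"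
    by (rule of_nat_mono)
  also have "\<dots> = (\<Sum>p\<in>\<T>. real (card ((set_inv F <#> sh p) - sh p)))" by simp
  also have "\<dots> \<le> (\<Sum>p\<in>\<T>. \<kappa> * real (card (sh p)))"
    using snoc.prems(2) sh by (intro sum_mono) (simp add: sorted_wrt_append)
  also have "\<dots> = \<kappa> * (\<Sum>p\<in>\<T>. real (card (sh p)))" by (simp add: sum_distrib_left)
  also have "\<dots> \<le> \<kappa> * (2 * real (card D))" using sum_shapes \<kappa> by (rule mult_left_mono)
  finally have bd: "real (card Bd) \<le> 2 * \<kappa> * real (card D)" by simp
  define D1 where "D1 = D0 - A - Bd"
  have "\<eta> * real (card D1) \<le> real (card (A' - A))"
  proof (rule double_count_hits[OF act F(1,2) _ _ _ F(3)])
    fix c assume c: "c \<in> D1"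
    then have "{s\<in>F. \<sigma> s c \<in> A'} = {s\<in>F. \<sigma> s c \<in> A' - A}" unfolding D1_def Bd_def by auto
    then show "\<eta> * real (card F) \<le> real (card {s\<in>F. \<sigma> s c \<in> A' - A})"
      using hits[of c] c unfolding A'_def D1_def by auto
  qed (use finA' in \<open>auto simp: D1_def\<close>)
  moreover have "real (card (D - A)) \<le> real (card D1) + b"
  proof -
    have "D - A \<subseteq> D1 \<union> Bd \<union> (D - D0)" unfolding D1_def by auto
    then have "card (D - A) \<le> card (D1 \<union> Bd \<union> (D - D0))"
      using finD D0 by (intro card_mono) (auto simp: D1_def Bd_def intro: finite_subset)
    also have "\<dots> \<le> card D1 + card Bd + card (D - D0)"
      by (meson card_Un_le add_right_mono le_trans)
    finally show ?thesis using bd unfolding b_def by simp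
  qed
  moreover have "real (card (D - A')) = real (card (D - A)) - real (card (A' - A))"
  proof -
    have "D - A = (D - A') \<union> (A' - A)" using A'D by (auto simp: A'_def)
    then have "card (D - A) = card (D - A') + card (A' - A)"
      using finD finA' by (metis Diff_disjoint Int_Diff card_Un_disjoint finite_Diff inf_commute)
    then show ?thesis by simp
  qed
  ultimately have "real (card (D - A')) \<le> real (card (D - A)) - \<eta> * (real (card (D - A)) - b)"
    using \<eta> by (smt (verit) mult_left_mono)
  also have "\<dots> = (1 - \<eta>) * (real (card (D - A)) - b) + b" by (simp add: algebra_simps)
  also have "\<dots> \<le> (1 - \<eta>) * ((1 - \<eta>) ^ length \<F> * real (card D)) + b"
    using unc \<eta> unfolding A_def by (intro add_right_mono mult_left_mono) auto
  finally have final: "real (card (D - A')) \<le> (1 - \<eta>) ^ length (\<F> @ [F]) * real (card D) + b" by simp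
  have un: "\<Union>(tile \<sigma> ` (\<T> \<union> \<T>')) = A'" unfolding A'_def A_def by auto
  show ?case
  proof (intro exI[of _ "\<T> \<union> \<T>'"] conjI ballI, goal_cases)
    case 1 show ?case using finT finT' by simp
  next
    case 2
    have cross: "tile \<sigma> p \<inter> tile \<sigma> q = {}" if "p \<in> \<T>" "q \<in> \<T>'" for p q
      using that pack unfolding tile_packing_def A_def by blast
    show ?case unfolding disjoint_family_on_def
    proof (intro ballI impI)
      fix p q assume "p \<in> \<T> \<union> \<T>'" "q \<in> \<T> \<union> \<T>'" "p \<noteq> q"
      then consider "p \<in> \<T>" "q \<in> \<T>" | "p \<in> \<T>" "q \<in> \<T>'" | "q \<in> \<T>" "p \<in> \<T>'" | "p \<in> \<T>'" "q \<in> \<T>'"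
        by blast
      then show "tile \<sigma> p \<inter> tile \<sigma> q = {}"
        using \<open>p \<noteq> q\<close> disT pack cross[of p q] cross[of q p]
        unfolding tile_packing_def disjoint_family_on_def by cases (simp_all add: Int_commute)
    qed
  next
    case (3 p)
    show ?case
    proof (cases "p \<in> \<T>")
      case True
      then show ?thesis using T by blast
    next
      case False
      then show ?thesis using 3 pack unfolding tile_packing_def by blast
    qed
  next
    case (4 p)
    show ?case
    proof (cases "p \<in> \<T>")
      case True
      then have "tile \<sigma> (fst p, sh p) \<subseteq> A'" using sh unfolding A'_def by blast
      then show ?thesis unfolding un using sh[OF True] by auto
    next
      case False
      then show ?thesis unfolding un using 4 pack unfolding tile_packing_def A'_def by auto
    qed
  next
    case 5 show ?case unfolding un using final by (simp add: b_def)
  qed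
qed

lemma sum_over_tiles:
  fixes g :: "'d \<Rightarrow> 'b :: comm_monoid_add"
  assumes act: "approx_action G L D D0 \<sigma>" and L: "finite L" and T: "finite \<T>" "\<T> \<subseteq> D0 \<times> Pow L"
    and disj: "disjoint_family_on (tile \<sigma>) \<T>"
  shows "(\<Sum>a\<in>D. g a) = (\<Sum>p\<in>\<T>. \<Sum>s\<in>snd p. g (\<sigma> s (fst p))) + (\<Sum>a\<in>D - \<Union>(tile \<sigma> ` \<T>). g a)"
proof -
  have finD: "finite D" using act by (simp add: approx_action_def)
  have p: "fst p \<in> D0" "snd p \<subseteq> L" if "p \<in> \<T>" for p
    using subsetD[OF T(2) that] by (auto simp: mem_Times_iff)
  have sub: "\<Union>(tile \<sigma> ` \<T>) \<subseteq> D"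
    using act p unfolding approx_action_def tile_def by blast
  have fin: "finite (tile \<sigma> p)" if "p \<in> \<T>" for p
    using p[OF that] L unfolding tile_def by (meson finite_imageI finite_subset)
  have "(\<Sum>a\<in>D. g a) = (\<Sum>a\<in>D - \<Union>(tile \<sigma> ` \<T>). g a) + (\<Sum>a\<in>\<Union>(tile \<sigma> ` \<T>). g a)"
    by (rule sum.subset_diff[OF sub finD])
  also have "(\<Sum>a\<in>\<Union>(tile \<sigma> ` \<T>). g a) = (\<Sum>p\<in>\<T>. \<Sum>a\<in>tile \<sigma> p. g a)"
    using T(1) fin disj by (intro sum.UNION_disjoint) (auto simp: disjoint_family_on_def)
  also have "\<dots> = (\<Sum>p\<in>\<T>. \<Sum>s\<in>snd p. g (\<sigma> s (fst p)))"
  proof (rule sum.cong)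
    fix q assume q: "q \<in> \<T>"
    have "inj_on (\<lambda>s. \<sigma> s (fst q)) (snd q)"
      using act p[OF q] unfolding approx_action_def by (blast intro: inj_on_subset)
    then show "(\<Sum>a\<in>tile \<sigma> q. g a) = (\<Sum>s\<in>snd q. g (\<sigma> s (fst q)))"
      unfolding tile_def by (simp add: sum.reindex)
  qed simp
  finally show ?thesis by (simp add: add.commute)
qed

section \<open>Almost invariant shapes\<close>

lemma eventually_left_invariant:
  assumes "K \<in> nonempty_finite_subsets G" "\<kappa> > 0"
  shows "\<forall>\<^sub>F F in left_invariant_filter G. F \<in> nonempty_finite_subsets G \<and>
           real (card (sym_diff (K <#>\<^bsub>G\<^esub> F) F)) \<le> \<kappa> * real (card F)"
proof -
  have "left_invariant_filter G \<le> principal {F \<in> nonempty_finite_subsets G.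
          real (card (sym_diff (K <#>\<^bsub>G\<^esub> F) F)) \<le> \<kappa> * real (card F)}"
    unfolding left_invariant_filter_def
    by (rule INF_lower2[of "(K, \<kappa>)"]) (use assms in auto)
  then show ?thesis by (simp add: le_principal)
qed

lemma finite_set_mult: "finite K \<Longrightarrow> finite F \<Longrightarrow> finite (K <#>\<^bsub>G\<^esub> F)"
  by (simp add: set_mult_def)

lemma (in group) one_nonempty_finite: "{\<one>} \<in> nonempty_finite_subsets G"
  by (simp add: nonempty_finite_subsets_def)

lemma (in group) eventually_nonempty_finite:
  "\<forall>\<^sub>F F in left_invariant_filter G. F \<in> nonempty_finite_subsets G"
  using eventually_left_invariant[OF one_nonempty_finite, of 1] by (auto elim: eventually_mono)

lemma (in group) set_inv_nonempty_finite:
  "F \<in> nonempty_finite_subsets G \<Longrightarrow> set_inv F \<in> nonempty_finite_subsets G"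
  by (auto simp: nonempty_finite_subsets_def SET_INV_def)

text \<open>
  A Folner sequence converges along the filter: \<open>K F \<Delta> F\<close> is contained in the union of the sets
  \<open>s F \<Delta> F\<close> with \<open>s \<in> K\<close>, where \<open>K \<noteq> {}\<close> is needed for the points of \<open>F - K F\<close>.
\<close>

lemma (in group) left_invariant_filter_neq_bot:
  assumes "amenable G"
  shows "left_invariant_filter G \<noteq> bot"
proof -
  obtain Fn where Fn: "\<And>n. Fn n \<in> nonempty_finite_subsets G"
    and lim: "\<And>s. s \<in> carrier G \<Longrightarrow>
        (\<lambda>n. real (card (sym_diff (s <# Fn n) (Fn n))) / real (card (Fn n))) \<longlonglongrightarrow> 0"
    using assms unfolding amenable_def Folner_sequence_def by blast
  have fin: "finite (Fn n)" and pos: "0 < real (card (Fn n))" for n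
    using Fn[of n] by (auto simp: nonempty_finite_subsets_def card_gt_0_iff)
  have "filterlim Fn (left_invariant_filter G) sequentially"
    unfolding left_invariant_filter_def filterlim_INF
  proof (intro ballI, clarify)
    fix K and \<delta> :: real assume K: "K \<in> nonempty_finite_subsets G" and \<delta>: "0 < \<delta>"
    have finK: "finite K" and "K \<noteq> {}" and KG: "K \<subseteq> carrier G"
      using K by (auto simp: nonempty_finite_subsets_def)
    have "(\<lambda>n. \<Sum>s\<in>K. real (card (sym_diff (s <# Fn n) (Fn n))) / real (card (Fn n))) \<longlonglongrightarrow> (\<Sum>s\<in>K. 0)"
      using lim KG by (intro tendsto_sum) auto
    then have "\<forall>\<^sub>F n in sequentially. (\<Sum>s\<in>K. real (card (sym_diff (s <# Fn n) (Fn n))) / real (card (Fn n))) < \<delta>"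
      using \<delta> order_tendstoD(2) by force
    then show "filterlim Fn (principal {F \<in> nonempty_finite_subsets G.
        real (card (sym_diff (K <#> F) F)) \<le> \<delta> * real (card F)}) sequentially"
      unfolding filterlim_principal
    proof eventually_elim
      case (elim n)
      have "sym_diff (K <#> Fn n) (Fn n) \<subseteq> (\<Union>s\<in>K. sym_diff (s <# Fn n) (Fn n))"
        using \<open>K \<noteq> {}\<close> unfolding set_mult_def l_coset_def by fast
      moreover have "finite (\<Union>s\<in>K. sym_diff (s <# Fn n) (Fn n))"
        using finK fin by (auto simp: l_coset_def)
      ultimately have "card (sym_diff (K <#> Fn n) (Fn n)) \<le> card (\<Union>s\<in>K. sym_diff (s <# Fn n) (Fn n))"
        by (rule card_mono[rotated])
      also have "\<dots> \<le> (\<Sum>s\<in>K. card (sym_diff (s <# Fn n) (Fn n)))"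
        by (rule card_UN_le[OF finK])
      finally have "real (card (sym_diff (K <#> Fn n) (Fn n))) \<le> (\<Sum>s\<in>K. real (card (sym_diff (s <# Fn n) (Fn n))))"
        using of_nat_mono by fastforce
      also have "\<dots> \<le> \<delta> * real (card (Fn n))"
        using elim pos[of n] by (simp add: sum_divide_distrib[symmetric] field_simps)
      finally show ?case using Fn by simp
    qed
  qed
  then show ?thesis by (metis filtermap_bot_iff filterlim_def le_bot sequentially_bot)
qed

text \<open>
  Shapes are chosen one after another, each almost invariant under all shapes chosen before it.
  The newest comes first in the list, as tiling has to start with the most invariant shape.
\<close>

lemma (in group) invariant_shape_sequence:
  assumes freq: "\<exists>\<^sub>F F in left_invariant_filter G. P F" and \<kappa>: "\<kappa> > 0"
  shows "\<exists>\<F>. length \<F> = l \<and> (\<forall>F\<in>set \<F>. F \<in> nonempty_finite_subsets G \<and> P F) \<and>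
    sorted_wrt (\<lambda>F F'. real (card ((set_inv F' <#> F) - F)) \<le> \<kappa> * real (card F)) \<F>"
proof (induction l)
  case (Suc l)
  then obtain \<F> where \<F>: "length \<F> = l" "\<And>F. F \<in> set \<F> \<Longrightarrow> F \<in> nonempty_finite_subsets G \<and> P F"
    "sorted_wrt (\<lambda>F F'. real (card ((set_inv F' <#> F) - F)) \<le> \<kappa> * real (card F)) \<F>"
    by blast
  have "\<forall>\<^sub>F F in left_invariant_filter G. \<forall>F'\<in>set \<F>. F \<in> nonempty_finite_subsets G \<and>
           real (card (sym_diff (set_inv F' <#> F) F)) \<le> \<kappa> * real (card F)"
    by (intro eventually_ball_finite ballI eventually_left_invariant set_inv_nonempty_finite \<kappa>) (use \<F> in auto)
  from frequently_eventually_conj[OF freq eventually_conj[OF this eventually_nonempty_finite]]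
  obtain F where F: "P F" "F \<in> nonempty_finite_subsets G"
    and Finv: "\<And>F'. F' \<in> set \<F> \<Longrightarrow> real (card (sym_diff (set_inv F' <#> F) F)) \<le> \<kappa> * real (card F)"
    by (auto dest: frequently_ex)
  have "real (card ((set_inv F' <#> F) - F)) \<le> \<kappa> * real (card F)" if "F' \<in> set \<F>" for F'
  proof -
    have "finite (sym_diff (set_inv F' <#> F) F)"
      using F(2) \<F>(2)[OF that] set_inv_nonempty_finite[of F']
      by (auto simp: nonempty_finite_subsets_def intro: finite_set_mult)
    then have "card ((set_inv F' <#> F) - F) \<le> card (sym_diff (set_inv F' <#> F) F)"
      by (intro card_mono) auto
    then show ?thesis using Finv[OF that] by linarith
  qed
  then show ?case
    using F \<F> by (intro exI[of _ "F # \<F>"]) auto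
qed simp

definition quasi_tiling ::
  "('g \<Rightarrow> 'd \<Rightarrow> 'd) \<Rightarrow> 'd set \<Rightarrow> 'd set \<Rightarrow> 'g set set \<Rightarrow> real \<Rightarrow> ('d \<times> 'g set) set \<Rightarrow> bool" where
  "quasi_tiling \<sigma> D D0 \<S> \<xi> \<T> \<longleftrightarrow>
     finite \<T> \<and> \<T> \<subseteq> D0 \<times> \<S> \<and> disjoint_family_on (tile \<sigma>) \<T> \<and>
     real (card (D - \<Union>(tile \<sigma> ` \<T>))) \<le> \<xi> * real (card D)"

text \<open>
  The shapes \<open>T\<close> are the large subsets of the members of an invariant sequence, since tiles are
  trimmed translates. The three contributions to the uncovered proportion, namely the greedy
  decay, the boundary and the bad points, are each at most \<open>\<xi> / 3\<close>. The shapes are fixed before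
  the approximate action, whose quality may thus be prescribed in terms of them.
\<close>

theorem (in group) quasi_tiling_exists:
  assumes freq: "\<exists>\<^sub>F F in left_invariant_filter G. \<forall>T\<subseteq>F. (1 - \<eta>) * real (card F) \<le> real (card T) \<longrightarrow> Q T"
    and \<eta>: "0 < \<eta>" and \<xi>: "0 < \<xi>"
  obtains \<S> where "finite \<S>" "\<S> \<noteq> {}" "\<S> \<subseteq> nonempty_finite_subsets G" "\<And>T. T \<in> \<S> \<Longrightarrow> Q T"
    "\<And>(D :: 'd set) D0 \<sigma>. approx_action G (\<Union>\<S>) D D0 \<sigma> \<Longrightarrow>
        real (card (D - D0)) \<le> \<xi> / 3 * real (card D) \<Longrightarrow> \<exists>\<T>. quasi_tiling \<sigma> D D0 \<S> \<xi> \<T>"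
proof -
  define \<theta> where "\<theta> = min \<eta> (1/2)"
  have \<theta>: "0 < \<theta>" "\<theta> \<le> 1/2" "\<theta> \<le> \<eta>" using \<eta> by (auto simp: \<theta>_def)
  obtain l0 where l0: "(1 - \<theta>) ^ l0 < \<xi> / 3"
    using real_arch_pow_inv[of "\<xi> / 3" "1 - \<theta>"] \<theta> \<xi> by auto
  \<comment> \<open>One more step than necessary makes the family of shapes nonempty.\<close>
  define l where "l = Suc l0"
  have "(1 - \<theta>) ^ l \<le> (1 - \<theta>) ^ l0" unfolding l_def using \<theta> by (intro power_decreasing) auto
  with l0 have l: "(1 - \<theta>) ^ l < \<xi> / 3" by simp
  define good where "good F \<longleftrightarrow> (\<forall>T\<subseteq>F. (1 - \<eta>) * real (card F) \<le> real (card T) \<longrightarrow> Q T)" for F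
  obtain \<F> where len: "length \<F> = l"
    and \<F>: "\<And>F. F \<in> set \<F> \<Longrightarrow> F \<in> nonempty_finite_subsets G \<and> good F"
    and srt: "sorted_wrt (\<lambda>F F'. real (card ((set_inv F' <#> F) - F)) \<le> \<xi> / 6 * real (card F)) \<F>"
    using invariant_shape_sequence[of good "\<xi> / 6" l] freq \<xi> unfolding good_def by auto
  define \<S> where "\<S> = {T. \<exists>F\<in>set \<F>. T \<subseteq> F \<and> (1 - \<theta>) * real (card F) \<le> real (card T)}"
  have subF: "F \<in> \<S>" if "F \<in> set \<F>" for F
    using that \<theta> by (auto simp: \<S>_def intro!: bexI[of _ F] mult_left_le_one_le)
  have union: "\<Union>\<S> = \<Union>(set \<F>)" 
  proof
    show "\<Union>\<S> \<subseteq> \<Union>(set \<F>)" by (auto simp: \<S>_def)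
    show "\<Union>(set \<F>) \<subseteq> \<Union>\<S>" using subF by blast
  qed
  show thesis
  proof (rule that[of \<S>])
    have "\<S> \<subseteq> (\<Union>F\<in>set \<F>. Pow F)" by (auto simp: \<S>_def)
    then show "finite \<S>"
      using \<F> by (auto simp: nonempty_finite_subsets_def intro: finite_subset)
    show "\<S> \<noteq> {}" using subF len l_def by (metis empty_iff last_in_set length_0_conv nat.distinct(1))
    show "\<S> \<subseteq> nonempty_finite_subsets G"
    proof
      fix T assume "T \<in> \<S>"
      then obtain F where F: "F \<in> set \<F>" "T \<subseteq> F" "(1 - \<theta>) * real (card F) \<le> real (card T)"
        by (auto simp: \<S>_def)
      then have F': "F \<subseteq> carrier G" "finite F" "F \<noteq> {}"
        using \<F>[OF F(1)] by (auto simp: nonempty_finite_subsets_def)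
      then have "0 < (1 - \<theta>) * real (card F)" using \<theta> by (simp add: card_gt_0_iff)
      then have "T \<noteq> {}" using F(3) by auto
      then show "T \<in> nonempty_finite_subsets G"
        using F F' by (auto simp: nonempty_finite_subsets_def intro: finite_subset)
    qed
    show "Q T" if TS: "T \<in> \<S>" for T
    proof -
      obtain F where F: "F \<in> set \<F>" "T \<subseteq> F" "(1 - \<theta>) * real (card F) \<le> real (card T)"
        using TS by (auto simp: \<S>_def)
      have "(1 - \<eta>) * real (card F) \<le> (1 - \<theta>) * real (card F)"
        using \<theta> by (intro mult_right_mono) auto
      then show "Q T" using \<F>[OF F(1)] F unfolding good_def by auto
    qed
    show "\<exists>\<T>. quasi_tiling \<sigma> D D0 \<S> \<xi> \<T>"
      if act: "approx_action G (\<Union>\<S>) D D0 \<sigma>" and small: "real (card (D - D0)) \<le> \<xi> / 3 * real (card D)"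
      for D :: "'d set" and D0 \<sigma>
    proof -
      have sh: "F \<subseteq> \<Union>\<S> \<and> finite F \<and> F \<noteq> {}" if "F \<in> set \<F>" for F
        using \<F>[OF that] that unfolding union by (auto simp: nonempty_finite_subsets_def)
      have fi: "finite (set_inv F' <#> F)" if "F \<in> set \<F>" "F' \<in> set \<F>" for F F'
        using \<F>[OF that(1)] set_inv_nonempty_finite[of F'] \<F>[OF that(2)]
        by (intro finite_set_mult) (auto simp: nonempty_finite_subsets_def)
      have \<xi>6: "0 \<le> \<xi> / 6" using \<xi> by simp
      have ex: "\<exists>\<T>. finite \<T> \<and> disjoint_family_on (tile \<sigma>) \<T> \<and>
        (\<forall>p\<in>\<T>. fst p \<in> D0 \<and> (\<exists>F\<in>set \<F>. snd p \<subseteq> F \<and>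
          (1 - \<theta>) * real (card F) \<le> real (card (snd p)) \<and> tile \<sigma> (fst p, F) \<subseteq> \<Union>(tile \<sigma> ` \<T>))) \<and>
        real (card (D - \<Union>(tile \<sigma> ` \<T>))) \<le>
          (1 - \<theta>) ^ length \<F> * real (card D) + 2 * (\<xi> / 6) * real (card D) + real (card (D - D0))"
        by (rule quasi_tiling_by_shapes[OF act \<theta>(1,2) \<xi>6 sh srt fi])
      obtain \<T> where T: "finite \<T> \<and> disjoint_family_on (tile \<sigma>) \<T> \<and>
        (\<forall>p\<in>\<T>. fst p \<in> D0 \<and> (\<exists>F\<in>set \<F>. snd p \<subseteq> F \<and>
          (1 - \<theta>) * real (card F) \<le> real (card (snd p)) \<and> tile \<sigma> (fst p, F) \<subseteq> \<Union>(tile \<sigma> ` \<T>))) \<and>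
        real (card (D - \<Union>(tile \<sigma> ` \<T>))) \<le>
          (1 - \<theta>) ^ length \<F> * real (card D) + 2 * (\<xi> / 6) * real (card D) + real (card (D - D0))"
        using ex by (rule exE) (rule that)
      have "(1 - \<theta>) ^ length \<F> * real (card D) \<le> \<xi> / 3 * real (card D)"
        using l len by (intro mult_right_mono) auto
      with T small have "real (card (D - \<Union>(tile \<sigma> ` \<T>))) \<le> \<xi> * real (card D)" by simp
      moreover have "\<T> \<subseteq> D0 \<times> \<S>"
      proof
        fix p assume "p \<in> \<T>"
        then have "fst p \<in> D0" "snd p \<in> \<S>" using T unfolding \<S>_def by blast+
        then show "p \<in> D0 \<times> \<S>" by (simp add: mem_Times_iff)
      qed
      ultimately show ?thesis using T unfolding quasi_tiling_def by blast
    qed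
  qed
qed

section \<open>Folner sets and sofic approximations as approximate actions\<close>

text \<open>
  If \<open>F\<close> is almost invariant under \<open>L\<close>, left multiplication by \<open>L\<close> keeps most points of \<open>F\<close>
  inside \<open>F\<close>, and the axioms hold exactly by cancellation in the group.
\<close>

lemma (in group) Folner_approx_action:
  assumes L: "L \<subseteq> carrier G" "finite L" and \<kappa>: "\<kappa> > 0"
  shows "\<forall>\<^sub>F F in left_invariant_filter G. F \<in> nonempty_finite_subsets G \<and>
    approx_action G L F {c\<in>F. \<forall>s\<in>L. s \<otimes> c \<in> F} (\<otimes>) \<and>
    real (card (F - {c\<in>F. \<forall>s\<in>L. s \<otimes> c \<in> F})) \<le> \<kappa> * real (card F)"
proof (cases "L = {}")
  case True
  show ?thesis using eventually_nonempty_finite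
  proof eventually_elim
    case (elim F)
    then show ?case using True \<kappa> by (auto simp: approx_action_def nonempty_finite_subsets_def)
  qed
next
  case False
  then have cL: "0 < card L" using L by (simp add: card_gt_0_iff)
  have "\<forall>\<^sub>F F in left_invariant_filter G. F \<in> nonempty_finite_subsets G \<and>
           real (card (sym_diff (L <#> F) F)) \<le> \<kappa> / real (card L) * real (card F)"
    using L False \<kappa> cL by (intro eventually_left_invariant) (auto simp: nonempty_finite_subsets_def)
  then show ?thesis
  proof eventually_elim
    case (elim F)
    then have F: "F \<subseteq> carrier G" "finite F" by (auto simp: nonempty_finite_subsets_def)
    let ?D = "{c\<in>F. \<forall>s\<in>L. s \<otimes> c \<in> F}"
    have "c' = inv s \<otimes> t \<otimes> c" if "c \<in> F" "c' \<in> F" "s \<in> L" "t \<in> L" "s \<otimes> c' = t \<otimes> c" for c c' s t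
    proof -
      have car: "c \<in> carrier G" "c' \<in> carrier G" "s \<in> carrier G" "t \<in> carrier G" using that F L by auto
      then have "c' = inv s \<otimes> (s \<otimes> c')" by (simp add: m_assoc[symmetric])
      also have "\<dots> = inv s \<otimes> t \<otimes> c" using car that(5) by (simp add: m_assoc)
      finally show ?thesis .
    qed
    then have "approx_action G L F ?D (\<otimes>)"
      unfolding approx_action_def inj_on_def using F L by (auto simp: subset_iff)
    moreover have "real (card (F - ?D)) \<le> \<kappa> * real (card F)"
    proof -
      have "F - ?D \<subseteq> (\<Union>s\<in>L. {c\<in>F. s \<otimes> c \<notin> F})" by auto
      then have "card (F - ?D) \<le> card (\<Union>s\<in>L. {c\<in>F. s \<otimes> c \<notin> F})"
        using F L by (intro card_mono) auto
      also have "\<dots> \<le> (\<Sum>s\<in>L. card {c\<in>F. s \<otimes> c \<notin> F})" by (rule card_UN_le[OF L(2)])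
      also have "\<dots> \<le> (\<Sum>s\<in>L. card (sym_diff (L <#> F) F))"
      proof (rule sum_mono)
        fix s assume s: "s \<in> L"
        show "card {c\<in>F. s \<otimes> c \<notin> F} \<le> card (sym_diff (L <#> F) F)"
        proof (rule card_inj_on_le)
          show "inj_on (\<lambda>c. s \<otimes> c) {c\<in>F. s \<otimes> c \<notin> F}"
            using s L F by (auto simp: inj_on_def subset_iff)
          show "(\<lambda>c. s \<otimes> c) ` {c\<in>F. s \<otimes> c \<notin> F} \<subseteq> sym_diff (L <#> F) F"
            using s by (auto simp: set_mult_def)
          show "finite (sym_diff (L <#> F) F)" using L F by (simp add: finite_set_mult)
        qed
      qed
      also have "\<dots> = card L * card (sym_diff (L <#> F) F)" by simp
      finally have "real (card (F - ?D)) \<le> real (card L * card (sym_diff (L <#> F) F))"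
        by (rule of_nat_mono)
      also have "\<dots> = real (card L) * real (card (sym_diff (L <#> F) F))" by simp
      also have "\<dots> \<le> real (card L) * (\<kappa> / real (card L) * real (card F))"
        using elim by (intro mult_left_mono) auto
      finally show ?thesis using cL by simp
    qed
    ultimately show ?case using elim by blast
  qed
qed

definition sofic_good :: "('g, 'r) monoid_scheme \<Rightarrow> 'g set \<Rightarrow> nat \<Rightarrow> ('g \<Rightarrow> nat \<Rightarrow> nat) \<Rightarrow> nat set" where
  "sofic_good G L d \<sigma> = {a\<in>{1..d}. \<forall>s\<in>L. \<forall>t\<in>L.
     \<sigma> s (\<sigma> t a) = \<sigma> (s \<otimes>\<^bsub>G\<^esub> t) a \<and> (s \<noteq> t \<longrightarrow> \<sigma> s a \<noteq> \<sigma> t a)}"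

text \<open>
  Multiplicativity at a good point for the pair \<open>(s\<inverse>, s)\<close> gives cancellation, and for the pair
  \<open>(\<one>, \<one>)\<close>, together with injectivity of \<open>\<sigma> \<one>\<close>, it gives \<open>\<sigma> \<one> c = c\<close>. Hence \<open>L'\<close> must also
  contain inverses and the unit.
\<close>

lemma (in group) sofic_good_approx_action:
  assumes L: "L \<subseteq> carrier G" and L': "L \<subseteq> L'" "set_inv L \<subseteq> L'" "\<one> \<in> L'"
    and perm: "\<And>s. s \<in> carrier G \<Longrightarrow> \<sigma> s permutes {1..d}"
  shows "approx_action G L {1..d} (sofic_good G L' d \<sigma>) \<sigma>"
proof -
  have one: "\<sigma> \<one> c = c" if "c \<in> sofic_good G L' d \<sigma>" for c
  proof -
    have "\<sigma> \<one> (\<sigma> \<one> c) = \<sigma> \<one> c" using that L'(3) by (auto simp: sofic_good_def)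
    then show ?thesis using permutes_inj[OF perm[OF one_closed]] by (meson injD)
  qed
  have "c' = \<sigma> (inv s \<otimes> t) c"
    if c: "c \<in> sofic_good G L' d \<sigma>" "c' \<in> sofic_good G L' d \<sigma>" and st: "s \<in> L" "t \<in> L" "\<sigma> s c' = \<sigma> t c" for c c' s t
  proof -
    have sL: "inv s \<in> L'" "s \<in> L'" "t \<in> L'" using st L' by (auto simp: SET_INV_def)
    have "\<sigma> (inv s) (\<sigma> s c') = \<sigma> (inv s \<otimes> s) c'" "\<sigma> (inv s) (\<sigma> t c) = \<sigma> (inv s \<otimes> t) c"
      using c sL by (auto simp: sofic_good_def)
    moreover have "inv s \<otimes> s = \<one>" using st L by auto
    ultimately show ?thesis using one[OF c(2)] st(3) by simp
  qed
  moreover have "\<sigma> s c \<in> {1..d}" if "c \<in> sofic_good G L' d \<sigma>" "s \<in> L" for c s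
    using permutes_in_image[OF perm, of s c] that L by (auto simp: sofic_good_def)
  moreover have "inj_on (\<lambda>s. \<sigma> s c) L" if "c \<in> sofic_good G L' d \<sigma>" for c
    using that L'(1) unfolding sofic_good_def inj_on_def by blast
  moreover have "sofic_good G L' d \<sigma> \<subseteq> {1..d}" by (auto simp: sofic_good_def)
  ultimately show ?thesis unfolding approx_action_def by auto
qed

lemma eventually_few_exceptions:
  assumes lim: "(\<lambda>i. 1 / real (d i) * real (card {a\<in>{1..d i}. P i a})) \<longlonglongrightarrow> 1"
    and d: "filterlim d at_top sequentially" and \<kappa>: "\<kappa> > 0"
  shows "\<forall>\<^sub>F i in sequentially. real (card {a\<in>{1..d i}. \<not> P i a}) \<le> \<kappa> * real (d i)"
proof -
  have "\<forall>\<^sub>F i in sequentially. 1 \<le> d i" using d by (simp add: filterlim_at_top)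
  moreover have "\<forall>\<^sub>F i in sequentially. 1 - \<kappa> < 1 / real (d i) * real (card {a\<in>{1..d i}. P i a})"
    using lim \<kappa> by (intro order_tendstoD) auto
  ultimately show ?thesis
  proof eventually_elim
    case (elim i)
    have "card ({a\<in>{1..d i}. P i a} \<union> {a\<in>{1..d i}. \<not> P i a}) = card {a\<in>{1..d i}. P i a} + card {a\<in>{1..d i}. \<not> P i a}"
      by (rule card_Un_disjoint) auto
    moreover have "{a\<in>{1..d i}. P i a} \<union> {a\<in>{1..d i}. \<not> P i a} = {1..d i}" by auto
    ultimately have "real (d i) = real (card {a\<in>{1..d i}. P i a}) + real (card {a\<in>{1..d i}. \<not> P i a})" by simp
    moreover have "(1 - \<kappa>) * real (d i) < real (card {a\<in>{1..d i}. P i a})"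
      using elim by (simp add: field_simps)
    ultimately show ?case by (simp add: algebra_simps)
  qed
qed

lemma (in group) eventually_mostly_sofic_good:
  assumes sof: "sofic_approximation_sequence G d \<sigma>" and L: "L \<subseteq> carrier G" "finite L" and \<kappa>: "\<kappa> > 0"
  shows "\<forall>\<^sub>F i in sequentially. real (card ({1..d i} - sofic_good G L (d i) (\<sigma> i))) \<le> \<kappa> * real (d i)"
proof -
  \<comment> \<open>Two exceptional sets for each pair in \<open>L \<times> L\<close>; the added 1 covers the case of empty \<open>L\<close>.\<close>
  define \<kappa>' where "\<kappa>' = \<kappa> / (2 * (real (card (L \<times> L)) + 1))"
  have \<kappa>': "\<kappa>' > 0" using \<kappa> by (auto simp: \<kappa>'_def intro!: divide_pos_pos add_nonneg_pos)
  have d: "filterlim d at_top sequentially" using sof by (simp add: sofic_approximation_sequence_def)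
  define M where "M p i = {a\<in>{1..d i}. \<not> \<sigma> i (fst p) (\<sigma> i (snd p) a) = \<sigma> i (fst p \<otimes> snd p) a}" for p i
  define N where "N p i = {a\<in>{1..d i}. \<not> (fst p \<noteq> snd p \<longrightarrow> \<sigma> i (fst p) a \<noteq> \<sigma> i (snd p) a)}" for p i
  have "\<forall>\<^sub>F i in sequentially. \<forall>p\<in>L \<times> L. real (card (M p i)) \<le> \<kappa>' * real (d i)"
    using sof L \<kappa>' unfolding M_def
    by (intro eventually_ball_finite ballI eventually_few_exceptions d)
      (auto simp: sofic_approximation_sequence_def subset_iff)
  moreover have "\<forall>\<^sub>F i in sequentially. \<forall>p\<in>L \<times> L. real (card (N p i)) \<le> \<kappa>' * real (d i)"
  proof (intro eventually_ball_finite ballI)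
    fix p assume p: "p \<in> L \<times> L"
    show "\<forall>\<^sub>F i in sequentially. real (card (N p i)) \<le> \<kappa>' * real (d i)"
    proof (cases "fst p = snd p")
      case True
      then show ?thesis using \<kappa>' by (simp add: N_def)
    next
      case False
      then show ?thesis
        using sof L \<kappa>' p unfolding N_def
        by (intro eventually_few_exceptions d) (auto simp: sofic_approximation_sequence_def subset_iff)
    qed
  qed (use L in simp)
  ultimately show ?thesis
  proof eventually_elim
    case (elim i)
    have "{1..d i} - sofic_good G L (d i) (\<sigma> i) \<subseteq> (\<Union>p\<in>L \<times> L. M p i \<union> N p i)"
    proof
      fix a assume "a \<in> {1..d i} - sofic_good G L (d i) (\<sigma> i)"
      then obtain s t where "s \<in> L" "t \<in> L" "a \<in> {1..d i}"
        "\<sigma> i s (\<sigma> i t a) \<noteq> \<sigma> i (s \<otimes> t) a \<or> s \<noteq> t \<and> \<sigma> i s a = \<sigma> i t a"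
        unfolding sofic_good_def by blast
      then have "(s, t) \<in> L \<times> L" "a \<in> M (s, t) i \<union> N (s, t) i" by (auto simp: M_def N_def)
      then show "a \<in> (\<Union>p\<in>L \<times> L. M p i \<union> N p i)" by blast
    qed
    moreover have fin: "finite (M p i)" "finite (N p i)" for p by (auto simp: M_def N_def)
    ultimately have "card ({1..d i} - sofic_good G L (d i) (\<sigma> i)) \<le> card (\<Union>p\<in>L \<times> L. M p i \<union> N p i)"
      using L by (intro card_mono) auto
    also have "\<dots> \<le> (\<Sum>p\<in>L \<times> L. card (M p i \<union> N p i))"
      using L by (intro card_UN_le) auto
    also have "\<dots> \<le> (\<Sum>p\<in>L \<times> L. card (M p i) + card (N p i))"
      by (intro sum_mono card_Un_le)
    finally have "real (card ({1..d i} - sofic_good G L (d i) (\<sigma> i))) \<le> real (\<Sum>p\<in>L \<times> L. card (M p i) + card (N p i))"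
      by (rule of_nat_mono)
    also have "\<dots> = (\<Sum>p\<in>L \<times> L. real (card (M p i)) + real (card (N p i)))" by simp
    also have "\<dots> \<le> (\<Sum>p\<in>L \<times> L. \<kappa>' * real (d i) + \<kappa>' * real (d i))"
      using elim by (intro sum_mono add_mono) auto
    also have "\<dots> = (real (card (L \<times> L)) * (2 * \<kappa>')) * real (d i)" by simp
    also have "\<dots> \<le> \<kappa> * real (d i)"
    proof (rule mult_right_mono)
      have "real (card (L \<times> L)) * (2 * \<kappa>') \<le> (real (card (L \<times> L)) + 1) * (2 * \<kappa>')"
        using \<kappa>' by (intro mult_right_mono) auto
      also have "\<dots> = \<kappa>" unfolding \<kappa>'_def by (simp add: field_simps)
      finally show "real (card (L \<times> L)) * (2 * \<kappa>') \<le> \<kappa>" .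
    qed simp
    finally show ?case .
  qed
qed

lemma eventually_sofic_dim_pos:
  assumes "sofic_approximation_sequence G d \<sigma>"
  shows "\<forall>\<^sub>F i in sequentially. 0 < d i"
proof -
  have "\<forall>\<^sub>F i in sequentially. 1 \<le> d i"
    using assms by (simp add: sofic_approximation_sequence_def filterlim_at_top)
  then show ?thesis by eventually_elim simp
qed

text \<open>
  The quasi-tiling theorem in a sofic approximation. The extra set \<open>K\<close> of group elements is
  there to compare \<open>\<sigma> t\<close> with tiles: on a tile, \<open>\<sigma> t\<close> acts by left multiplication of the shape.
\<close>

lemma (in group) sofic_quasi_tiling_exists:
  assumes freq: "\<exists>\<^sub>F F in left_invariant_filter G. \<forall>T\<subseteq>F. (1 - \<eta>) * real (card F) \<le> real (card T) \<longrightarrow> Q T"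
    and \<eta>: "0 < \<eta>" and \<xi>: "0 < \<xi>"
    and sof: "sofic_approximation_sequence G d \<sigma>" and K: "K \<subseteq> carrier G" "finite K"
  obtains \<S> where "finite \<S>" "\<S> \<noteq> {}" "\<S> \<subseteq> nonempty_finite_subsets G" "\<And>T. T \<in> \<S> \<Longrightarrow> Q T"
    "\<forall>\<^sub>F i in sequentially. 0 < d i \<and> (\<exists>D0 \<T>. approx_action G (\<Union>\<S>) {1..d i} D0 (\<sigma> i) \<and>
       quasi_tiling (\<sigma> i) {1..d i} D0 \<S> \<xi> \<T> \<and>
       (\<forall>c\<in>D0. \<forall>t\<in>K. \<forall>s\<in>\<Union>\<S>. \<sigma> i t (\<sigma> i s c) = \<sigma> i (t \<otimes> s) c))"
proof -
  obtain \<S> where \<S>: "finite \<S>" "\<S> \<noteq> {}" "\<S> \<subseteq> nonempty_finite_subsets G" "\<And>T. T \<in> \<S> \<Longrightarrow> Q T"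
    and tiling: "\<And>(D :: nat set) D0 \<sigma>. approx_action G (\<Union>\<S>) D D0 \<sigma> \<Longrightarrow>
        real (card (D - D0)) \<le> \<xi> / 3 * real (card D) \<Longrightarrow> \<exists>\<T>. quasi_tiling \<sigma> D D0 \<S> \<xi> \<T>"
    by (rule quasi_tiling_exists[OF freq \<eta> \<xi>, where 'd = nat]) blast
  have L: "\<Union>\<S> \<subseteq> carrier G" "finite (\<Union>\<S>)" using \<S> by (auto simp: nonempty_finite_subsets_def)
  define L' where "L' = \<Union>\<S> \<union> set_inv (\<Union>\<S>) \<union> {\<one>} \<union> K"
  have "finite (set_inv A)" if "finite A" for A using that by (simp add: SET_INV_def)
  from this[OF L(2)] have L': "L' \<subseteq> carrier G" "finite L'" using L K by (auto simp: L'_def SET_INV_def)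
  have sub: "\<Union>\<S> \<subseteq> L'" "set_inv (\<Union>\<S>) \<subseteq> L'" "\<one> \<in> L'" unfolding L'_def by blast+
  have perm: "\<sigma> i s permutes {1..d i}" if "s \<in> carrier G" for i s
    using sof that unfolding sofic_approximation_sequence_def by (auto simp: sym_group_carrier)
  have "\<xi> / 3 > 0" using \<xi> by simp
  from eventually_mostly_sofic_good[OF sof L' this] eventually_sofic_dim_pos[OF sof]
  have "\<forall>\<^sub>F i in sequentially. 0 < d i \<and> (\<exists>D0 \<T>. approx_action G (\<Union>\<S>) {1..d i} D0 (\<sigma> i) \<and>
       quasi_tiling (\<sigma> i) {1..d i} D0 \<S> \<xi> \<T> \<and>
       (\<forall>c\<in>D0. \<forall>t\<in>K. \<forall>s\<in>\<Union>\<S>. \<sigma> i t (\<sigma> i s c) = \<sigma> i (t \<otimes> s) c))"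
  proof eventually_elim
    case (elim i)
    define D0 where "D0 = sofic_good G L' (d i) (\<sigma> i)"
    have act: "approx_action G (\<Union>\<S>) {1..d i} D0 (\<sigma> i)"
      unfolding D0_def by (rule sofic_good_approx_action[OF L(1) sub perm])
    moreover obtain \<T> where "quasi_tiling (\<sigma> i) {1..d i} D0 \<S> \<xi> \<T>"
      using tiling[OF act] elim(1) by (auto simp: D0_def)
    moreover have "\<forall>c\<in>D0. \<forall>t\<in>K. \<forall>s\<in>\<Union>\<S>. \<sigma> i t (\<sigma> i s c) = \<sigma> i (t \<otimes> s) c"
      unfolding D0_def sofic_good_def L'_def by blast
    ultimately show ?case using elim(2) by blast
  qed
  then show thesis using that[OF \<S>] by blast
qed

section \<open>Counting and elementary estimates\<close>

text \<open>
  Each subset \<open>B\<close> counted has \<open>x ^ |B| \<ge> x ^ (\<beta> n)\<close>, and \<open>x ^ |B|\<close> summed over all subsets is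
  \<open>(1 + x) ^ n \<le> exp (x n)\<close>. For small \<open>x\<close>, and then \<open>\<beta>\<close> small in terms of \<open>x\<close>, the exponential
  rate is arbitrarily small.
\<close>

lemma card_small_subsets:
  fixes x \<beta> :: real
  assumes D: "finite D" and x: "0 < x" "x \<le> 1"
  shows "real (card {B. B \<subseteq> D \<and> real (card B) \<le> \<beta> * real (card D)}) \<le> exp ((x - \<beta> * ln x) * real (card D))"
proof -
  let ?\<B> = "{B. B \<subseteq> D \<and> real (card B) \<le> \<beta> * real (card D)}"
  let ?n = "real (card D)"
  have fin: "finite ?\<B>" using D by (auto intro: finite_subset[of _ "Pow D"])
  have "real (card ?\<B>) * exp (\<beta> * ?n * ln x) = (\<Sum>B\<in>?\<B>. exp (\<beta> * ?n * ln x))" by simp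
  also have "\<dots> \<le> (\<Sum>B\<in>?\<B>. x ^ card B)"
  proof (rule sum_mono)
    fix B assume B: "B \<in> ?\<B>"
    have "\<beta> * ?n * ln x \<le> real (card B) * ln x"
      using B x by (intro mult_right_mono_neg) auto
    then have "exp (\<beta> * ?n * ln x) \<le> exp (real (card B) * ln x)" by simp
    also have "\<dots> = x ^ card B" using x by (simp add: exp_of_nat_mult)
    finally show "exp (\<beta> * ?n * ln x) \<le> x ^ card B" .
  qed
  also have "\<dots> \<le> (\<Sum>B\<in>Pow D. x ^ card B)"
    using D x by (intro sum_mono2) auto
  also have "\<dots> = (\<Prod>a\<in>D. x + 1)"
    unfolding prod_add[OF D] by simp
  also have "\<dots> = (x + 1) ^ card D" by simp
  also have "\<dots> \<le> exp x ^ card D"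
    using x exp_ge_add_one_self[of x] by (intro power_mono) (auto simp: add.commute)
  also have "\<dots> = exp (x * ?n)" by (simp add: exp_of_nat_mult[symmetric] mult.commute)
  finally have "real (card ?\<B>) * exp (\<beta> * ?n * ln x) \<le> exp (x * ?n)" .
  then have "real (card ?\<B>) \<le> exp (x * ?n) / exp (\<beta> * ?n * ln x)" by (simp add: pos_le_divide_eq)
  also have "\<dots> = exp ((x - \<beta> * ln x) * ?n)" by (simp add: exp_diff[symmetric] algebra_simps)
  finally show ?thesis .
qed

text \<open>
  A sum over objects determined by a tuple of codes is at most the sum over all tuples, which
  factorises.
\<close>

lemma sum_le_prod_of_codes:
  fixes w :: "'e \<Rightarrow> real" and W :: "'j \<Rightarrow> 'k \<Rightarrow> real"
  assumes J: "finite J" and C: "\<And>j. j \<in> J \<Longrightarrow> finite (C j)"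
    and W: "\<And>j k. j \<in> J \<Longrightarrow> k \<in> C j \<Longrightarrow> 0 \<le> W j k"
    and code: "\<And>\<phi> j. \<phi> \<in> E \<Longrightarrow> j \<in> J \<Longrightarrow> code \<phi> j \<in> C j"
    and inj: "\<And>\<phi> \<psi>. \<phi> \<in> E \<Longrightarrow> \<psi> \<in> E \<Longrightarrow> (\<And>j. j \<in> J \<Longrightarrow> code \<phi> j = code \<psi> j) \<Longrightarrow> \<phi> = \<psi>"
    and le: "\<And>\<phi>. \<phi> \<in> E \<Longrightarrow> w \<phi> \<le> (\<Prod>j\<in>J. W j (code \<phi> j))"
  shows "(\<Sum>\<phi>\<in>E. w \<phi>) \<le> (\<Prod>j\<in>J. \<Sum>k\<in>C j. W j k)"
proof -
  let ?c = "\<lambda>\<phi>. restrict (code \<phi>) J"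
  have inj': "inj_on ?c E"
    by (rule inj_onI, rule inj) (auto simp: restrict_def fun_eq_iff split: if_splits; metis)+
  have "(\<Sum>\<phi>\<in>E. w \<phi>) \<le> (\<Sum>\<phi>\<in>E. \<Prod>j\<in>J. W j (?c \<phi> j))"
    using le by (intro sum_mono) simp
  also have "\<dots> = (\<Sum>g\<in>?c ` E. \<Prod>j\<in>J. W j (g j))"
    by (simp add: sum.reindex[OF inj'])
  also have "\<dots> \<le> (\<Sum>g\<in>PiE J C. \<Prod>j\<in>J. W j (g j))"
    using J C W code by (intro sum_mono2 finite_PiE prod_nonneg) (auto simp: PiE_mem)
  also have "\<dots> = (\<Prod>j\<in>J. \<Sum>k\<in>C j. W j k)"
    by (rule prod_sum_PiE[symmetric]) (use J C in auto)
  finally show ?thesis .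
qed

text \<open>
  Passing from \<open>F\<close> to a subset \<open>T\<close> of proportion at least \<open>1 - \<eta>\<close> changes quantities
  proportional to the cardinality by \<open>O(\<eta> |T|)\<close>, as \<open>|F - T| \<le> \<eta> |F| \<le> 2 \<eta> |T|\<close>.
\<close>

lemma card_large_subset:
  fixes v :: real
  assumes F: "finite F" and T: "T \<subseteq> F" and large: "(1 - \<eta>) * real (card F) \<le> real (card T)"
    and \<eta>: "0 < \<eta>" "\<eta> \<le> 1/2" and c: "0 \<le> c"
  shows "v * real (card F) + c * real (card (F - T)) \<le> (v + 2 * (\<bar>v\<bar> + c) * \<eta>) * real (card T)"
    and "v * real (card T) - 2 * (\<bar>v\<bar> + c) * \<eta> * real (card T) \<le> v * real (card F) - c * real (card (F - T))"
proof -
  have fT: "finite T" using F T finite_subset by blast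
  have eq: "real (card F) = real (card T) + real (card (F - T))"
    using F T fT by (simp add: card_Diff_subset card_mono)
  have "1/2 * real (card F) \<le> (1 - \<eta>) * real (card F)" using \<eta> by (intro mult_right_mono) auto
  then have "real (card F) \<le> 2 * real (card T)" using large by simp
  then have "\<eta> * real (card F) \<le> \<eta> * (2 * real (card T))" using \<eta> by (intro mult_left_mono) auto
  moreover have "real (card (F - T)) \<le> \<eta> * real (card F)" using large eq by (simp add: algebra_simps)
  ultimately have small: "real (card (F - T)) \<le> 2 * \<eta> * real (card T)" by simp
  have *: "(\<bar>v\<bar> + c) * real (card (F - T)) \<le> (\<bar>v\<bar> + c) * (2 * \<eta> * real (card T))"
    using small c by (intro mult_left_mono) auto
  have "v * real (card (F - T)) \<le> \<bar>v\<bar> * real (card (F - T))"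
    by (rule mult_right_mono) auto
  moreover have "- \<bar>v\<bar> * real (card (F - T)) \<le> v * real (card (F - T))"
    by (rule mult_right_mono) auto
  ultimately show "v * real (card F) + c * real (card (F - T)) \<le> (v + 2 * (\<bar>v\<bar> + c) * \<eta>) * real (card T)"
    and "v * real (card T) - 2 * (\<bar>v\<bar> + c) * \<eta> * real (card T) \<le> v * real (card F) - c * real (card (F - T))"
    using * unfolding eq by (simp_all add: algebra_simps)
qed

lemma small_eta:
  fixes a \<theta> :: real
  assumes "a \<ge> 0" "\<theta> > 0"
  obtains \<eta> where "0 < \<eta>" "\<eta> \<le> 1/2" "2 * a * \<eta> \<le> \<theta>"
proof -
  define \<eta> where "\<eta> = min (1/2) (\<theta> / (2 * (a + 1)))"
  have "2 * a * \<eta> \<le> 2 * a * (\<theta> / (2 * (a + 1)))"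
    using assms unfolding \<eta>_def by (intro mult_left_mono) auto
  also have "\<dots> = a / (a + 1) * \<theta>" using assms by (simp add: field_simps)
  also have "\<dots> \<le> 1 * \<theta>" using assms by (intro mult_right_mono) auto
  finally have "2 * a * \<eta> \<le> \<theta>" by simp
  moreover have "0 < \<eta>" using assms unfolding \<eta>_def by simp
  moreover have "\<eta> \<le> 1/2" unfolding \<eta>_def by (rule min.cobounded1)
  ultimately show thesis using that by blast
qed

lemma elog_exp: "elog (ennreal (exp y)) = ereal y"
  by (simp add: elog_def)

lemma elog_le: "x \<le> ennreal (exp y) \<Longrightarrow> elog x \<le> ereal y"
proof -
  assume le: "x \<le> ennreal (exp y)"
  have "x < \<infinity>" using le by (rule le_less_trans) simp
  show "elog x \<le> ereal y"
  proof (cases "x = 0")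
    case False
    have "0 < enn2real x" using False \<open>x < \<infinity>\<close> by (simp add: enn2real_positive_iff zero_less_iff_neq_zero)
    moreover have "enn2real x \<le> exp y" using le by (rule enn2real_leI[rotated]) simp
    ultimately have "ln (enn2real x) \<le> ln (exp y)" by (intro ln_mono) auto
    then show ?thesis using False \<open>x < \<infinity>\<close> by (simp add: elog_def)
  qed (simp add: elog_def)
qed

lemma elog_ge: "ennreal (exp y) \<le> x \<Longrightarrow> ereal y \<le> elog x"
proof -
  assume le: "ennreal (exp y) \<le> x"
  have pos: "0 < x" using le by (rule less_le_trans[rotated]) simp
  show "ereal y \<le> elog x"
  proof (cases "x = \<infinity>")
    case False
    then have fin: "x < \<infinity>" by (simp add: less_top)
    have "enn2real (ennreal (exp y)) \<le> enn2real x" using le fin by (intro enn2real_mono) auto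
    then have "exp y \<le> enn2real x" by simp
    then have "ln (exp y) \<le> ln (enn2real x)" by (intro ln_mono) auto
    then show ?thesis using False pos by (simp add: elog_def)
  qed (simp add: elog_def)
qed

lemma normalized_elog_le:
  assumes "0 < n" "x \<le> ennreal (exp (v * real n))"
  shows "ereal (1 / real n) * elog x \<le> ereal v"
proof -
  have "ereal (1 / real n) * elog x \<le> ereal (1 / real n) * ereal (v * real n)"
    using assms by (intro ereal_mult_left_mono elog_le) auto
  then show ?thesis using assms(1) by simp
qed

lemma normalized_elog_ge:
  assumes "0 < n" "ennreal (exp (v * real n)) \<le> x"
  shows "ereal v \<le> ereal (1 / real n) * elog x"
proof -
  have "ereal (1 / real n) * ereal (v * real n) \<le> ereal (1 / real n) * elog x"
    using assms by (intro ereal_mult_left_mono elog_ge) auto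
  then show ?thesis using assms(1) by simp
qed

section \<open>Actions on compact metric spaces\<close>

text \<open>
  By the Lebesgue number lemma, a relation that holds locally holds at all pairs of points at
  distance below a uniform scale. Uniform continuity of \<open>f\<close> and uniform comparison of two
  compatible metrics are both of this form.
\<close>

lemma uniform_on_small_scales:
  assumes "compact_space X" "compatible_metric X \<rho>"
    and local: "\<And>x. x \<in> topspace X \<Longrightarrow> \<exists>U. openin X U \<and> x \<in> U \<and> (\<forall>y\<in>U. \<forall>z\<in>U. R y z)"
  shows "\<exists>\<tau>>0. \<forall>y\<in>topspace X. \<forall>z\<in>topspace X. \<rho> y z < \<tau> \<longrightarrow> R y z"
proof -
  interpret Metric_space "topspace X" \<rho> using assms(2) by (simp add: compatible_metric_def)
  have top: "mtopology = X" using assms(2) by (simp add: compatible_metric_def)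
  define \<C> where "\<C> = {U. openin X U \<and> (\<forall>y\<in>U. \<forall>z\<in>U. R y z)}"
  have cp: "compactin mtopology (topspace X)" using assms(1) top by (simp add: compact_space_def)
  have "topspace X \<subseteq> \<Union>\<C>"
  proof
    fix x assume "x \<in> topspace X"
    from local[OF this] show "x \<in> \<Union>\<C>" unfolding \<C>_def by auto
  qed
  from lebesgue_number[OF cp this] obtain \<tau> where \<tau>: "\<tau> > 0" "\<forall>x\<in>topspace X. \<exists>U\<in>\<C>. mball x \<tau> \<subseteq> U"
    unfolding top by (auto simp: \<C>_def)
  have "R y z" if yz: "y \<in> topspace X" "z \<in> topspace X" "\<rho> y z < \<tau>" for y z
  proof -
    obtain U where "U \<in> \<C>" "mball y \<tau> \<subseteq> U" using bspec[OF \<tau>(2) yz(1)] by blast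
    moreover have "y \<in> mball y \<tau>" "z \<in> mball y \<tau>" using yz \<tau> by simp_all
    ultimately have "y \<in> U" "z \<in> U" "\<forall>y\<in>U. \<forall>z\<in>U. R y z" unfolding \<C>_def by auto
    then show ?thesis by blast
  qed
  then show ?thesis using \<tau>(1) by blast
qed

lemma amenable_P1_mono_metric:
  assumes small: "\<And>x y. x \<in> topspace X \<Longrightarrow> y \<in> topspace X \<Longrightarrow> \<rho> x y < \<delta> \<Longrightarrow> \<rho>' x y < \<delta>'"
    and act: "\<And>s x. s \<in> F \<Longrightarrow> x \<in> topspace X \<Longrightarrow> \<alpha> s x \<in> topspace X"
    and F: "finite F" "F \<noteq> {}"
  shows "amenable_P1 X \<alpha> \<rho>' F f \<delta>' \<le> amenable_P1 X \<alpha> \<rho> F f \<delta>"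
proof -
  have "cover_of_order X \<alpha> \<rho>' F \<delta>' \<U>" if "cover_of_order X \<alpha> \<rho> F \<delta> \<U>" for \<U>
  proof -
    have "U \<subseteq> topspace X" if "U \<in> \<U>" for U
      using \<open>cover_of_order X \<alpha> \<rho> F \<delta> \<U>\<close> that by (auto simp: cover_of_order_def)
    then show ?thesis
      using that F small act by (auto simp: cover_of_order_def subset_iff)
  qed
  then show ?thesis unfolding amenable_P1_def by (intro INF_superset_mono) auto
qed

text \<open>
  On the empty space all weighted covers have value 0 and logarithm \<open>-\<infinity>\<close>; excluding it makes
  these values positive reals, so that the estimates can be made with real numbers.
\<close>

locale compact_dynamics = group G for G :: "('g, 'r) monoid_scheme" (structure) +
  fixes X :: "'x topology" and \<alpha> :: "'g \<Rightarrow> 'x \<Rightarrow> 'x" and \<rho> :: "'x \<Rightarrow> 'x \<Rightarrow> real" and f :: "'x \<Rightarrow> real"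
  assumes compact: "compact_space X"
    and action: "continuous_action G X \<alpha>"
    and metric: "compatible_metric X \<rho>"
    and cont: "continuous_map X euclideanreal f"
    and nonempty: "topspace X \<noteq> {}"
begin

lemma group_action: "group_action G (topspace X) \<alpha>"
  using action by (simp add: continuous_action_def)

lemma act_closed: "s \<in> carrier G \<Longrightarrow> x \<in> topspace X \<Longrightarrow> \<alpha> s x \<in> topspace X"
  using group_action.element_image[OF group_action] by blast

lemma act_mult: "s \<in> carrier G \<Longrightarrow> t \<in> carrier G \<Longrightarrow> x \<in> topspace X \<Longrightarrow> \<alpha> (s \<otimes> t) x = \<alpha> s (\<alpha> t x)"
  using group_action.composition_rule[OF group_action] by blast

lemma act_one: "x \<in> topspace X \<Longrightarrow> \<alpha> \<one> x = x"
  using group_action.id_eq_one[OF group_action] by (metis restrict_apply')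

lemma open_preimage: "s \<in> carrier G \<Longrightarrow> openin X U \<Longrightarrow> openin X {x \<in> topspace X. \<alpha> s x \<in> U}"
  using action by (intro openin_continuous_map_preimage) (auto simp: continuous_action_def)

lemma Metric: "Metric_space (topspace X) \<rho>" and topology: "Metric_space.mtopology (topspace X) \<rho> = X"
  using metric by (auto simp: compatible_metric_def)

sublocale Metric_space "topspace X" \<rho> by (rule Metric)

lemma open_ball: "openin X (mball x r)"
  using openin_mball topology by simp

lemma f_bounded: "\<exists>C. \<forall>x\<in>topspace X. \<bar>f x\<bar> \<le> C"
proof -
  have "compactin euclideanreal (f ` topspace X)"
    using compact cont by (intro image_compactin[of X]) (auto simp: compact_space_def)
  then have "bounded (f ` topspace X)" by (simp add: compact_imp_bounded)
  then show ?thesis by (auto simp: bounded_iff)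
qed

definition f_bound :: real where "f_bound = (SOME C. \<forall>x\<in>topspace X. \<bar>f x\<bar> \<le> C)"

lemma f_le: "x \<in> topspace X \<Longrightarrow> \<bar>f x\<bar> \<le> f_bound"
  using someI_ex[OF f_bounded] by (simp add: f_bound_def)

lemma f_bound_nonneg: "0 \<le> f_bound"
  using f_le nonempty by (meson abs_ge_zero all_not_in_conv order_trans)

lemma diameter_bounded: "\<exists>D>0. \<forall>x\<in>topspace X. \<forall>y\<in>topspace X. \<rho> x y \<le> D"
proof -
  have "mbounded (topspace X)"
    using compact by (intro compactin_imp_mbounded) (simp add: topology compact_space_def)
  then show ?thesis unfolding mbounded_alt_pos by blast
qed

lemma f_uniform: "\<theta> > 0 \<Longrightarrow> \<exists>\<tau>>0. \<forall>x\<in>topspace X. \<forall>y\<in>topspace X. \<rho> x y < \<tau> \<longrightarrow> \<bar>f x - f y\<bar> < \<theta>"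
proof (rule uniform_on_small_scales[OF compact metric])
  fix x assume \<theta>: "\<theta> > 0" and x: "x \<in> topspace X"
  let ?U = "{y \<in> topspace X. f y \<in> ball (f x) (\<theta>/2)}"
  have "openin X ?U" using cont by (intro openin_continuous_map_preimage[of X euclideanreal]) auto
  moreover have "\<bar>f y - f z\<bar> < \<theta>" if "y \<in> ?U" "z \<in> ?U" for y z
    using that by (auto simp: dist_real_def abs_real_def split: if_splits)
  ultimately show "\<exists>U. openin X U \<and> x \<in> U \<and> (\<forall>y\<in>U. \<forall>z\<in>U. \<bar>f y - f z\<bar> < \<theta>)"
    using x \<theta> by (intro exI[of _ ?U]) auto
qed

section \<open>Weighted covers\<close>

definition orbit_sum :: "'g set \<Rightarrow> 'x \<Rightarrow> real" where "orbit_sum T x = (\<Sum>s\<in>T. f (\<alpha> s x))"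

lemma orbit_sum_bound:
  assumes "T \<subseteq> carrier G" "x \<in> topspace X"
  shows "\<bar>orbit_sum T x\<bar> \<le> f_bound * real (card T)"
proof -
  have "\<bar>orbit_sum T x\<bar> \<le> (\<Sum>s\<in>T. \<bar>f (\<alpha> s x)\<bar>)" unfolding orbit_sum_def by (rule sum_abs)
  also have "\<dots> \<le> (\<Sum>s\<in>T. f_bound)"
    using assms by (intro sum_mono f_le act_closed) auto
  finally show ?thesis by (simp add: mult.commute)
qed

lemma cover_iff:
  assumes "T \<in> nonempty_finite_subsets G"
  shows "cover_of_order X \<alpha> \<rho> T \<delta> \<U> \<longleftrightarrow> (\<forall>U\<in>\<U>. openin X U) \<and> \<Union>\<U> = topspace X \<and>
     (\<forall>U\<in>\<U>. \<forall>x\<in>U. \<forall>y\<in>U. \<forall>s\<in>T. \<rho> (\<alpha> s x) (\<alpha> s y) < \<delta>)"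
  using assms by (auto simp: cover_of_order_def nonempty_finite_subsets_def)

text \<open>
  Balls of half the size for the metric \<open>max {\<rho> (s x) (s y) | s \<in> T}\<close> form an open cover, and
  the space is compact.
\<close>

lemma finite_cover_exists:
  assumes T: "T \<in> nonempty_finite_subsets G" and \<delta>: "\<delta> > 0"
  shows "\<exists>\<U>. finite \<U> \<and> cover_of_order X \<alpha> \<rho> T \<delta> \<U>"
proof -
  have Tf: "finite T" "T \<noteq> {}" "T \<subseteq> carrier G" using T by (auto simp: nonempty_finite_subsets_def)
  define U where "U x = (\<Inter>s\<in>T. {y \<in> topspace X. \<alpha> s y \<in> mball (\<alpha> s x) (\<delta>/2)})" for x
  have op: "openin X (U x)" for x
    unfolding U_def using Tf by (intro openin_INT2 open_preimage open_ball) auto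
  have mem: "x \<in> U x" if "x \<in> topspace X" for x
    using that Tf \<delta> act_closed by (auto simp: U_def)
  have "(\<forall>V\<in>U ` topspace X. openin X V) \<and> \<Union>(U ` topspace X) = topspace X"
    using op mem openin_subset by fastforce
  then obtain \<V> where \<V>: "finite \<V>" "\<V> \<subseteq> U ` topspace X" "\<Union>\<V> = topspace X"
    using compact unfolding compact_space by meson
  have "\<rho> (\<alpha> s x) (\<alpha> s y) < \<delta>" if "V \<in> \<V>" "x \<in> V" "y \<in> V" "s \<in> T" for V x y s
  proof -
    obtain z where "z \<in> topspace X" "V = U z" using \<V>(2) \<open>V \<in> \<V>\<close> by blast
    then have "\<alpha> s x \<in> mball (\<alpha> s z) (\<delta>/2)" "\<alpha> s y \<in> mball (\<alpha> s z) (\<delta>/2)"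
      using that by (auto simp: U_def)
    then have *: "\<rho> (\<alpha> s z) (\<alpha> s x) < \<delta>/2" "\<rho> (\<alpha> s z) (\<alpha> s y) < \<delta>/2"
      and M: "\<alpha> s x \<in> topspace X" "\<alpha> s y \<in> topspace X" "\<alpha> s z \<in> topspace X" by auto
    have "\<rho> (\<alpha> s x) (\<alpha> s y) \<le> \<rho> (\<alpha> s x) (\<alpha> s z) + \<rho> (\<alpha> s z) (\<alpha> s y)"
      using M by (intro triangle)
    then show ?thesis using * commute[of "\<alpha> s x" "\<alpha> s z"] by simp
  qed
  then have "cover_of_order X \<alpha> \<rho> T \<delta> \<V>"
    unfolding cover_iff[OF T] using \<V> op by blast
  then show ?thesis using \<V>(1) by blast
qed

text \<open>
  A cover may be given as a family: distinct indices with equal members only increase the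
  right-hand side.
\<close>

lemma P1_le_indexed_cover:
  assumes I: "finite I" and cov: "cover_of_order X \<alpha> \<rho> T \<delta> (A ` I)"
    and W: "\<And>i. i \<in> I \<Longrightarrow> 0 \<le> W i" "\<And>i x. i \<in> I \<Longrightarrow> x \<in> A i \<Longrightarrow> exp (orbit_sum T x) \<le> W i"
  shows "amenable_P1 X \<alpha> \<rho> T f \<delta> \<le> ennreal (\<Sum>i\<in>I. W i)"
proof -
  have "amenable_P1 X \<alpha> \<rho> T f \<delta> \<le> (\<Sum>U\<in>A ` I. SUP x\<in>U. ennreal (exp (\<Sum>s\<in>T. f (\<alpha> s x))))"
    unfolding amenable_P1_def using I cov by (intro INF_lower) auto
  also have "\<dots> \<le> (\<Sum>i\<in>I. SUP x\<in>A i. ennreal (exp (\<Sum>s\<in>T. f (\<alpha> s x))))"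
    using sum_image_le[OF I, of "\<lambda>U. SUP x\<in>U. ennreal (exp (\<Sum>s\<in>T. f (\<alpha> s x)))" A] by (simp add: o_def)
  also have "\<dots> \<le> (\<Sum>i\<in>I. ennreal (W i))"
    using W by (intro sum_mono SUP_least) (auto simp: orbit_sum_def intro: ennreal_leI)
  also have "\<dots> = ennreal (\<Sum>i\<in>I. W i)" using W by (intro sum_ennreal) auto
  finally show ?thesis .
qed

lemma P1_pos:
  assumes T: "T \<in> nonempty_finite_subsets G"
  shows "ennreal (exp (- f_bound * real (card T))) \<le> amenable_P1 X \<alpha> \<rho> T f \<delta>"
  unfolding amenable_P1_def
proof (rule INF_greatest)
  fix \<U> assume "\<U> \<in> {\<U>. finite \<U> \<and> cover_of_order X \<alpha> \<rho> T \<delta> \<U>}"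
  then have \<U>: "finite \<U>" "\<Union>\<U> = topspace X" by (auto simp: cover_of_order_def)
  obtain x where x: "x \<in> topspace X" using nonempty by blast
  then obtain U where U: "U \<in> \<U>" "x \<in> U" using \<U> by blast
  have "- f_bound * real (card T) \<le> orbit_sum T x"
    using orbit_sum_bound[of T x] T x by (auto simp: nonempty_finite_subsets_def)
  then have "ennreal (exp (- f_bound * real (card T))) \<le> ennreal (exp (orbit_sum T x))"
    by (intro ennreal_leI) simp
  also have "\<dots> \<le> (SUP x\<in>U. ennreal (exp (\<Sum>s\<in>T. f (\<alpha> s x))))"
    using U(2) by (intro SUP_upper2[of x]) (auto simp: orbit_sum_def)
  also have "\<dots> \<le> (\<Sum>U\<in>\<U>. SUP x\<in>U. ennreal (exp (\<Sum>s\<in>T. f (\<alpha> s x))))"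
    using \<U>(1) U(1) by (intro member_le_sum) auto
  finally show "ennreal (exp (- f_bound * real (card T))) \<le> \<dots>" .
qed

lemma P1_finite:
  assumes T: "T \<in> nonempty_finite_subsets G" and \<delta>: "\<delta> > 0"
  shows "amenable_P1 X \<alpha> \<rho> T f \<delta> < \<infinity>"
proof -
  obtain \<U> where \<U>: "finite \<U>" "cover_of_order X \<alpha> \<rho> T \<delta> \<U>"
    using finite_cover_exists[OF T \<delta>] by blast
  have "orbit_sum T x \<le> f_bound * real (card T)" if "x \<in> U" "U \<in> \<U>" for x U
  proof -
    have "x \<in> topspace X" using \<U>(2) that unfolding cover_of_order_def by blast
    then show ?thesis using orbit_sum_bound[of T x] T by (simp add: nonempty_finite_subsets_def)
  qed
  then have "amenable_P1 X \<alpha> \<rho> T f \<delta> \<le> ennreal (\<Sum>U\<in>\<U>. exp (f_bound * real (card T)))"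
    using \<U> by (intro P1_le_indexed_cover[of _ _ _ "\<lambda>U. U"]) auto
  also have "\<dots> < \<infinity>" by simp
  finally show ?thesis .
qed

definition lnP :: "real \<Rightarrow> 'g set \<Rightarrow> real" where
  "lnP \<delta> T = ln (enn2real (amenable_P1 X \<alpha> \<rho> T f \<delta>))"

lemma P1_eq:
  assumes T: "T \<in> nonempty_finite_subsets G" and \<delta>: "\<delta> > 0"
  shows "amenable_P1 X \<alpha> \<rho> T f \<delta> = ennreal (exp (lnP \<delta> T))"
proof -
  have "0 < amenable_P1 X \<alpha> \<rho> T f \<delta>"
    using P1_pos[OF T, of \<delta>] by (metis ennreal_less_zero_iff exp_gt_zero order_less_le_trans)
  then have "0 < enn2real (amenable_P1 X \<alpha> \<rho> T f \<delta>)"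
    using P1_finite[OF T \<delta>] by (simp add: enn2real_positive_iff)
  then show ?thesis using P1_finite[OF T \<delta>] by (simp add: lnP_def)
qed

lemma lnP_le_indexed_cover:
  assumes T: "T \<in> nonempty_finite_subsets G" and \<delta>: "\<delta> > 0"
    and I: "finite I" and cov: "cover_of_order X \<alpha> \<rho> T \<delta> (A ` I)"
    and W: "\<And>i. i \<in> I \<Longrightarrow> 0 \<le> W i" "\<And>i x. i \<in> I \<Longrightarrow> x \<in> A i \<Longrightarrow> exp (orbit_sum T x) \<le> W i"
  shows "exp (lnP \<delta> T) \<le> (\<Sum>i\<in>I. W i)"
  using P1_le_indexed_cover[OF I cov, of W] W P1_eq[OF T \<delta>] by (simp add: sum_nonneg)

text \<open>
  The infimum in the definition of \<open>lnP\<close> is approached by a cover with real weights bounding the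
  suprema over its members, since these suprema are finite.
\<close>

lemma near_optimal_cover:
  assumes T: "T \<in> nonempty_finite_subsets G" and \<delta>: "\<delta> > 0" and e: "e > 0"
  obtains \<U> W where "finite \<U>" "cover_of_order X \<alpha> \<rho> T \<delta> \<U>" "\<forall>U\<in>\<U>. 0 \<le> W U"
    "\<forall>U\<in>\<U>. \<forall>x\<in>U. exp (orbit_sum T x) \<le> W U" "(\<Sum>U\<in>\<U>. W U) \<le> exp (lnP \<delta> T + e)"
proof -
  define w where "w U = (SUP x\<in>U. ennreal (exp (\<Sum>s\<in>T. f (\<alpha> s x))))" for U
  have "amenable_P1 X \<alpha> \<rho> T f \<delta> < ennreal (exp (lnP \<delta> T + e))"
    using e unfolding P1_eq[OF T \<delta>] by (intro ennreal_lessI) auto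
  then obtain \<U> where \<U>: "finite \<U>" "cover_of_order X \<alpha> \<rho> T \<delta> \<U>"
    and less: "(\<Sum>U\<in>\<U>. w U) < ennreal (exp (lnP \<delta> T + e))"
    unfolding amenable_P1_def INF_less_iff w_def by blast
  have fin: "w U < \<infinity>" if "U \<in> \<U>" for U
  proof -
    have "w U \<le> (\<Sum>U\<in>\<U>. w U)" using \<U>(1) that by (intro member_le_sum) auto
    also note less
    also have "ennreal (exp (lnP \<delta> T + e)) < \<infinity>" by simp
    finally show ?thesis .
  qed
  show thesis
  proof (rule that[of \<U> "\<lambda>U. enn2real (w U)"])
    have "exp (orbit_sum T x) \<le> enn2real (w U)" if "U \<in> \<U>" "x \<in> U" for U x
    proof -
      have "ennreal (exp (orbit_sum T x)) \<le> w U"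
        unfolding w_def orbit_sum_def using that(2) by (intro SUP_upper)
      then have "enn2real (ennreal (exp (orbit_sum T x))) \<le> enn2real (w U)"
        using fin[OF that(1)] by (intro enn2real_mono) auto
      then show ?thesis by simp
    qed
    then show "\<forall>U\<in>\<U>. \<forall>x\<in>U. exp (orbit_sum T x) \<le> enn2real (w U)" by blast
    have "ennreal (\<Sum>U\<in>\<U>. enn2real (w U)) = (\<Sum>U\<in>\<U>. ennreal (enn2real (w U)))"
      by (simp add: sum_ennreal)
    also have "\<dots> = (\<Sum>U\<in>\<U>. w U)" using fin by (intro sum.cong) auto
    finally show "(\<Sum>U\<in>\<U>. enn2real (w U)) \<le> exp (lnP \<delta> T + e)"
      using less by (metis ennreal_le_iff exp_ge_zero less_imp_le)
  qed (use \<U> in auto)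
qed

text \<open>
  The common refinement of a cover for \<open>T\<close> and a cover for \<open>T'\<close> is a cover for \<open>T \<union> T'\<close>, and
  because \<open>T\<close> and \<open>T'\<close> are disjoint the weights multiply.
\<close>

lemma lnP_union:
  assumes T: "T \<in> nonempty_finite_subsets G" and T': "T' \<in> nonempty_finite_subsets G"
    and disj: "T \<inter> T' = {}" and \<delta>: "\<delta> > 0"
  shows "lnP \<delta> (T \<union> T') \<le> lnP \<delta> T + lnP \<delta> T'"
proof (rule field_le_epsilon)
  fix e :: real assume e: "e > 0"
  then have e2: "e/2 > 0" by simp
  have TT': "T \<union> T' \<in> nonempty_finite_subsets G" using T T' by (auto simp: nonempty_finite_subsets_def)
  obtain \<U> W where 1: "finite \<U>" "cover_of_order X \<alpha> \<rho> T \<delta> \<U>" "\<forall>U\<in>\<U>. 0 \<le> W U"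
    "\<forall>U\<in>\<U>. \<forall>x\<in>U. exp (orbit_sum T x) \<le> W U" "(\<Sum>U\<in>\<U>. W U) \<le> exp (lnP \<delta> T + e/2)"
    by (rule near_optimal_cover[OF T \<delta> e2]) (rule that)
  obtain \<U>' W' where 2: "finite \<U>'" "cover_of_order X \<alpha> \<rho> T' \<delta> \<U>'" "\<forall>U\<in>\<U>'. 0 \<le> W' U"
    "\<forall>U\<in>\<U>'. \<forall>x\<in>U. exp (orbit_sum T' x) \<le> W' U" "(\<Sum>U\<in>\<U>'. W' U) \<le> exp (lnP \<delta> T' + e/2)"
    by (rule near_optimal_cover[OF T' \<delta> e2]) (rule that)
  have "exp (lnP \<delta> (T \<union> T')) \<le> (\<Sum>p\<in>\<U> \<times> \<U>'. W (fst p) * W' (snd p))"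
  proof (rule lnP_le_indexed_cover[OF TT' \<delta>])
    show "finite (\<U> \<times> \<U>')" using 1 2 by simp
    have "(\<Union>p\<in>\<U> \<times> \<U>'. fst p \<inter> snd p) = \<Union>\<U> \<inter> \<Union>\<U>'" by auto
    also have "\<dots> = topspace X" using 1(2) 2(2) by (auto simp: cover_of_order_def)
    finally have un: "(\<Union>p\<in>\<U> \<times> \<U>'. fst p \<inter> snd p) = topspace X" .
    show "cover_of_order X \<alpha> \<rho> (T \<union> T') \<delta> ((\<lambda>p. fst p \<inter> snd p) ` (\<U> \<times> \<U>'))"
      unfolding cover_iff[OF TT']
    proof (intro conjI)
      show "\<forall>U\<in>(\<lambda>p. fst p \<inter> snd p) ` (\<U> \<times> \<U>'). openin X U"
        using 1(2) 2(2) by (auto simp: cover_of_order_def)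
      show "\<forall>U\<in>(\<lambda>p. fst p \<inter> snd p) ` (\<U> \<times> \<U>'). \<forall>x\<in>U. \<forall>y\<in>U. \<forall>s\<in>T \<union> T'. \<rho> (\<alpha> s x) (\<alpha> s y) < \<delta>"
        using 1(2) 2(2) unfolding cover_iff[OF T] cover_iff[OF T'] by fastforce
    qed (rule un)
    show "exp (orbit_sum (T \<union> T') x) \<le> W (fst p) * W' (snd p)"
      if "p \<in> \<U> \<times> \<U>'" "x \<in> fst p \<inter> snd p" for p x
    proof -
      have "orbit_sum (T \<union> T') x = orbit_sum T x + orbit_sum T' x"
        unfolding orbit_sum_def using T T' disj by (intro sum.union_disjoint) (auto simp: nonempty_finite_subsets_def)
      then show ?thesis using 1(3,4) 2(4) that by (auto simp: exp_add intro!: mult_mono)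
    qed
  qed (use 1 2 in auto)
  also have "\<dots> = (\<Sum>U\<in>\<U>. W U) * (\<Sum>U\<in>\<U>'. W' U)"
    by (simp add: sum_product sum.cartesian_product case_prod_unfold)
  also have "\<dots> \<le> exp (lnP \<delta> T + e/2) * exp (lnP \<delta> T' + e/2)"
    using 1 2 by (intro mult_mono) (auto intro: sum_nonneg)
  also have "\<dots> = exp (lnP \<delta> T + lnP \<delta> T' + e)" by (simp add: exp_add[symmetric])
  finally show "lnP \<delta> (T \<union> T') \<le> lnP \<delta> T + lnP \<delta> T' + e" by simp
qed

text \<open>
  A cover for \<open>F\<close> is one for \<open>T\<close>; the orbit sums differ by the terms from \<open>F - T\<close>.
\<close>

lemma lnP_subset:
  assumes T: "T \<in> nonempty_finite_subsets G" and F: "F \<in> nonempty_finite_subsets G"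
    and sub: "T \<subseteq> F" and \<delta>: "\<delta> > 0"
  shows "lnP \<delta> T \<le> lnP \<delta> F + f_bound * real (card (F - T))"
proof (rule field_le_epsilon)
  fix e :: real assume e: "e > 0"
  obtain \<U> W where 1: "finite \<U>" "cover_of_order X \<alpha> \<rho> F \<delta> \<U>" "\<forall>U\<in>\<U>. 0 \<le> W U"
    "\<forall>U\<in>\<U>. \<forall>x\<in>U. exp (orbit_sum F x) \<le> W U" "(\<Sum>U\<in>\<U>. W U) \<le> exp (lnP \<delta> F + e)"
    by (rule near_optimal_cover[OF F \<delta> e]) (rule that)
  let ?c = "exp (f_bound * real (card (F - T)))"
  have "exp (lnP \<delta> T) \<le> (\<Sum>U\<in>\<U>. W U * ?c)"
  proof (rule lnP_le_indexed_cover[OF T \<delta> 1(1)])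
    show "cover_of_order X \<alpha> \<rho> T \<delta> ((\<lambda>U. U) ` \<U>)"
      using 1(2) sub unfolding cover_iff[OF T] cover_iff[OF F] by (simp add: subset_iff)
    show "exp (orbit_sum T x) \<le> W U * ?c" if "U \<in> \<U>" "x \<in> U" for U x
    proof -
      have "x \<in> topspace X" using that 1(2) by (auto simp: cover_of_order_def)
      then have "\<bar>orbit_sum (F - T) x\<bar> \<le> f_bound * real (card (F - T))"
        using F by (intro orbit_sum_bound) (auto simp: nonempty_finite_subsets_def)
      moreover have "orbit_sum F x = orbit_sum (F - T) x + orbit_sum T x"
        unfolding orbit_sum_def using F sub by (intro sum.subset_diff) (auto simp: nonempty_finite_subsets_def)
      ultimately have "exp (orbit_sum T x) \<le> exp (orbit_sum F x) * ?c" by (simp add: exp_add[symmetric])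
      also have "\<dots> \<le> W U * ?c" using 1(4) that by simp
      finally show ?thesis .
    qed
  qed (use 1 in auto)
  also have "\<dots> = (\<Sum>U\<in>\<U>. W U) * ?c" by (simp add: sum_distrib_right)
  also have "\<dots> \<le> exp (lnP \<delta> F + e) * ?c" using 1(5) by simp
  also have "\<dots> = exp (lnP \<delta> F + f_bound * real (card (F - T)) + e)" by (simp add: exp_add[symmetric])
  finally show "lnP \<delta> T \<le> lnP \<delta> F + f_bound * real (card (F - T)) + e" by simp
qed

text \<open>
  Covers for \<open>T\<close> pull back along \<open>\<alpha> c\<close> to covers for \<open>T c\<close> with the same weights.
\<close>

lemma lnP_translate:
  assumes T: "T \<in> nonempty_finite_subsets G" and c: "c \<in> carrier G" and \<delta>: "\<delta> > 0"
  shows "lnP \<delta> ((\<lambda>s. s \<otimes> c) ` T) \<le> lnP \<delta> T"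
proof (rule field_le_epsilon)
  fix e :: real assume e: "e > 0"
  have Tf: "finite T" "T \<noteq> {}" "T \<subseteq> carrier G" using T by (auto simp: nonempty_finite_subsets_def)
  have Tc: "(\<lambda>s. s \<otimes> c) ` T \<in> nonempty_finite_subsets G"
    using Tf c by (auto simp: nonempty_finite_subsets_def)
  obtain \<U> W where 1: "finite \<U>" "cover_of_order X \<alpha> \<rho> T \<delta> \<U>" "\<forall>U\<in>\<U>. 0 \<le> W U"
    "\<forall>U\<in>\<U>. \<forall>x\<in>U. exp (orbit_sum T x) \<le> W U" "(\<Sum>U\<in>\<U>. W U) \<le> exp (lnP \<delta> T + e)"
    by (rule near_optimal_cover[OF T \<delta> e]) (rule that)
  let ?A = "\<lambda>U. {x \<in> topspace X. \<alpha> c x \<in> U}"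
  have act: "\<alpha> (s \<otimes> c) x = \<alpha> s (\<alpha> c x)" if "s \<in> T" "x \<in> topspace X" for s x
    using act_mult that c Tf by auto
  have "exp (lnP \<delta> ((\<lambda>s. s \<otimes> c) ` T)) \<le> (\<Sum>U\<in>\<U>. W U)"
  proof (rule lnP_le_indexed_cover[OF Tc \<delta> 1(1)])
    have un: "\<Union>\<U> = topspace X" using 1(2) by (simp add: cover_of_order_def)
    show "cover_of_order X \<alpha> \<rho> ((\<lambda>s. s \<otimes> c) ` T) \<delta> (?A ` \<U>)"
      unfolding cover_iff[OF Tc]
    proof (intro conjI)
      show "\<forall>V\<in>?A ` \<U>. openin X V"
        using 1(2) open_preimage[OF c] by (auto simp: cover_of_order_def)
      have "\<exists>U\<in>\<U>. \<alpha> c x \<in> U" if "x \<in> topspace X" for x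
        using act_closed[OF c that] unfolding un[symmetric] by simp
      then show "\<Union>(?A ` \<U>) = topspace X" by auto
      show "\<forall>V\<in>?A ` \<U>. \<forall>x\<in>V. \<forall>y\<in>V. \<forall>s\<in>(\<lambda>s. s \<otimes> c) ` T. \<rho> (\<alpha> s x) (\<alpha> s y) < \<delta>"
      proof (intro ballI)
        fix V x y s' assume V: "V \<in> ?A ` \<U>" "x \<in> V" "y \<in> V" and s': "s' \<in> (\<lambda>s. s \<otimes> c) ` T"
        obtain U where U: "U \<in> \<U>" "V = ?A U" using V(1) by blast
        obtain s where s: "s \<in> T" "s' = s \<otimes> c" using s' by blast
        have xy: "x \<in> topspace X" "y \<in> topspace X" "\<alpha> c x \<in> U" "\<alpha> c y \<in> U"
          using V(2,3) unfolding U(2) by auto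
        have "\<rho> (\<alpha> s (\<alpha> c x)) (\<alpha> s (\<alpha> c y)) < \<delta>"
          using 1(2) U(1) s(1) xy unfolding cover_iff[OF T] by blast
        then show "\<rho> (\<alpha> s' x) (\<alpha> s' y) < \<delta>" using act s xy by simp
      qed
    qed
    show "exp (orbit_sum ((\<lambda>s. s \<otimes> c) ` T) x) \<le> W U" if "U \<in> \<U>" "x \<in> ?A U" for U x
    proof -
      have inj: "inj_on (\<lambda>s. s \<otimes> c) T" using c Tf by (auto simp: inj_on_def subset_iff)
      have "orbit_sum ((\<lambda>s. s \<otimes> c) ` T) x = (\<Sum>s\<in>T. f (\<alpha> (s \<otimes> c) x))"
        unfolding orbit_sum_def by (simp add: sum.reindex[OF inj])
      also have "\<dots> = orbit_sum T (\<alpha> c x)" unfolding orbit_sum_def using act that(2) by (intro sum.cong) auto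
      finally show ?thesis using 1(4) that by simp
    qed
  qed (use 1 in auto)
  also have "\<dots> \<le> exp (lnP \<delta> T + e)" by (rule 1(5))
  finally show "lnP \<delta> ((\<lambda>s. s \<otimes> c) ` T) \<le> lnP \<delta> T + e" by simp
qed

text \<open>
  Expressing the bounds on the parts as sums of one function \<open>u\<close> over their elements allows
  parts with different densities, here tiles and single leftover points, to be added up in one
  sum over the union.
\<close>

lemma lnP_partition:
  assumes "finite \<P>" "\<P> \<noteq> {}" "\<And>P. P \<in> \<P> \<Longrightarrow> P \<in> nonempty_finite_subsets G" "pairwise disjnt \<P>"
    and "\<And>P. P \<in> \<P> \<Longrightarrow> lnP \<delta> P \<le> (\<Sum>a\<in>P. u a)" and \<delta>: "\<delta> > 0"
  shows "lnP \<delta> (\<Union>\<P>) \<le> (\<Sum>a\<in>\<Union>\<P>. u a)"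
  using assms(1-5)
proof (induction \<P> rule: finite_ne_induct)
  case (insert P \<P>)
  have disj: "P \<inter> \<Union>\<P> = {}"
    using insert.prems(2) insert.hyps(3) by (auto simp: pairwise_insert disjnt_def)
  have "\<Union>\<P> \<in> nonempty_finite_subsets G"
    using insert.hyps insert.prems(1) by (auto simp: nonempty_finite_subsets_def; blast)
  then have "lnP \<delta> (P \<union> \<Union>\<P>) \<le> lnP \<delta> P + lnP \<delta> (\<Union>\<P>)"
    using insert.prems(1) disj \<delta> by (intro lnP_union) auto
  also have "\<dots> \<le> (\<Sum>a\<in>P. u a) + (\<Sum>a\<in>\<Union>\<P>. u a)"
    using insert.prems by (intro add_mono insert.IH) (auto simp: pairwise_insert)
  also have "\<dots> = (\<Sum>a\<in>P \<union> \<Union>\<P>. u a)"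
    using disj insert.hyps(1) insert.prems(1)
    by (intro sum.union_disjoint[symmetric]) (auto simp: nonempty_finite_subsets_def)
  finally show ?case by simp
qed simp

text \<open>
  One constant bounding \<open>|lnP \<delta> T|\<close> by a multiple of \<open>|T|\<close>: singletons bound \<open>lnP\<close> from above by
  subadditivity, and \<open>f_bound\<close> bounds it from below.
\<close>

definition lnP_bound :: "real \<Rightarrow> real" where "lnP_bound \<delta> = max f_bound (lnP \<delta> {\<one>})"

lemma f_bound_le_lnP_bound: "f_bound \<le> lnP_bound \<delta>" and lnP_bound_nonneg: "0 \<le> lnP_bound \<delta>"
  using f_bound_nonneg by (auto simp: lnP_bound_def)

lemma lnP_singleton: "a \<in> carrier G \<Longrightarrow> \<delta> > 0 \<Longrightarrow> lnP \<delta> {a} \<le> lnP_bound \<delta>"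
  using lnP_translate[OF one_nonempty_finite, of a \<delta>] by (simp add: lnP_bound_def)

lemma lnP_upper:
  assumes T: "T \<in> nonempty_finite_subsets G" and \<delta>: "\<delta> > 0"
  shows "lnP \<delta> T \<le> lnP_bound \<delta> * real (card T)"
proof -
  have "lnP \<delta> (\<Union>((\<lambda>a. {a}) ` T)) \<le> (\<Sum>a\<in>\<Union>((\<lambda>a. {a}) ` T). lnP_bound \<delta>)"
    using T lnP_singleton \<delta>
    by (intro lnP_partition) (auto simp: nonempty_finite_subsets_def pairwise_def disjnt_def)
  then show ?thesis by (simp add: mult.commute)
qed

lemma lnP_lower:
  assumes T: "T \<in> nonempty_finite_subsets G" and \<delta>: "\<delta> > 0"
  shows "- lnP_bound \<delta> * real (card T) \<le> lnP \<delta> T"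
proof -
  have "exp (- f_bound * real (card T)) \<le> exp (lnP \<delta> T)"
    using P1_pos[OF T, of \<delta>] unfolding P1_eq[OF T \<delta>] by simp
  moreover have "f_bound * real (card T) \<le> lnP_bound \<delta> * real (card T)"
    using f_bound_le_lnP_bound by (intro mult_right_mono) auto
  ultimately show ?thesis by simp
qed

section \<open>Convergence along invariant sets\<close>

definition avg :: "real \<Rightarrow> 'g set \<Rightarrow> real" where "avg \<delta> F = lnP \<delta> F / real (card F)"

lemma avg_less_iff: "F \<in> nonempty_finite_subsets G \<Longrightarrow> avg \<delta> F < v \<longleftrightarrow> lnP \<delta> F < v * real (card F)"
  by (auto simp: avg_def nonempty_finite_subsets_def card_gt_0_iff pos_divide_less_eq)

lemma avg_greater_iff: "F \<in> nonempty_finite_subsets G \<Longrightarrow> v < avg \<delta> F \<longleftrightarrow> v * real (card F) < lnP \<delta> F"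
  by (auto simp: avg_def nonempty_finite_subsets_def card_gt_0_iff pos_less_divide_eq)

lemma avg_bounds: 
  assumes "F \<in> nonempty_finite_subsets G" "\<delta> > 0"
  shows "- lnP_bound \<delta> \<le> avg \<delta> F" "avg \<delta> F \<le> lnP_bound \<delta>"
  using lnP_upper[OF assms] lnP_lower[OF assms] assms(1)
  by (auto simp: avg_def nonempty_finite_subsets_def card_gt_0_iff pos_divide_le_eq pos_le_divide_eq)

lemma large_subsets_below:
  assumes freq: "\<exists>\<^sub>F F in left_invariant_filter G. avg \<delta> F < v" and \<theta>: "\<theta> > 0" and \<delta>: "\<delta> > 0"
  obtains \<eta> where "0 < \<eta>"
    "\<exists>\<^sub>F F in left_invariant_filter G. \<forall>T\<subseteq>F. (1 - \<eta>) * real (card F) \<le> real (card T) \<longrightarrow>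
       T \<noteq> {} \<longrightarrow> lnP \<delta> T \<le> (v + \<theta>) * real (card T)"
proof -
  obtain \<eta> where \<eta>: "0 < \<eta>" "\<eta> \<le> 1/2" "2 * (\<bar>v\<bar> + f_bound) * \<eta> \<le> \<theta>"
    using small_eta[of "\<bar>v\<bar> + f_bound" \<theta>] \<theta> f_bound_nonneg by auto
  have "\<exists>\<^sub>F F in left_invariant_filter G. avg \<delta> F < v \<and> F \<in> nonempty_finite_subsets G"
    using frequently_eventually_conj[OF freq eventually_nonempty_finite] by (simp add: conj_commute)
  then have "\<exists>\<^sub>F F in left_invariant_filter G. \<forall>T\<subseteq>F. (1 - \<eta>) * real (card F) \<le> real (card T) \<longrightarrow>
       T \<noteq> {} \<longrightarrow> lnP \<delta> T \<le> (v + \<theta>) * real (card T)"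
  proof (rule frequently_elim1, intro allI impI)
    fix F T assume F: "avg \<delta> F < v \<and> F \<in> nonempty_finite_subsets G" and T: "T \<subseteq> F"
      and large: "(1 - \<eta>) * real (card F) \<le> real (card T)" and "T \<noteq> {}"
    have finF: "finite F" and "T \<in> nonempty_finite_subsets G"
      using F T \<open>T \<noteq> {}\<close> by (auto simp: nonempty_finite_subsets_def intro: finite_subset)
    then have "lnP \<delta> T \<le> v * real (card F) + f_bound * real (card (F - T))"
      using lnP_subset[of T F \<delta>] F T \<delta> avg_less_iff[of F \<delta> v] by auto
    also have "\<dots> \<le> (v + 2 * (\<bar>v\<bar> + f_bound) * \<eta>) * real (card T)"
      by (rule card_large_subset(1)[OF finF T large \<eta>(1,2) f_bound_nonneg])
    also have "\<dots> \<le> (v + \<theta>) * real (card T)" using \<eta>(3) by (intro mult_right_mono) auto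
    finally show "lnP \<delta> T \<le> (v + \<theta>) * real (card T)" .
  qed
  then show thesis using that \<eta>(1) by blast
qed

lemma lnP_large_subset_lower:
  assumes F: "F \<in> nonempty_finite_subsets G" "v < avg \<delta> F" and T: "T \<subseteq> F" "T \<noteq> {}"
    and large: "(1 - \<eta>) * real (card F) \<le> real (card T)" and \<delta>: "\<delta> > 0"
    and \<eta>: "0 < \<eta>" "\<eta> \<le> 1/2" "2 * (\<bar>v\<bar> + lnP_bound \<delta>) * \<eta> \<le> \<theta>"
  shows "(v - \<theta>) * real (card T) \<le> lnP \<delta> T"
proof -
  have finF: "finite F" and T': "T \<in> nonempty_finite_subsets G"
    using F T by (auto simp: nonempty_finite_subsets_def intro: finite_subset)
  have "lnP \<delta> F \<le> lnP \<delta> T + lnP_bound \<delta> * real (card (F - T))"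
  proof (cases "F = T")
    case False
    then have "F - T \<in> nonempty_finite_subsets G" using F T by (auto simp: nonempty_finite_subsets_def)
    note FT = this
    have "lnP \<delta> (T \<union> (F - T)) \<le> lnP \<delta> T + lnP \<delta> (F - T)"
      by (rule lnP_union[OF T' FT _ \<delta>]) auto
    moreover have "lnP \<delta> (F - T) \<le> lnP_bound \<delta> * real (card (F - T))" by (rule lnP_upper[OF FT \<delta>])
    moreover have "T \<union> (F - T) = F" using T by auto
    ultimately show ?thesis by simp
  qed simp
  then have "v * real (card F) - lnP_bound \<delta> * real (card (F - T)) \<le> lnP \<delta> T"
    using F avg_greater_iff[of F v \<delta>] by simp
  moreover have "v * real (card T) - 2 * (\<bar>v\<bar> + lnP_bound \<delta>) * \<eta> * real (card T) \<le> v * real (card F) - lnP_bound \<delta> * real (card (F - T))"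
    by (rule card_large_subset(2)[OF finF T(1) large \<eta>(1,2) lnP_bound_nonneg])
  moreover have "2 * (\<bar>v\<bar> + lnP_bound \<delta>) * \<eta> * real (card T) \<le> \<theta> * real (card T)"
    using \<eta>(3) by (intro mult_right_mono) auto
  ultimately show ?thesis by (simp add: algebra_simps)
qed

text \<open>
  The Ornstein-Weiss argument. If \<open>avg \<delta>\<close> is frequently below \<open>v\<close>, tiles can be taken with
  average at most about \<open>v\<close>. A sufficiently invariant \<open>F\<close> is itself an approximate action, hence
  almost partitioned into right translates of these tiles; subadditivity bounds \<open>lnP \<delta> F\<close> by the
  tiles and the few leftover points.
\<close>

lemma frequently_below_imp_eventually:
  assumes freq: "\<exists>\<^sub>F F in left_invariant_filter G. avg \<delta> F < v" and \<theta>: "\<theta> > 0" and \<delta>: "\<delta> > 0"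
  shows "\<forall>\<^sub>F F in left_invariant_filter G. avg \<delta> F \<le> v + \<theta>"
proof -
  have tile_group: "tile (\<otimes>) (c, T) = (\<lambda>s. s \<otimes> c) ` T" for c T by (simp add: tile_def)
  define w where "w = v + \<theta>/2"
  obtain \<eta> where \<eta>: "0 < \<eta>"
    "\<exists>\<^sub>F F in left_invariant_filter G. \<forall>T\<subseteq>F. (1 - \<eta>) * real (card F) \<le> real (card T) \<longrightarrow>
       T \<noteq> {} \<longrightarrow> lnP \<delta> T \<le> w * real (card T)"
    using large_subsets_below[OF freq, of "\<theta>/2"] \<theta> \<delta> unfolding w_def by auto
  obtain \<xi> where \<xi>: "\<xi> > 0" "2 * (\<bar>w\<bar> + lnP_bound \<delta>) * \<xi> \<le> \<theta>"
    using small_eta[of "\<bar>w\<bar> + lnP_bound \<delta>" \<theta>] \<theta> lnP_bound_nonneg[of \<delta>] by auto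
  then have "2 * ((\<bar>w\<bar> + lnP_bound \<delta>) * \<xi>) \<le> \<theta>" by (simp only: mult.assoc)
  then have \<xi>': "(\<bar>w\<bar> + lnP_bound \<delta>) * \<xi> \<le> \<theta>/2" by linarith
  obtain \<S> where \<S>: "finite \<S>" "\<S> \<subseteq> nonempty_finite_subsets G"
    and low: "\<And>T. T \<in> \<S> \<Longrightarrow> T \<noteq> {} \<longrightarrow> lnP \<delta> T \<le> w * real (card T)"
    and tiling: "\<And>(D :: 'g set) D0 \<sigma>. approx_action G (\<Union>\<S>) D D0 \<sigma> \<Longrightarrow>
        real (card (D - D0)) \<le> \<xi> / 3 * real (card D) \<Longrightarrow> \<exists>\<T>. quasi_tiling \<sigma> D D0 \<S> \<xi> \<T>"
    by (rule quasi_tiling_exists[OF \<eta>(2,1) \<xi>(1), where 'd = 'g]) blast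
  have L: "\<Union>\<S> \<subseteq> carrier G" "finite (\<Union>\<S>)" using \<S> by (auto simp: nonempty_finite_subsets_def)
  have "\<xi> / 3 > 0" using \<xi> by simp
  from Folner_approx_action[OF L this] show ?thesis
  proof eventually_elim
    case (elim F)
    let ?D = "{c\<in>F. \<forall>s\<in>\<Union>\<S>. s \<otimes> c \<in> F}"
    have F: "F \<in> nonempty_finite_subsets G" and act: "approx_action G (\<Union>\<S>) F ?D (\<otimes>)"
      using elim by auto
    have FG: "F \<subseteq> carrier G" "finite F" "F \<noteq> {}" using F by (auto simp: nonempty_finite_subsets_def)
    obtain \<T> where T: "finite \<T>" "\<T> \<subseteq> ?D \<times> \<S>" "disjoint_family_on (tile (\<otimes>)) \<T>"
      and rest: "real (card (F - \<Union>(tile (\<otimes>) ` \<T>))) \<le> \<xi> * real (card F)"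
      using tiling[of F ?D "(\<otimes>)"] elim unfolding quasi_tiling_def by auto
    define A where "A = \<Union>(tile (\<otimes>) ` \<T>)"
    \<comment> \<open>Density of the bound: \<open>w\<close> on tiles, the trivial bound on leftover points.\<close>
    define u where "u a = (if a \<in> A then w else lnP_bound \<delta>)" for a
    define \<P> where "\<P> = tile (\<otimes>) ` \<T> \<union> (\<lambda>a. {a}) ` (F - A)"
    have AF: "A \<subseteq> F" using T(2) unfolding A_def tile_def by auto
    have tile_ok: "tile (\<otimes>) p \<in> nonempty_finite_subsets G \<and> lnP \<delta> (tile (\<otimes>) p) \<le> (\<Sum>a\<in>tile (\<otimes>) p. u a)"
      if p: "p \<in> \<T>" for p
    proof -
      obtain c T' where pe: "p = (c, T')" by force
      have c: "c \<in> ?D" and T': "T' \<in> \<S>" using T(2) p pe by auto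
      have T'n: "T' \<in> nonempty_finite_subsets G" using T' \<S> by auto
      have cG: "c \<in> carrier G" using c FG by auto
      have "tile (\<otimes>) p \<in> nonempty_finite_subsets G"
        using T'n cG unfolding pe tile_group by (auto simp: nonempty_finite_subsets_def)
      moreover have "lnP \<delta> (tile (\<otimes>) p) \<le> lnP \<delta> T'"
        unfolding pe tile_group by (rule lnP_translate[OF T'n cG \<delta>])
      moreover have "lnP \<delta> T' \<le> w * real (card T')"
        using low[OF T'] T'n by (auto simp: nonempty_finite_subsets_def)
      moreover have "card (tile (\<otimes>) p) = card T'"
        using card_tile[OF act, of p] c T' by (auto simp: pe)
      moreover have "(\<Sum>a\<in>tile (\<otimes>) p. u a) = (\<Sum>a\<in>tile (\<otimes>) p. w)"
        using p by (intro sum.cong) (auto simp: u_def A_def)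
      ultimately show ?thesis by (simp add: mult.commute)
    qed
    have "pairwise disjnt \<P>"
      unfolding pairwise_def
    proof (intro ballI impI)
      fix P Q assume PQ: "P \<in> \<P>" "Q \<in> \<P>" "P \<noteq> Q"
      then consider (tt) p q where "p \<in> \<T>" "q \<in> \<T>" "P = tile (\<otimes>) p" "Q = tile (\<otimes>) q"
        | (ta) p a where "p \<in> \<T>" "a \<in> F - A" "P = tile (\<otimes>) p" "Q = {a}"
        | (at) p a where "p \<in> \<T>" "a \<in> F - A" "Q = tile (\<otimes>) p" "P = {a}"
        | (aa) a b where "P = {a}" "Q = {b}"
        unfolding \<P>_def by blast
      then show "disjnt P Q"
      proof cases
        case tt
        then have "p \<noteq> q" using PQ by auto
        then show ?thesis using tt T(3) by (simp add: disjoint_family_on_def disjnt_def)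
      next
        case ta
        then show ?thesis by (auto simp: A_def disjnt_def)
      next
        case at
        then show ?thesis by (auto simp: A_def disjnt_def)
      next
        case aa
        then show ?thesis using PQ by (auto simp: disjnt_def)
      qed
    qed
    moreover have un: "\<Union>\<P> = F" using AF by (auto simp: \<P>_def A_def)
    moreover have "finite \<P>" "\<P> \<noteq> {}" using T(1) FG un by (auto simp: \<P>_def)
    moreover have "P \<in> nonempty_finite_subsets G \<and> lnP \<delta> P \<le> (\<Sum>a\<in>P. u a)" if P: "P \<in> \<P>" for P
    proof (cases "P \<in> tile (\<otimes>) ` \<T>")
      case True
      then show ?thesis using tile_ok by blast
    next
      case False
      then obtain a where "P = {a}" "a \<in> F - A" using P by (auto simp: \<P>_def)
      then show ?thesis using FG lnP_singleton[of a \<delta>] \<delta> by (auto simp: u_def nonempty_finite_subsets_def)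
    qed
    ultimately have "lnP \<delta> F \<le> (\<Sum>a\<in>F. u a)"
      using lnP_partition[of \<P> \<delta> u] \<delta> by simp
    also have "\<dots> = (\<Sum>a\<in>A. u a) + (\<Sum>a\<in>F - A. u a)"
      using AF FG by (metis add.commute sum.subset_diff)
    also have "\<dots> = w * real (card A) + lnP_bound \<delta> * real (card (F - A))" by (simp add: u_def)
    also have "real (card A) = real (card F) - real (card (F - A))"
      using AF FG by (simp add: card_Diff_subset finite_subset card_mono)
    also have "w * (real (card F) - real (card (F - A))) + lnP_bound \<delta> * real (card (F - A))
        = w * real (card F) + (lnP_bound \<delta> - w) * real (card (F - A))" by (simp add: algebra_simps)
    also have "(lnP_bound \<delta> - w) * real (card (F - A)) \<le> (\<bar>w\<bar> + lnP_bound \<delta>) * real (card (F - A))"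
      by (intro mult_right_mono) auto
    also have "\<dots> \<le> (\<bar>w\<bar> + lnP_bound \<delta>) * (\<xi> * real (card F))"
      using rest lnP_bound_nonneg[of \<delta>] unfolding A_def by (intro mult_left_mono) auto
    also have "\<dots> = (\<bar>w\<bar> + lnP_bound \<delta>) * \<xi> * real (card F)" by simp
    also have "\<dots> \<le> \<theta>/2 * real (card F)" by (intro mult_right_mono \<xi>') simp
    finally have "lnP \<delta> F \<le> (v + \<theta>) * real (card F)" by (simp add: w_def algebra_simps)
    then show ?case using FG by (simp add: avg_def card_gt_0_iff pos_divide_le_eq)
  qed
qed

text \<open>
  The limit is the infimum of the values below which \<open>avg \<delta>\<close> is found frequently.
\<close>

lemma avg_converges:
  assumes am: "amenable G" and \<delta>: "\<delta> > 0"
  shows "\<exists>p. (avg \<delta> \<longlongrightarrow> p) (left_invariant_filter G)"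
proof -
  define V where "V = {v. \<exists>\<^sub>F F in left_invariant_filter G. avg \<delta> F < v}"
  have nb: "left_invariant_filter G \<noteq> bot" by (rule left_invariant_filter_neq_bot[OF am])
  have "\<forall>\<^sub>F F in left_invariant_filter G. avg \<delta> F < lnP_bound \<delta> + 1"
    using eventually_nonempty_finite by eventually_elim (use avg_bounds(2) \<delta> in \<open>smt (verit)\<close>)
  then have "lnP_bound \<delta> + 1 \<in> V" using nb by (simp add: V_def eventually_frequently)
  then have ne: "V \<noteq> {}" by blast
  have lower: "- lnP_bound \<delta> \<le> v" if "v \<in> V" for v
  proof -
    have "\<exists>\<^sub>F F in left_invariant_filter G. F \<in> nonempty_finite_subsets G \<and> avg \<delta> F < v"
      using that frequently_eventually_conj[OF _ eventually_nonempty_finite] unfolding V_def by blast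
    then obtain F where "F \<in> nonempty_finite_subsets G" "avg \<delta> F < v" by (auto dest: frequently_ex)
    then show ?thesis using avg_bounds(1)[of F \<delta>] \<delta> by linarith
  qed
  then have bdd: "bdd_below V" by (auto simp: bdd_below_def)
  show ?thesis
  proof (intro exI[of _ "Inf V"] tendstoI)
    fix e :: real assume e: "e > 0"
    obtain v where v: "v \<in> V" "v < Inf V + e/2"
      using ne bdd e cInf_lessD[of V "Inf V + e/2"] by auto
    have "e/2 - (v - Inf V) > 0" using v by simp
    then have "(e/2 - (v - Inf V)) / 2 + 0 > 0" by simp
    then have up: "\<forall>\<^sub>F F in left_invariant_filter G. avg \<delta> F \<le> v + ((e/2 - (v - Inf V)) / 2 + 0)"
      using v(1) \<delta> unfolding V_def by (intro frequently_below_imp_eventually) auto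
    have "Inf V - e/2 \<notin> V" using cInf_lower[OF _ bdd] e by fastforce
    then have "\<forall>\<^sub>F F in left_invariant_filter G. Inf V - e/2 \<le> avg \<delta> F"
      by (simp add: V_def frequently_def not_less)
    with up show "\<forall>\<^sub>F F in left_invariant_filter G. dist (avg \<delta> F) (Inf V) < e"
    proof eventually_elim
      case (elim F)
      have "avg \<delta> F < Inf V + e" using elim(1) v(2) e by (simp add: field_simps)
      then show ?case using elim(2) e by (simp add: dist_real_def abs_less_iff)
    qed
  qed
qed

definition p1 :: "real \<Rightarrow> real" where "p1 \<delta> = Lim (left_invariant_filter G) (avg \<delta>)"

lemma tendsto_p1:
  assumes "amenable G" "\<delta> > 0"
  shows "(avg \<delta> \<longlongrightarrow> p1 \<delta>) (left_invariant_filter G)"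
  using avg_converges[OF assms] left_invariant_filter_neq_bot[OF assms(1)] tendsto_Lim
  unfolding p1_def by metis

lemma tendsto_ereal_p1:
  assumes am: "amenable G" and \<delta>: "\<delta> > 0"
  shows "((\<lambda>F. ereal (1 / real (card F)) * elog (amenable_P1 X \<alpha> \<rho> F f \<delta>)) \<longlongrightarrow> ereal (p1 \<delta>)) (left_invariant_filter G)"
proof -
  have "\<forall>\<^sub>F F in left_invariant_filter G.
     ereal (avg \<delta> F) = ereal (1 / real (card F)) * elog (amenable_P1 X \<alpha> \<rho> F f \<delta>)"
    using eventually_nonempty_finite
  proof eventually_elim
    case (elim F)
    then show ?case by (simp add: P1_eq[OF _ \<delta>] elog_exp avg_def)
  qed
  moreover have "((\<lambda>F. ereal (avg \<delta> F)) \<longlongrightarrow> ereal (p1 \<delta>)) (left_invariant_filter G)"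
    using tendsto_p1[OF am \<delta>] by simp
  ultimately show ?thesis by (rule Lim_transform_eventually[rotated])
qed

lemma amenable_p1_eq:
  assumes am: "amenable G" and \<delta>: "\<delta> > 0"
  shows "amenable_p1 f X G \<alpha> \<rho> \<delta> = ereal (p1 \<delta>)"
  unfolding amenable_p1_def
  by (rule tendsto_Lim[OF left_invariant_filter_neq_bot[OF am] tendsto_ereal_p1[OF am \<delta>]])

lemma amenable_pressure_eq:
  "amenable G \<Longrightarrow> amenable_pressure f X G \<alpha> \<rho> = (SUP \<delta>\<in>{0<..}. ereal (p1 \<delta>))"
  unfolding amenable_pressure_def by (intro SUP_cong) (auto simp: amenable_p1_eq)

text \<open>
  By uniform comparison, covers that are fine for \<open>\<rho>\<close> are fine for \<open>\<rho>'\<close>, so \<open>p1\<close> for \<open>\<rho>'\<close> at any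
  scale is at most \<open>p1\<close> for \<open>\<rho>\<close> at a smaller scale.
\<close>

lemma amenable_pressure_le_metric:
  assumes am: "amenable G" and \<rho>': "compatible_metric X \<rho>'"
  shows "amenable_pressure f X G \<alpha> \<rho>' \<le> amenable_pressure f X G \<alpha> \<rho>"
proof -
  interpret other: compact_dynamics G X \<alpha> \<rho>' f
    by unfold_locales (use compact action cont nonempty \<rho>' in auto)
  have nb: "left_invariant_filter G \<noteq> bot" by (rule left_invariant_filter_neq_bot[OF am])
  have "\<exists>\<delta>\<in>{0<..}. ereal (other.p1 \<delta>') \<le> ereal (p1 \<delta>)" if \<delta>': "\<delta>' > 0" for \<delta>'
  proof -
    have "\<exists>\<delta>>0. \<forall>y\<in>topspace X. \<forall>z\<in>topspace X. \<rho> y z < \<delta> \<longrightarrow> \<rho>' y z < \<delta>'"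
    proof (rule uniform_on_small_scales[OF compact metric])
      fix x assume x: "x \<in> topspace X"
      have "\<rho>' y z < \<delta>'" if "y \<in> other.mball x (\<delta>'/2)" "z \<in> other.mball x (\<delta>'/2)" for y z
        using that other.triangle[of y x z] other.commute[of x y] by auto
      then show "\<exists>U. openin X U \<and> x \<in> U \<and> (\<forall>y\<in>U. \<forall>z\<in>U. \<rho>' y z < \<delta>')"
        using other.open_ball[of x "\<delta>'/2"] x \<delta>' by (intro exI[of _ "other.mball x (\<delta>'/2)"]) auto
    qed
    then obtain \<delta> where \<delta>: "\<delta> > 0" "\<And>y z. y \<in> topspace X \<Longrightarrow> z \<in> topspace X \<Longrightarrow> \<rho> y z < \<delta> \<Longrightarrow> \<rho>' y z < \<delta>'"
      by blast
    have "\<forall>\<^sub>F F in left_invariant_filter G. other.avg \<delta>' F \<le> avg \<delta> F"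
      using eventually_nonempty_finite
    proof eventually_elim
      case (elim F)
      then have F: "finite F" "F \<noteq> {}" "F \<subseteq> carrier G" by (auto simp: nonempty_finite_subsets_def)
      have "amenable_P1 X \<alpha> \<rho>' F f \<delta>' \<le> amenable_P1 X \<alpha> \<rho> F f \<delta>"
        using F act_closed \<delta>(2) by (intro amenable_P1_mono_metric) auto
      then have "other.lnP \<delta>' F \<le> lnP \<delta> F"
        unfolding P1_eq[OF elim \<delta>(1)] other.P1_eq[OF elim \<delta>'] by simp
      then show ?case by (simp add: avg_def other.avg_def divide_right_mono)
    qed
    then have "other.p1 \<delta>' \<le> p1 \<delta>"
      using tendsto_le[OF nb tendsto_p1[OF am \<delta>(1)] other.tendsto_p1[OF am \<delta>']] by blast
    then show ?thesis using \<delta>(1) by auto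
  qed
  then show ?thesis
    unfolding amenable_pressure_eq[OF am] other.amenable_pressure_eq[OF am]
    by (intro SUP_mono) auto
qed

lemma amenable_pressure_metric_independent:
  assumes "amenable G" "compatible_metric X \<rho>'"
  shows "amenable_pressure f X G \<alpha> \<rho>' = amenable_pressure f X G \<alpha> \<rho>"
proof (rule antisym)
  interpret other: compact_dynamics G X \<alpha> \<rho>' f
    by unfold_locales (use compact action cont nonempty assms in auto)
  show "amenable_pressure f X G \<alpha> \<rho>' \<le> amenable_pressure f X G \<alpha> \<rho>"
    by (rule amenable_pressure_le_metric[OF assms])
  show "amenable_pressure f X G \<alpha> \<rho> \<le> amenable_pressure f X G \<alpha> \<rho>'"
    by (rule other.amenable_pressure_le_metric[OF assms(1) metric])
qed

section \<open>The sofic pressure is at most the amenable pressure\<close>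

text \<open>
  The coding argument. Every member of \<open>E\<close> is equivariant up to \<open>\<tau>\<close> on each tile of \<open>\<T>\<close>. Its
  code consists of the member of \<open>\<U> T\<close> that contains its value at the centre, for each tile, and
  of the member of \<open>\<V>\<close> that contains its value, for each point of the rest \<open>R\<close>. Two maps with
  equal codes are closer than \<open>\<delta> + 2 \<tau> < \<epsilon>\<close> everywhere and so equal, as \<open>E\<close> is separated. The
  weight of a map is at most the product of the weights of the parts of its code, where the
  factor \<open>exp (\<theta> |T|)\<close> pays for replacing \<open>f (\<phi> (\<sigma> s c))\<close> by \<open>f (s (\<phi> c))\<close>.
\<close>

lemma sum_of_separated_maps:
  assumes d: "0 < d" and L: "finite L" "L \<subseteq> carrier G"
    and act: "approx_action G L {1..d} D0 \<sigma>"
    and T: "finite \<T>" "\<T> \<subseteq> D0 \<times> \<S>" and disj: "disjoint_family_on (tile \<sigma>) \<T>"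
    and \<S>: "\<S> \<subseteq> nonempty_finite_subsets G" "\<And>T. T \<in> \<S> \<Longrightarrow> T \<subseteq> L"
    and cov: "\<And>T. T \<in> \<S> \<Longrightarrow> finite (\<U> T) \<and> cover_of_order X \<alpha> \<rho> T \<delta> (\<U> T)"
    and W: "\<And>T U. T \<in> \<S> \<Longrightarrow> U \<in> \<U> T \<Longrightarrow> 0 \<le> W T U"
      "\<And>T U x. T \<in> \<S> \<Longrightarrow> U \<in> \<U> T \<Longrightarrow> x \<in> U \<Longrightarrow> exp (orbit_sum T x) \<le> W T U"
      "\<And>T. T \<in> \<S> \<Longrightarrow> (\<Sum>U\<in>\<U> T. W T U) \<le> exp (g * real (card T))"
    and cov1: "finite \<V>" "cover_of_order X \<alpha> \<rho> {\<one>} \<delta> \<V>"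
    and B: "real (card \<V>) * exp f_bound \<le> exp B"
    and \<tau>: "\<tau> > 0" "\<And>x y. x \<in> topspace X \<Longrightarrow> y \<in> topspace X \<Longrightarrow> \<rho> x y < \<tau> \<Longrightarrow> \<bar>f x - f y\<bar> < \<theta>"
    and \<epsilon>: "\<delta> + 2 * \<tau> < \<epsilon>" and \<theta>: "\<theta> > 0"
    and E: "E \<subseteq> {1..d} \<rightarrow>\<^sub>E topspace X" and sep: "separated (rho_inf \<rho> d) \<epsilon> E"
    and equi: "\<And>\<phi> p s. \<phi> \<in> E \<Longrightarrow> p \<in> \<T> \<Longrightarrow> s \<in> snd p \<Longrightarrow> \<rho> (\<alpha> s (\<phi> (fst p))) (\<phi> (\<sigma> s (fst p))) < \<tau>"
  defines "R \<equiv> {1..d} - \<Union>(tile \<sigma> ` \<T>)"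
  shows "(\<Sum>\<phi>\<in>E. exp (\<Sum>a=1..d. f (\<phi> a))) \<le> exp ((g + \<theta>) * (real d - real (card R)) + B * real (card R))"
proof -
  have D0: "D0 \<subseteq> {1..d}" using act by (simp add: approx_action_def)
  have TL: "\<T> \<subseteq> D0 \<times> Pow L" using T \<S> by blast
  have finR: "finite R" by (simp add: R_def)
  have Tp: "fst p \<in> {1..d}" "snd p \<in> \<S>" if "p \<in> \<T>" for p
    using subsetD[OF T(2) that] D0 by (auto simp: mem_Times_iff)
  have top: "\<phi> a \<in> topspace X" if "\<phi> \<in> E" "a \<in> {1..d}" for \<phi> a using E that by (auto simp: PiE_def Pi_def)
  have tileD: "\<sigma> s (fst p) \<in> {1..d}" if "p \<in> \<T>" "s \<in> snd p" for p s
  proof -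
    have "fst p \<in> D0" "s \<in> L" using subsetD[OF TL that(1)] that(2) by (auto simp: mem_Times_iff)
    then show ?thesis using act unfolding approx_action_def by blast
  qed
  \<comment> \<open>Codes are indexed by tiles (left) and points of the rest (right).\<close>
  define C where "C j = (case j of Inl p \<Rightarrow> \<U> (snd p) | Inr a \<Rightarrow> \<V>)" for j :: "nat \<times> 'g set + nat"
  define w where "w j U = (case j of Inl p \<Rightarrow> W (snd p) U * exp (\<theta> * real (card (snd p))) | Inr a \<Rightarrow> exp f_bound)"
    for j :: "nat \<times> 'g set + nat" and U
  define pt where "pt j = (case j of Inl p \<Rightarrow> fst p | Inr a \<Rightarrow> a)" for j :: "nat \<times> 'g set + nat"
  define code where "code \<phi> j = (SOME U. U \<in> C j \<and> \<phi> (pt j) \<in> U)" for \<phi> :: "nat \<Rightarrow> 'x" and j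
  let ?J = "\<T> <+> R"
  have code: "code \<phi> j \<in> C j \<and> \<phi> (pt j) \<in> code \<phi> j" if \<phi>: "\<phi> \<in> E" and j: "j \<in> ?J" for \<phi> j
  proof -
    have "\<exists>U. U \<in> C j \<and> \<phi> (pt j) \<in> U"
    proof (cases j)
      case (Inl p)
      then have p: "p \<in> \<T>" using j by auto
      have "\<phi> (fst p) \<in> \<Union>(\<U> (snd p))"
        using cov[OF Tp(2)[OF p]] top[OF \<phi> Tp(1)[OF p]] by (simp add: cover_of_order_def)
      then show ?thesis by (auto simp: C_def pt_def Inl)
    next
      case (Inr a)
      then have "a \<in> {1..d}" using j by (auto simp: R_def)
      then have "\<phi> a \<in> \<Union>\<V>" using cov1(2) top[OF \<phi>] by (simp add: cover_of_order_def)
      then show ?thesis by (auto simp: C_def pt_def Inr)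
    qed
    then show ?thesis unfolding code_def by (rule someI_ex)
  qed
  have "(\<Sum>\<phi>\<in>E. exp (\<Sum>a=1..d. f (\<phi> a))) \<le> (\<Prod>j\<in>?J. \<Sum>U\<in>C j. w j U)"
  proof (rule sum_le_prod_of_codes[where code = code])
    show "finite ?J" using T finR by simp
    show "finite (C j)" if "j \<in> ?J" for j
      using that cov Tp cov1 by (auto simp: C_def)
    show "0 \<le> w j U" if "j \<in> ?J" "U \<in> C j" for j U
      using that W(1) Tp by (auto simp: C_def w_def)
    show "code \<phi> j \<in> C j" if "\<phi> \<in> E" "j \<in> ?J" for \<phi> j using code[OF that] by simp
    show "\<phi> = \<psi>" if \<phi>: "\<phi> \<in> E" and \<psi>: "\<psi> \<in> E" and eq: "\<And>j. j \<in> ?J \<Longrightarrow> code \<phi> j = code \<psi> j" for \<phi> \<psi>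
    proof (rule ccontr)
      assume "\<phi> \<noteq> \<psi>"
      then have far: "\<epsilon> \<le> rho_inf \<rho> d \<phi> \<psi>" using sep \<phi> \<psi> by (simp add: separated_def)
      have "\<rho> (\<phi> a) (\<psi> a) < \<epsilon>" if a: "a \<in> {1..d}" for a
      proof (cases "a \<in> R")
        case True
        then have j: "Inr a \<in> ?J" by auto
        define V where "V = code \<phi> (Inr a)"
        have "V \<in> \<V>" "\<phi> a \<in> V" "\<psi> a \<in> V"
          using code[OF \<phi> j] code[OF \<psi> j] eq[OF j] by (auto simp: V_def C_def pt_def)
        then have "\<rho> (\<alpha> \<one> (\<phi> a)) (\<alpha> \<one> (\<psi> a)) < \<delta>"
          using cov1(2) unfolding cover_iff[OF one_nonempty_finite] by blast
        then show ?thesis using act_one top \<phi> \<psi> a \<epsilon> \<tau>(1) by simp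
      next
        case False
        then obtain p s where p: "p \<in> \<T>" and s: "s \<in> snd p" "a = \<sigma> s (fst p)"
          using a by (auto simp: R_def tile_def)
        have j: "Inl p \<in> ?J" using p by auto
        define U where "U = code \<phi> (Inl p)"
        have U: "U \<in> \<U> (snd p)" "\<phi> (fst p) \<in> U" "\<psi> (fst p) \<in> U"
          using code[OF \<phi> j] code[OF \<psi> j] eq[OF j] by (auto simp: U_def C_def pt_def)
        have ne: "snd p \<in> nonempty_finite_subsets G" using Tp(2)[OF p] \<S> by blast
        have mid: "\<rho> (\<alpha> s (\<phi> (fst p))) (\<alpha> s (\<psi> (fst p))) < \<delta>"
          using cov[OF Tp(2)[OF p]] U s(1) unfolding cover_iff[OF ne] by blast
        have sG: "s \<in> carrier G" using s ne by (auto simp: nonempty_finite_subsets_def)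
        let ?x = "\<alpha> s (\<phi> (fst p))" and ?y = "\<alpha> s (\<psi> (fst p))"
        have M: "?x \<in> topspace X" "?y \<in> topspace X" "\<phi> a \<in> topspace X" "\<psi> a \<in> topspace X"
          using act_closed[OF sG] top \<phi> \<psi> Tp(1)[OF p] a by auto
        have "\<rho> (\<phi> a) (\<psi> a) \<le> \<rho> (\<phi> a) ?x + \<rho> ?x (\<psi> a)" using M by (intro triangle)
        also have "\<rho> ?x (\<psi> a) \<le> \<rho> ?x ?y + \<rho> ?y (\<psi> a)" using M by (intro triangle)
        also have "\<rho> (\<phi> a) ?x = \<rho> ?x (\<phi> a)" by (rule commute)
        finally show ?thesis
          using mid equi[OF \<phi> p s(1)] equi[OF \<psi> p s(1)] \<epsilon> unfolding s(2)[symmetric] by simp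
      qed
      moreover have "{1..d} \<noteq> {}" using d by simp
      ultimately have "rho_inf \<rho> d \<phi> \<psi> < \<epsilon>" unfolding rho_inf_def by (subst Max_less_iff) auto
      then show False using far by simp
    qed
    show "exp (\<Sum>a=1..d. f (\<phi> a)) \<le> (\<Prod>j\<in>?J. w j (code \<phi> j))" if \<phi>: "\<phi> \<in> E" for \<phi>
    proof -
      have "exp (\<Sum>a=1..d. f (\<phi> a)) = (\<Prod>p\<in>\<T>. exp (\<Sum>s\<in>snd p. f (\<phi> (\<sigma> s (fst p))))) * (\<Prod>a\<in>R. exp (f (\<phi> a)))"
        unfolding sum_over_tiles[OF act L(1) T(1) TL disj] R_def[symmetric]
        by (simp add: exp_add exp_sum T finR)
      also have "\<dots> \<le> (\<Prod>p\<in>\<T>. w (Inl p) (code \<phi> (Inl p))) * (\<Prod>a\<in>R. w (Inr a) (code \<phi> (Inr a)))"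
      proof (intro mult_mono prod_mono conjI)
        fix p assume p: "p \<in> \<T>"
        have ne: "snd p \<in> nonempty_finite_subsets G" using Tp(2)[OF p] \<S> by blast
        then have sG: "snd p \<subseteq> carrier G" by (auto simp: nonempty_finite_subsets_def)
        have "(\<Sum>s\<in>snd p. f (\<phi> (\<sigma> s (fst p)))) \<le> (\<Sum>s\<in>snd p. f (\<alpha> s (\<phi> (fst p))) + \<theta>)"
        proof (rule sum_mono)
          fix s assume s: "s \<in> snd p"
          have "\<bar>f (\<alpha> s (\<phi> (fst p))) - f (\<phi> (\<sigma> s (fst p)))\<bar> < \<theta>"
            using equi[OF \<phi> p s] top[OF \<phi>] Tp(1)[OF p] tileD[OF p s] sG s
            by (intro \<tau>(2) act_closed) auto
          then show "f (\<phi> (\<sigma> s (fst p))) \<le> f (\<alpha> s (\<phi> (fst p))) + \<theta>" by linarith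
        qed
        also have "\<dots> = orbit_sum (snd p) (\<phi> (fst p)) + \<theta> * real (card (snd p))"
          by (simp add: orbit_sum_def sum.distrib mult.commute)
        finally have "exp (\<Sum>s\<in>snd p. f (\<phi> (\<sigma> s (fst p)))) \<le> exp (orbit_sum (snd p) (\<phi> (fst p))) * exp (\<theta> * real (card (snd p)))"
          by (simp add: exp_add[symmetric])
        also have "\<dots> \<le> w (Inl p) (code \<phi> (Inl p))"
        proof -
          have "code \<phi> (Inl p) \<in> \<U> (snd p)" "\<phi> (fst p) \<in> code \<phi> (Inl p)"
            using code[OF \<phi>, of "Inl p"] p by (auto simp: C_def pt_def)
          then have "exp (orbit_sum (snd p) (\<phi> (fst p))) \<le> W (snd p) (code \<phi> (Inl p))"
            by (rule W(2)[OF Tp(2)[OF p]])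
          then show ?thesis by (simp add: w_def)
        qed
        finally show "exp (\<Sum>s\<in>snd p. f (\<phi> (\<sigma> s (fst p)))) \<le> w (Inl p) (code \<phi> (Inl p))" .
      next
        fix a assume "a \<in> R"
        then have "\<phi> a \<in> topspace X" using top[OF \<phi>] by (auto simp: R_def)
        then show "exp (f (\<phi> a)) \<le> w (Inr a) (code \<phi> (Inr a))"
          using f_le[of "\<phi> a"] by (simp add: w_def abs_le_iff)
      next
        show "0 \<le> (\<Prod>p\<in>\<T>. w (Inl p) (code \<phi> (Inl p)))"
        proof (rule prod_nonneg)
          fix p assume p: "p \<in> \<T>"
          then have "code \<phi> (Inl p) \<in> \<U> (snd p)" using code[OF \<phi>, of "Inl p"] by (auto simp: C_def)
          then show "0 \<le> w (Inl p) (code \<phi> (Inl p))" using W(1)[OF Tp(2)[OF p]] by (simp add: w_def)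
        qed
      qed (auto intro: prod_nonneg)
      also have "\<dots> = (\<Prod>j\<in>?J. w j (code \<phi> j))"
        using T finR by (simp add: prod.Plus)
      finally show ?thesis .
    qed
  qed
  also have "\<dots> = (\<Prod>p\<in>\<T>. \<Sum>U\<in>\<U> (snd p). W (snd p) U * exp (\<theta> * real (card (snd p)))) * (\<Prod>a\<in>R. \<Sum>U\<in>\<V>. exp f_bound)"
    using T finR by (simp add: prod.Plus C_def w_def)
  also have "\<dots> \<le> (\<Prod>p\<in>\<T>. exp ((g + \<theta>) * real (card (snd p)))) * (\<Prod>a\<in>R. exp B)"
  proof (intro mult_mono prod_mono conjI)
    fix p assume p: "p \<in> \<T>"
    have "(\<Sum>U\<in>\<U> (snd p). W (snd p) U * exp (\<theta> * real (card (snd p)))) = (\<Sum>U\<in>\<U> (snd p). W (snd p) U) * exp (\<theta> * real (card (snd p)))"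
      by (simp add: sum_distrib_right)
    also have "\<dots> \<le> exp (g * real (card (snd p))) * exp (\<theta> * real (card (snd p)))"
      using W(3)[OF Tp(2)[OF p]] by (intro mult_right_mono) auto
    also have "\<dots> = exp ((g + \<theta>) * real (card (snd p)))" by (simp add: exp_add[symmetric] distrib_right)
    finally show "(\<Sum>U\<in>\<U> (snd p). W (snd p) U * exp (\<theta> * real (card (snd p)))) \<le> exp ((g + \<theta>) * real (card (snd p)))" .
    show "0 \<le> (\<Sum>U\<in>\<U> (snd p). W (snd p) U * exp (\<theta> * real (card (snd p))))"
      using W(1)[OF Tp(2)[OF p]] by (intro sum_nonneg) auto
  qed (use B in \<open>auto intro: prod_nonneg\<close>)
  also have "\<dots> = exp ((g + \<theta>) * (\<Sum>p\<in>\<T>. real (card (snd p))) + B * real (card R))"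
    using T by (simp add: exp_add exp_sum sum_distrib_left exp_of_nat_mult[symmetric] mult.commute)
  also have "(\<Sum>p\<in>\<T>. real (card (snd p))) = real d - real (card R)"
    using sum_over_tiles[OF act L(1) T(1) TL disj, of "\<lambda>_. 1::real"] by (simp add: R_def)
  finally show ?thesis .
qed

text \<open>
  Chebyshev's inequality for the mean squares \<open>rho_2\<close>, summed over the elements of \<open>L\<close>.
\<close>

lemma few_bad_points:
  assumes \<phi>: "\<phi> \<in> sofic_Map X \<alpha> \<rho> L \<delta> d \<sigma>" and L: "finite L" "L \<noteq> {}" and d: "0 < d" and \<tau>: "\<tau> > 0"
  shows "real (card {a\<in>{1..d}. \<exists>s\<in>L. \<tau> \<le> \<rho> (\<alpha> s (\<phi> a)) (\<phi> (\<sigma> s a))}) * \<tau>\<^sup>2 \<le> real (card L) * (\<delta>\<^sup>2 * real d)"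
proof -
  let ?U = "{a\<in>{1..d}. \<exists>s\<in>L. \<tau> \<le> \<rho> (\<alpha> s (\<phi> a)) (\<phi> (\<sigma> s a))}"
  let ?B = "\<lambda>s. {a\<in>{1..d}. \<tau> \<le> \<rho> (\<alpha> s (\<phi> a)) (\<phi> (\<sigma> s a))}"
  have each: "real (card (?B s)) * \<tau>\<^sup>2 \<le> \<delta>\<^sup>2 * real d" if s: "s \<in> L" for s
  proof -
    let ?Q = "\<Sum>a=1..d. (\<rho> (\<alpha> s (\<phi> a)) (\<phi> (\<sigma> s a)))\<^sup>2"
    have "rho_2 \<rho> d (\<alpha> s \<circ> \<phi>) (\<phi> \<circ> \<sigma> s) < \<delta>"
      using \<phi> L s by (simp add: sofic_Map_def)
    then have less: "sqrt (1 / real d * ?Q) < \<delta>" by (simp add: rho_2_def)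
    have Q: "0 \<le> ?Q" by (rule sum_nonneg) simp
    then have pos: "0 \<le> 1 / real d * ?Q" by simp
    have "1 / real d * ?Q = (sqrt (1 / real d * ?Q))\<^sup>2" using pos by (rule real_sqrt_pow2[symmetric])
    also have "\<dots> \<le> \<delta>\<^sup>2" using less pos by (intro power_mono) auto
    finally have "?Q \<le> \<delta>\<^sup>2 * real d" using d by (simp add: field_simps)
    moreover have "real (card (?B s)) * \<tau>\<^sup>2 \<le> ?Q"
    proof -
      have "real (card (?B s)) * \<tau>\<^sup>2 = (\<Sum>a\<in>?B s. \<tau>\<^sup>2)" by simp
      also have "\<dots> \<le> (\<Sum>a\<in>?B s. (\<rho> (\<alpha> s (\<phi> a)) (\<phi> (\<sigma> s a)))\<^sup>2)"
        using \<tau> by (intro sum_mono power_mono) auto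
      also have "\<dots> \<le> ?Q" by (intro sum_mono2) auto
      finally show ?thesis .
    qed
    ultimately show ?thesis by linarith
  qed
  have "?U = (\<Union>s\<in>L. ?B s)" by auto
  then have "card ?U \<le> (\<Sum>s\<in>L. card (?B s))"
    using card_UN_le[OF L(1), of ?B] by simp
  then have "real (card ?U) \<le> real (\<Sum>s\<in>L. card (?B s))"
    by (rule of_nat_mono)
  then have "real (card ?U) * \<tau>\<^sup>2 \<le> real (\<Sum>s\<in>L. card (?B s)) * \<tau>\<^sup>2"
    by (rule mult_right_mono) simp
  also have "\<dots> = (\<Sum>s\<in>L. real (card (?B s)) * \<tau>\<^sup>2)" by (simp add: sum_distrib_right)
  also have "\<dots> \<le> (\<Sum>s\<in>L. \<delta>\<^sup>2 * real d)" using each by (rule sum_mono)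
  finally show ?thesis by simp
qed

text \<open>
  Tiles whose centre is a bad point of \<open>\<phi>\<close> are given up and join the rest; this loses at most
  \<open>|L|\<close> points for each bad point. The maps are grouped by their set of bad points. Within a
  group the coding argument applies to the remaining tiles, and the number of groups is
  subexponential.

  With \<open>\<zeta> = \<theta> / 8\<close>, the exponent exceeds \<open>v\<close> by one \<open>\<zeta>\<close> each for the choice of shapes, the
  choice of covers and the oscillation of \<open>f\<close>, by \<open>2 \<zeta>\<close> for the rest (half from the tiling, half
  from bad centres) and by \<open>2 \<zeta>\<close> for the number of groups.
\<close>

theorem sofic_M_upper:
  assumes sof: "sofic_approximation_sequence G d \<sigma>" and \<epsilon>: "\<epsilon> > 0" and \<theta>: "\<theta> > 0"
    and freq: "\<exists>\<^sub>F F in left_invariant_filter G. avg (\<epsilon>/4) F < v"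
  shows "\<exists>F\<in>nonempty_finite_subsets G. \<exists>\<delta>>0. \<forall>\<^sub>F i in sequentially.
    sofic_M f X \<alpha> \<rho> \<epsilon> F \<delta> (d i) (\<sigma> i) \<le> ennreal (exp ((v + \<theta>) * real (d i)))"
proof -
  define \<zeta> where "\<zeta> = \<theta> / 8"
  define \<delta> where "\<delta> = \<epsilon> / 4"
  have \<zeta>: "\<zeta> > 0" and \<delta>: "\<delta> > 0" using \<theta> \<epsilon> by (auto simp: \<zeta>_def \<delta>_def)
  obtain \<eta> where \<eta>: "0 < \<eta>"
    "\<exists>\<^sub>F F in left_invariant_filter G. \<forall>T\<subseteq>F. (1 - \<eta>) * real (card F) \<le> real (card T) \<longrightarrow>
       T \<noteq> {} \<longrightarrow> lnP \<delta> T \<le> (v + \<zeta>) * real (card T)"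
    using large_subsets_below[OF freq \<zeta>] \<delta> unfolding \<delta>_def by auto
  obtain \<V> where \<V>: "finite \<V>" "cover_of_order X \<alpha> \<rho> {\<one>} \<delta> \<V>"
    using finite_cover_exists[OF one_nonempty_finite \<delta>] by blast
  define b where "b = real (card \<V>) + f_bound"
  have b0: "0 \<le> b" using f_bound_nonneg by (simp add: b_def)
  have "real (card \<V>) \<le> exp (real (card \<V>))" using exp_ge_add_one_self[of "real (card \<V>)"] by linarith
  then have b: "real (card \<V>) * exp f_bound \<le> exp b" by (simp add: b_def exp_add)
  obtain \<tau>0 where \<tau>0: "\<tau>0 > 0" "\<And>x y. x \<in> topspace X \<Longrightarrow> y \<in> topspace X \<Longrightarrow> \<rho> x y < \<tau>0 \<Longrightarrow> \<bar>f x - f y\<bar> < \<zeta>"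
    using f_uniform[OF \<zeta>] by blast
  define \<tau> where "\<tau> = min \<tau>0 (\<epsilon>/4)"
  have \<tau>: "\<tau> > 0" using \<tau>0 \<epsilon> by (simp add: \<tau>_def)
  have \<tau>f: "\<bar>f x - f y\<bar> < \<zeta>" if "x \<in> topspace X" "y \<in> topspace X" "\<rho> x y < \<tau>" for x y
    using \<tau>0(2) that by (simp add: \<tau>_def)
  have \<tau>\<epsilon>: "\<delta> + 2 * \<tau> < \<epsilon>"
  proof -
    have "\<tau> \<le> \<epsilon>/4" by (simp add: \<tau>_def)
    then show ?thesis using \<epsilon> by (simp add: \<delta>_def)
  qed
  define g where "g = v + 2 * \<zeta>"
  define h where "h = g + \<zeta>"
  define q where "q = \<bar>h\<bar> + b"
  have q0: "0 \<le> q" using b0 by (simp add: q_def)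
  obtain \<xi> where \<xi>: "0 < \<xi>" "2 * q * \<xi> \<le> \<zeta>" using small_eta[OF q0 \<zeta>] by auto
  obtain \<S> where \<S>: "finite \<S>" "\<S> \<noteq> {}" "\<S> \<subseteq> nonempty_finite_subsets G"
    and low: "\<forall>T\<in>\<S>. T \<noteq> {} \<longrightarrow> lnP \<delta> T \<le> (v + \<zeta>) * real (card T)"
    and ev: "\<forall>\<^sub>F i in sequentially. 0 < d i \<and> (\<exists>D0 \<T>. approx_action G (\<Union>\<S>) {1..d i} D0 (\<sigma> i) \<and>
       quasi_tiling (\<sigma> i) {1..d i} D0 \<S> \<xi> \<T> \<and>
       (\<forall>c\<in>D0. \<forall>t\<in>{}. \<forall>s\<in>\<Union>\<S>. \<sigma> i t (\<sigma> i s c) = \<sigma> i (t \<otimes> s) c))"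
    by (rule sofic_quasi_tiling_exists[OF \<eta>(2,1) \<xi>(1) sof empty_subsetI finite.emptyI]) blast
  define L where "L = \<Union>\<S>"
  have L: "L \<subseteq> carrier G" "finite L" "L \<noteq> {}"
    using \<S> by (auto simp: nonempty_finite_subsets_def L_def)
  have "\<exists>\<U> W. finite \<U> \<and> cover_of_order X \<alpha> \<rho> T \<delta> \<U> \<and> (\<forall>U\<in>\<U>. 0 \<le> W U) \<and>
     (\<forall>U\<in>\<U>. \<forall>x\<in>U. exp (orbit_sum T x) \<le> W U) \<and> (\<Sum>U\<in>\<U>. W U) \<le> exp (g * real (card T))" if T: "T \<in> \<S>" for T
  proof -
    have ne: "T \<in> nonempty_finite_subsets G" using T \<S> by auto
    then have c: "1 \<le> real (card T)" by (auto simp: nonempty_finite_subsets_def card_gt_0_iff Suc_le_eq)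
    obtain \<U> W where 1: "finite \<U>" "cover_of_order X \<alpha> \<rho> T \<delta> \<U>" "\<forall>U\<in>\<U>. 0 \<le> W U"
      "\<forall>U\<in>\<U>. \<forall>x\<in>U. exp (orbit_sum T x) \<le> W U" "(\<Sum>U\<in>\<U>. W U) \<le> exp (lnP \<delta> T + \<zeta>)"
      by (rule near_optimal_cover[OF ne \<delta> \<zeta>]) (rule that)
    have "lnP \<delta> T \<le> (v + \<zeta>) * real (card T)" using low T ne by (auto simp: nonempty_finite_subsets_def)
    moreover have "\<zeta> * 1 \<le> \<zeta> * real (card T)" using \<zeta> c by (intro mult_left_mono) auto
    ultimately have "lnP \<delta> T + \<zeta> \<le> g * real (card T)" by (simp add: g_def algebra_simps)
    then have "(\<Sum>U\<in>\<U>. W U) \<le> exp (g * real (card T))" using 1(5) by (meson exp_le_cancel_iff order_trans)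
    then show ?thesis using 1(1-4) by blast
  qed
  then obtain \<U> W where cov: "\<And>T. T \<in> \<S> \<Longrightarrow> finite (\<U> T) \<and> cover_of_order X \<alpha> \<rho> T \<delta> (\<U> T)"
    and W: "\<And>T U. T \<in> \<S> \<Longrightarrow> U \<in> \<U> T \<Longrightarrow> 0 \<le> W T U"
      "\<And>T U x. T \<in> \<S> \<Longrightarrow> U \<in> \<U> T \<Longrightarrow> x \<in> U \<Longrightarrow> exp (orbit_sum T x) \<le> W T U"
      "\<And>T. T \<in> \<S> \<Longrightarrow> (\<Sum>U\<in>\<U> T. W T U) \<le> exp (g * real (card T))"
    by metis
  \<comment> \<open>\<open>x\<close> and \<open>\<beta>\<close> make the number of sets of at most \<open>\<beta> n\<close> bad points at most \<open>exp (2 \<zeta> n)\<close>; \<open>\<beta>\<close>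
    also keeps the loss of tiles with bad centres below \<open>\<zeta>\<close>.\<close>
  define x where "x = min 1 \<zeta>"
  have x: "0 < x" "x \<le> 1" "x \<le> \<zeta>" using \<zeta> by (auto simp: x_def)
  define \<beta> where "\<beta> = \<zeta> / (\<bar>ln x\<bar> + real (card L) * q + 1)"
  have den: "0 < \<bar>ln x\<bar> + real (card L) * q + 1" using q0 by (intro add_nonneg_pos add_nonneg_nonneg mult_nonneg_nonneg) auto
  have \<beta>: "0 < \<beta>" using \<zeta> den by (simp add: \<beta>_def)
  have \<beta>D: "\<beta> * (\<bar>ln x\<bar> + real (card L) * q + 1) = \<zeta>" using den by (simp add: \<beta>_def)
  have \<beta>1: "- \<beta> * ln x \<le> \<zeta>"
  proof -
    have "- \<beta> * ln x \<le> \<beta> * \<bar>ln x\<bar>" using \<beta> by (simp add: abs_if)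
    also have "\<dots> \<le> \<beta> * (\<bar>ln x\<bar> + real (card L) * q + 1)" using \<beta> q0 by (intro mult_left_mono) auto
    finally show ?thesis using \<beta>D by simp
  qed
  have \<beta>2: "q * (\<beta> * real (card L)) \<le> \<zeta>"
  proof -
    have "q * (\<beta> * real (card L)) = \<beta> * (real (card L) * q)" by simp
    also have "\<dots> \<le> \<beta> * (\<bar>ln x\<bar> + real (card L) * q + 1)" using \<beta> by (intro mult_left_mono) auto
    finally show ?thesis using \<beta>D by simp
  qed
  \<comment> \<open>Chosen so that the Chebyshev bound for the number of bad points is exactly \<open>\<beta> n\<close>.\<close>
  define \<delta>' where "\<delta>' = \<tau> * sqrt (\<beta> / real (card L))"
  have cL: "0 < real (card L)" using L by (simp add: card_gt_0_iff)
  have \<delta>': "\<delta>' > 0" using \<tau> \<beta> cL by (simp add: \<delta>'_def)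
  have "\<delta>'\<^sup>2 = \<tau>\<^sup>2 * (\<beta> / real (card L))" using \<beta> cL by (simp add: \<delta>'_def power_mult_distrib)
  then have \<delta>'L: "real (card L) * \<delta>'\<^sup>2 = \<beta> * \<tau>\<^sup>2" using cL by simp
  from ev have "\<forall>\<^sub>F i in sequentially.
    sofic_M f X \<alpha> \<rho> \<epsilon> L \<delta>' (d i) (\<sigma> i) \<le> ennreal (exp ((v + \<theta>) * real (d i)))"
  proof eventually_elim
    case (elim i)
    define n where "n = d i"
    define \<pi> where "\<pi> = \<sigma> i"
    obtain D0 \<T> where n: "0 < n" and act: "approx_action G L {1..n} D0 \<pi>"
      and T: "finite \<T>" "\<T> \<subseteq> D0 \<times> \<S>" and disj: "disjoint_family_on (tile \<pi>) \<T>"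
      and rest: "real (card ({1..n} - \<Union>(tile \<pi> ` \<T>))) \<le> \<xi> * real n"
      using elim by (auto simp: quasi_tiling_def n_def \<pi>_def L_def)
    define bad where "bad \<phi> = {a\<in>{1..n}. \<exists>s\<in>L. \<tau> \<le> \<rho> (\<alpha> s (\<phi> a)) (\<phi> (\<pi> s a))}" for \<phi>
    define \<B> where "\<B> = {B. B \<subseteq> {1..n} \<and> real (card B) \<le> \<beta> * real (card {1..n})}"
    have fin\<B>: "finite \<B>" unfolding \<B>_def by (rule finite_subset[of _ "Pow {1..n}"]) auto
    have main: "(\<Sum>\<phi>\<in>E. ennreal (exp (\<Sum>a=1..n. f (\<phi> a)))) \<le> ennreal (exp ((v + \<theta>) * real n))"
      if E: "E \<subseteq> sofic_Map X \<alpha> \<rho> L \<delta>' n \<pi>" and sep: "separated (rho_inf \<rho> n) \<epsilon> E" and finE: "finite E" for E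
    proof -
      have bad\<B>: "bad \<phi> \<in> \<B>" if "\<phi> \<in> E" for \<phi>
      proof -
        have "\<phi> \<in> sofic_Map X \<alpha> \<rho> L \<delta>' n \<pi>" using that E by blast
        from few_bad_points[OF this L(2,3) n \<tau>]
        have "real (card (bad \<phi>)) * \<tau>\<^sup>2 \<le> real (card L) * \<delta>'\<^sup>2 * real n" by (simp add: bad_def mult.assoc)
        also have "\<dots> = \<beta> * real n * \<tau>\<^sup>2" unfolding \<delta>'L by simp
        finally have "real (card (bad \<phi>)) \<le> \<beta> * real n" using \<tau> by (simp add: mult_le_cancel_right)
        then show ?thesis by (auto simp: \<B>_def bad_def)
      qed
      have fixed_bad: "(\<Sum>\<phi>\<in>{\<phi>\<in>E. bad \<phi> = B}. exp (\<Sum>a=1..n. f (\<phi> a))) \<le> exp ((h + 2 * \<zeta>) * real n)"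
        if B: "B \<in> \<B>" for B
      proof -
        define \<T>' where "\<T>' = {p\<in>\<T>. fst p \<notin> B}"
        define R where "R = {1..n} - \<Union>(tile \<pi> ` \<T>')"
        have "(\<Sum>\<phi>\<in>{\<phi>\<in>E. bad \<phi> = B}. exp (\<Sum>a=1..n. f (\<phi> a)))
            \<le> exp ((g + \<zeta>) * (real n - real (card R)) + b * real (card R))"
          unfolding R_def
        proof (rule sum_of_separated_maps[OF n L(2,1) act, where \<S> = \<S> and \<U> = \<U> and W = W and \<V> = \<V> and \<delta> = \<delta> and \<tau> = \<tau>])
          show "finite \<T>'" "\<T>' \<subseteq> D0 \<times> \<S>" using T by (auto simp: \<T>'_def)
          show "disjoint_family_on (tile \<pi>) \<T>'"
            using disj by (auto simp: \<T>'_def disjoint_family_on_def)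
          show "{\<phi> \<in> E. bad \<phi> = B} \<subseteq> {1..n} \<rightarrow>\<^sub>E topspace X"
            using E by (auto simp: sofic_Map_def)
          show "separated (rho_inf \<rho> n) \<epsilon> {\<phi> \<in> E. bad \<phi> = B}" using sep by (auto simp: separated_def)
          fix \<phi> p s assume \<phi>: "\<phi> \<in> {\<phi> \<in> E. bad \<phi> = B}" and p: "p \<in> \<T>'" and s: "s \<in> snd p"
          have "p \<in> D0 \<times> \<S>" using p T by (auto simp: \<T>'_def)
          then have "fst p \<in> {1..n}" "s \<in> L" using act s by (auto simp: L_def approx_action_def)
          moreover have "fst p \<notin> bad \<phi>" using \<phi> p by (auto simp: \<T>'_def)
          ultimately show "\<rho> (\<alpha> s (\<phi> (fst p))) (\<phi> (\<pi> s (fst p))) < \<tau>"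
            by (auto simp: bad_def not_le)
        qed (use \<S> cov W \<V> b \<tau> \<tau>f \<tau>\<epsilon> \<zeta> in \<open>auto simp: L_def\<close>)
        also have "(g + \<zeta>) * (real n - real (card R)) + b * real (card R) \<le> (h + 2 * \<zeta>) * real n"
        proof -
          have Bn: "B \<subseteq> {1..n}" "real (card B) \<le> \<beta> * real n" using B by (auto simp: \<B>_def)
          have "R \<subseteq> ({1..n} - \<Union>(tile \<pi> ` \<T>)) \<union> (\<lambda>z. \<pi> (fst z) (snd z)) ` (L \<times> B)"
          proof
            fix a assume a: "a \<in> R"
            show "a \<in> ({1..n} - \<Union>(tile \<pi> ` \<T>)) \<union> (\<lambda>z. \<pi> (fst z) (snd z)) ` (L \<times> B)"
            proof (cases "a \<in> \<Union>(tile \<pi> ` \<T>)")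
              case True
              then obtain p s where p: "p \<in> \<T>" "s \<in> snd p" "a = \<pi> s (fst p)" by (auto simp: tile_def)
              have "p \<notin> \<T>'" using a p by (auto simp: R_def tile_def)
              then have "fst p \<in> B" using p by (simp add: \<T>'_def)
              moreover have "s \<in> L" using p(2) subsetD[OF T(2) p(1)] by (auto simp: L_def mem_Times_iff)
              ultimately show ?thesis using p(3) by force
            next
              case False
              then show ?thesis using a by (auto simp: R_def)
            qed
          qed
          moreover have finB: "finite B" using Bn(1) finite_subset by blast
          ultimately have "card R \<le> card (({1..n} - \<Union>(tile \<pi> ` \<T>)) \<union> (\<lambda>z. \<pi> (fst z) (snd z)) ` (L \<times> B))"
            using L by (intro card_mono) auto
          also have "\<dots> \<le> card ({1..n} - \<Union>(tile \<pi> ` \<T>)) + card ((\<lambda>z. \<pi> (fst z) (snd z)) ` (L \<times> B))"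
            by (rule card_Un_le)
          also have "card ((\<lambda>z. \<pi> (fst z) (snd z)) ` (L \<times> B)) \<le> card (L \<times> B)"
            using L finB by (intro card_image_le) simp
          finally have "real (card R) \<le> real (card ({1..n} - \<Union>(tile \<pi> ` \<T>))) + real (card L) * real (card B)"
            by (simp add: card_cartesian_product flip: of_nat_mult of_nat_add)
          also have "\<dots> \<le> \<xi> * real n + real (card L) * (\<beta> * real n)"
            using rest Bn(2) by (intro add_mono mult_left_mono) auto
          finally have R: "real (card R) \<le> (\<xi> + \<beta> * real (card L)) * real n" by (simp add: algebra_simps)
          have "(g + \<zeta>) * (real n - real (card R)) + b * real (card R) = h * real n + (b - h) * real (card R)"
            by (simp add: h_def algebra_simps)
          also have "(b - h) * real (card R) \<le> q * real (card R)"
            unfolding q_def by (intro mult_right_mono) auto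
          also have "\<dots> \<le> q * ((\<xi> + \<beta> * real (card L)) * real n)"
            using R q0 by (rule mult_left_mono)
          also have "\<dots> = (q * \<xi> + q * (\<beta> * real (card L))) * real n" by (simp add: algebra_simps)
          also have "\<dots> \<le> (2 * \<zeta>) * real n"
          proof (rule mult_right_mono)
            have "0 \<le> q * \<xi>" using q0 \<xi> by simp
            then show "q * \<xi> + q * (\<beta> * real (card L)) \<le> 2 * \<zeta>" using \<xi>(2) \<beta>2 by linarith
          qed simp
          finally show ?thesis by (simp add: algebra_simps)
        qed
        finally show ?thesis by simp
      qed
      have "(\<Sum>\<phi>\<in>E. exp (\<Sum>a=1..n. f (\<phi> a))) = (\<Sum>B\<in>\<B>. \<Sum>\<phi>\<in>{\<phi>\<in>E. bad \<phi> = B}. exp (\<Sum>a=1..n. f (\<phi> a)))"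
        by (rule sum.group[symmetric]) (use finE fin\<B> bad\<B> in auto)
      also have "\<dots> \<le> (\<Sum>B\<in>\<B>. exp ((h + 2 * \<zeta>) * real n))" by (rule sum_mono) (rule fixed_bad)
      also have "\<dots> = real (card \<B>) * exp ((h + 2 * \<zeta>) * real n)" by simp
      also have "\<dots> \<le> exp ((x - \<beta> * ln x) * real n) * exp ((h + 2 * \<zeta>) * real n)"
        using card_small_subsets[of "{1..n}" x \<beta>] x unfolding \<B>_def by (intro mult_right_mono) auto
      also have "\<dots> = exp ((x - \<beta> * ln x + h + 2 * \<zeta>) * real n)" by (simp add: exp_add[symmetric] algebra_simps)
      also have "\<dots> \<le> exp ((v + \<theta>) * real n)"
      proof -
        have "x - \<beta> * ln x + h + 2 * \<zeta> \<le> v + \<theta>"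
          using x(3) \<beta>1 \<zeta> unfolding h_def g_def by (simp add: \<zeta>_def)
        then have "(x - \<beta> * ln x + h + 2 * \<zeta>) * real n \<le> (v + \<theta>) * real n" by (rule mult_right_mono) simp
        then show ?thesis by simp
      qed
      finally show ?thesis by (simp add: sum_ennreal ennreal_leI)
    qed
    have "sofic_M f X \<alpha> \<rho> \<epsilon> L \<delta>' n \<pi> \<le> ennreal (exp ((v + \<theta>) * real n))"
      unfolding sofic_M_def
    proof (rule SUP_least)
      fix E assume E: "E \<in> {E. E \<subseteq> sofic_Map X \<alpha> \<rho> L \<delta>' n \<pi> \<and> separated (rho_inf \<rho> n) \<epsilon> E}"
      show "(\<Sum>\<phi>\<in>E. ennreal (exp (\<Sum>a=1..n. f (\<phi> a)))) \<le> ennreal (exp ((v + \<theta>) * real n))"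
        \<comment> \<open>The sum over an infinite set is 0 by convention.\<close>
        using main[of E] E by (cases "finite E") auto
    qed
    then show ?case by (simp add: n_def \<pi>_def)
  qed
  moreover have "L \<in> nonempty_finite_subsets G" using L by (simp add: nonempty_finite_subsets_def)
  ultimately show ?thesis using \<delta>' by blast
qed

lemma sofic_pressure_le:
  assumes am: "amenable G" and sof: "sofic_approximation_sequence G d \<sigma>"
  shows "sofic_pressure d \<sigma> f X G \<alpha> \<rho> \<le> amenable_pressure f X G \<alpha> \<rho>"
  unfolding sofic_pressure_def
proof (rule SUP_least)
  fix \<epsilon> :: real assume "\<epsilon> \<in> {0<..}"
  then have \<epsilon>: "\<epsilon> > 0" by simp
  let ?h = "\<lambda>F \<delta> i. ereal (1 / real (d i)) * elog (sofic_M f X \<alpha> \<rho> \<epsilon> F \<delta> (d i) (\<sigma> i))"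
  let ?I = "INF F\<in>nonempty_finite_subsets G. INF \<delta>\<in>{0<..}. limsup (?h F \<delta>)"
  have nb: "left_invariant_filter G \<noteq> bot" by (rule left_invariant_filter_neq_bot[OF am])
  have "?I \<le> ereal (p1 (\<epsilon>/4)) + ereal e" if e: "e > 0" for e :: real
  proof -
    have "\<forall>\<^sub>F F in left_invariant_filter G. avg (\<epsilon>/4) F < p1 (\<epsilon>/4) + e/2"
      using tendsto_p1[OF am, of "\<epsilon>/4"] \<epsilon> e by (intro order_tendstoD) auto
    then have "\<exists>\<^sub>F F in left_invariant_filter G. avg (\<epsilon>/4) F < p1 (\<epsilon>/4) + e/2"
      using nb by (rule eventually_frequently[rotated])
    from sofic_M_upper[OF sof \<epsilon> _ this, of "e/2"] e
    obtain F \<delta> where F: "F \<in> nonempty_finite_subsets G" and \<delta>: "\<delta> > 0"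
      and ev: "\<forall>\<^sub>F i in sequentially. sofic_M f X \<alpha> \<rho> \<epsilon> F \<delta> (d i) (\<sigma> i) \<le> ennreal (exp ((p1 (\<epsilon>/4) + e/2 + e/2) * real (d i)))"
      by auto
    from ev eventually_sofic_dim_pos[OF sof] have "\<forall>\<^sub>F i in sequentially. ?h F \<delta> i \<le> ereal (p1 (\<epsilon>/4) + e)"
    proof eventually_elim
      case (elim i)
      have "p1 (\<epsilon>/4) + e/2 + e/2 = p1 (\<epsilon>/4) + e" by simp
      with elim(1) have "sofic_M f X \<alpha> \<rho> \<epsilon> F \<delta> (d i) (\<sigma> i) \<le> ennreal (exp ((p1 (\<epsilon>/4) + e) * real (d i)))"
        by (simp only:)
      then show ?case using elim(2) by (intro normalized_elog_le) auto
    qed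
    then have le: "limsup (?h F \<delta>) \<le> ereal (p1 (\<epsilon>/4) + e)"
      by (rule Limsup_bounded)
    have "?I \<le> limsup (?h F \<delta>)"
      by (rule INF_lower2[OF F], rule INF_lower) (use \<delta> in simp)
    also note le
    also have "ereal (p1 (\<epsilon>/4) + e) = ereal (p1 (\<epsilon>/4)) + ereal e" by (simp only: plus_ereal.simps)
    finally show ?thesis .
  qed
  then have "?I \<le> ereal (p1 (\<epsilon>/4))" by (rule ereal_le_epsilon2)
  also have "\<dots> \<le> (SUP \<delta>\<in>{0<..}. ereal (p1 \<delta>))" using \<epsilon> by (intro SUP_upper) auto
  finally show "?I \<le> amenable_pressure f X G \<alpha> \<rho>" unfolding amenable_pressure_eq[OF am] .
qed

section \<open>The amenable pressure is at most the sofic pressure\<close>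

text \<open>
  In a separated set of maximal cardinality, which exists because a cover of order \<open>(T, \<tau>)\<close> has
  at most one of its points in each member, every point of the space is \<open>\<tau>\<close>-close to a member
  along \<open>T\<close>. So the \<open>\<tau>\<close>-balls around its members form a cover of order \<open>(T, \<delta>)\<close>, on which the
  orbit sums vary by at most \<open>\<theta> |T|\<close>.
\<close>

lemma large_separated_set:
  assumes T: "T \<in> nonempty_finite_subsets G" and \<tau>: "\<tau> > 0" "2 * \<tau> < \<delta>"
    and \<tau>f: "\<And>x y. x \<in> topspace X \<Longrightarrow> y \<in> topspace X \<Longrightarrow> \<rho> x y < \<tau> \<Longrightarrow> \<bar>f x - f y\<bar> < \<theta>"
  shows "\<exists>D. finite D \<and> D \<subseteq> topspace X \<and> (\<forall>x\<in>D. \<forall>y\<in>D. x \<noteq> y \<longrightarrow> (\<exists>s\<in>T. \<tau> \<le> \<rho> (\<alpha> s x) (\<alpha> s y))) \<and>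
     exp (lnP \<delta> T - \<theta> * real (card T)) \<le> (\<Sum>x\<in>D. exp (orbit_sum T x))"
proof -
  have Tf: "finite T" "T \<noteq> {}" "T \<subseteq> carrier G" using T by (auto simp: nonempty_finite_subsets_def)
  have \<delta>: "\<delta> > 0" using \<tau> by simp
  define sep where "sep D \<longleftrightarrow> finite D \<and> D \<subseteq> topspace X \<and>
    (\<forall>x\<in>D. \<forall>y\<in>D. x \<noteq> y \<longrightarrow> (\<exists>s\<in>T. \<tau> \<le> \<rho> (\<alpha> s x) (\<alpha> s y)))" for D
  obtain \<U> where \<U>: "finite \<U>" "cover_of_order X \<alpha> \<rho> T \<tau> \<U>" using finite_cover_exists[OF T \<tau>(1)] by blast
  have bound: "card D \<le> card \<U>" if D: "sep D" for D
  proof -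
    have "\<exists>U. U \<in> \<U> \<and> x \<in> U" if "x \<in> D" for x
    proof -
      have "x \<in> topspace X" using D that by (auto simp: sep_def)
      then have "x \<in> \<Union>\<U>" using \<U>(2) by (simp add: cover_of_order_def)
      then show ?thesis by blast
    qed
    then obtain u where u: "\<And>x. x \<in> D \<Longrightarrow> u x \<in> \<U> \<and> x \<in> u x" by metis
    have "inj_on u D"
    proof (rule inj_onI, rule ccontr)
      fix x y assume xy: "x \<in> D" "y \<in> D" "u x = u y" "x \<noteq> y"
      then obtain s where s: "s \<in> T" "\<tau> \<le> \<rho> (\<alpha> s x) (\<alpha> s y)" using D unfolding sep_def by blast
      have "u x \<in> \<U>" "x \<in> u x" "y \<in> u x" using u xy by auto
      then have "\<rho> (\<alpha> s x) (\<alpha> s y) < \<tau>" using \<U>(2) s(1) unfolding cover_iff[OF T] by blast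
      then show False using s(2) by simp
    qed
    then show ?thesis using u \<U>(1) by (intro card_inj_on_le[of u]) auto
  qed
  have "sep {}" by (simp add: sep_def)
  then obtain D where D: "sep D" and max: "\<And>D'. sep D' \<Longrightarrow> card D' \<le> card D"
    using ex_has_greatest_nat[of sep "{}" card "card \<U> + 1"] bound by (auto simp: less_Suc_eq_le)
  have near: "\<exists>x\<in>D. \<forall>s\<in>T. \<rho> (\<alpha> s x) (\<alpha> s y) < \<tau>" if y: "y \<in> topspace X" for y
  proof (rule ccontr)
    assume far: "\<not> ?thesis"
    have "y \<notin> D"
    proof
      assume "y \<in> D"
      then obtain s where s: "s \<in> T" "\<not> \<rho> (\<alpha> s y) (\<alpha> s y) < \<tau>" using far by blast
      have "\<alpha> s y \<in> topspace X" using act_closed s(1) Tf y by blast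
      then show False using s \<tau>(1) by simp
    qed
    moreover have "sep (insert y D)"
      unfolding sep_def
    proof (intro conjI ballI impI)
      fix x z assume xz: "x \<in> insert y D" "z \<in> insert y D" "x \<noteq> z"
      consider "x \<in> D" "z \<in> D" | "x \<in> D" "z = y" | "x = y" "z \<in> D" using xz by blast
      then show "\<exists>s\<in>T. \<tau> \<le> \<rho> (\<alpha> s x) (\<alpha> s z)"
      proof cases
        case 1
        then show ?thesis using D xz(3) unfolding sep_def by blast
      next
        case 2
        then show ?thesis using far by (auto simp: not_less)
      next
        case 3
        then obtain s where "s \<in> T" "\<tau> \<le> \<rho> (\<alpha> s z) (\<alpha> s x)" using far by (auto simp: not_less)
        then show ?thesis by (metis commute)
      qed
    qed (use D y in \<open>auto simp: sep_def\<close>)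
    ultimately show False using max[of "insert y D"] D by (simp add: sep_def)
  qed
  define A where "A x = (\<Inter>s\<in>T. {y \<in> topspace X. \<alpha> s y \<in> mball (\<alpha> s x) \<tau>})" for x
  have A: "y \<in> A x \<longleftrightarrow> y \<in> topspace X \<and> (\<forall>s\<in>T. \<rho> (\<alpha> s x) (\<alpha> s y) < \<tau>)" if "x \<in> D" for x y
    using Tf D that act_closed by (auto simp: A_def sep_def)
  have openA: "openin X (A x)" for x
    unfolding A_def using Tf by (intro openin_INT2 open_preimage open_ball) auto
  have "exp (lnP \<delta> T) \<le> (\<Sum>x\<in>D. exp (orbit_sum T x + \<theta> * real (card T)))"
  proof (rule lnP_le_indexed_cover[OF T \<delta>])
    show "finite D" using D by (simp add: sep_def)
    show "cover_of_order X \<alpha> \<rho> T \<delta> (A ` D)"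
      unfolding cover_iff[OF T]
    proof (intro conjI ballI)
      fix V assume "V \<in> A ` D"
      then show "openin X V"
        using openA by blast
    next
      show "\<Union>(A ` D) = topspace X"
      proof
        show "\<Union>(A ` D) \<subseteq> topspace X" using Tf by (auto simp: A_def)
        show "topspace X \<subseteq> \<Union>(A ` D)"
        proof
          fix y assume y: "y \<in> topspace X"
          obtain x where "x \<in> D" "\<forall>s\<in>T. \<rho> (\<alpha> s x) (\<alpha> s y) < \<tau>" using near[OF y] by blast
          then show "y \<in> \<Union>(A ` D)" using A y by blast
        qed
      qed
    next
      fix V y z s assume V: "V \<in> A ` D" "y \<in> V" "z \<in> V" and s: "s \<in> T"
      obtain x where x: "x \<in> D" "V = A x" using V(1) by blast
      have yz: "y \<in> topspace X" "z \<in> topspace X" "\<rho> (\<alpha> s x) (\<alpha> s y) < \<tau>" "\<rho> (\<alpha> s x) (\<alpha> s z) < \<tau>"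
        using V(2,3) s unfolding x(2) A[OF x(1)] by auto
      have "x \<in> topspace X" using x D by (auto simp: sep_def)
      then have "\<alpha> s x \<in> topspace X" "\<alpha> s y \<in> topspace X" "\<alpha> s z \<in> topspace X"
        using act_closed s Tf yz by auto
      then have "\<rho> (\<alpha> s y) (\<alpha> s z) \<le> \<rho> (\<alpha> s y) (\<alpha> s x) + \<rho> (\<alpha> s x) (\<alpha> s z)" by (intro triangle)
      then show "\<rho> (\<alpha> s y) (\<alpha> s z) < \<delta>" using yz \<tau> commute[of "\<alpha> s y" "\<alpha> s x"] by simp
    qed
    show "exp (orbit_sum T y) \<le> exp (orbit_sum T x + \<theta> * real (card T))" if x: "x \<in> D" and y: "y \<in> A x" for x y
    proof -
      have "orbit_sum T y \<le> (\<Sum>s\<in>T. f (\<alpha> s x) + \<theta>)"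
        unfolding orbit_sum_def
      proof (rule sum_mono)
        fix s assume s: "s \<in> T"
        have "\<bar>f (\<alpha> s x) - f (\<alpha> s y)\<bar> < \<theta>"
          using y s Tf D x unfolding A[OF x] sep_def by (intro \<tau>f act_closed) auto
        then show "f (\<alpha> s y) \<le> f (\<alpha> s x) + \<theta>" by linarith
      qed
      then show ?thesis by (simp add: orbit_sum_def sum.distrib mult.commute)
    qed
  qed auto
  also have "\<dots> = (\<Sum>x\<in>D. exp (orbit_sum T x)) * exp (\<theta> * real (card T))"
    by (simp add: exp_add sum_distrib_right)
  finally have "exp (lnP \<delta> T - \<theta> * real (card T)) \<le> (\<Sum>x\<in>D. exp (orbit_sum T x))"
    by (simp add: exp_diff pos_divide_le_eq)
  then show ?thesis using D unfolding sep_def by (intro exI[of _ D]) simp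
qed

text \<open>
  A map \<open>\<phi> y\<close> is glued from orbit pieces: on the tile \<open>p = (c, T)\<close> it sends \<open>\<sigma> s c\<close> to
  \<open>\<alpha> s (y p)\<close>, where \<open>y p\<close> ranges over the separated set \<open>Y T\<close>, and it is constant off the
  tiles. Since \<open>\<phi> y (\<sigma> t (\<sigma> s c)) = \<alpha> t (\<phi> y (\<sigma> s c))\<close> as long as \<open>t s \<in> T\<close>, equivariance under
  \<open>t \<in> F\<close> fails only at a proportion \<open>\<zeta>\<close> of each tile and off the tiles. Different \<open>y\<close> are far
  apart at a point of some tile, and the sum of the weights over all \<open>y\<close> factorises over the
  tiles.
\<close>

lemma glued_maps_sum:
  assumes d: "0 < d" and L: "finite L" "L \<subseteq> carrier G"
    and act: "approx_action G L {1..d} D0 \<sigma>"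
    and perm: "\<And>t. t \<in> F \<Longrightarrow> \<sigma> t permutes {1..d}" and F: "F \<in> nonempty_finite_subsets G"
    and mult: "\<And>c s t. c \<in> D0 \<Longrightarrow> s \<in> L \<Longrightarrow> t \<in> F \<Longrightarrow> \<sigma> t (\<sigma> s c) = \<sigma> (t \<otimes> s) c"
    and T: "finite \<T>" "\<T> \<subseteq> D0 \<times> \<S>" and disj: "disjoint_family_on (tile \<sigma>) \<T>"
    and \<S>: "\<S> \<subseteq> nonempty_finite_subsets G" "\<And>T. T \<in> \<S> \<Longrightarrow> T \<subseteq> L"
    and inv: "\<And>T t. T \<in> \<S> \<Longrightarrow> t \<in> F \<Longrightarrow> real (card {s\<in>T. t \<otimes> s \<notin> T}) \<le> \<zeta> * real (card T)"
    and rest: "real (card ({1..d} - \<Union>(tile \<sigma> ` \<T>))) \<le> \<zeta> * real d" and \<zeta>: "0 \<le> \<zeta>"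
    and diam: "\<And>x y. x \<in> topspace X \<Longrightarrow> y \<in> topspace X \<Longrightarrow> \<rho> x y \<le> M" and \<zeta>M: "2 * \<zeta> * M\<^sup>2 < \<delta>\<^sup>2" and \<delta>: "\<delta> > 0"
    and \<tau>: "\<tau> > 0"
    and sep: "\<And>T. T \<in> \<S> \<Longrightarrow> finite (Y T) \<and> Y T \<subseteq> topspace X \<and>
        (\<forall>x\<in>Y T. \<forall>y\<in>Y T. x \<noteq> y \<longrightarrow> (\<exists>s\<in>T. \<tau> \<le> \<rho> (\<alpha> s x) (\<alpha> s y)))"
    and big: "\<And>T. T \<in> \<S> \<Longrightarrow> exp (h * real (card T)) \<le> (\<Sum>x\<in>Y T. exp (orbit_sum T x))"
  shows "ennreal (exp ((h - (\<bar>h\<bar> + f_bound) * \<zeta>) * real d)) \<le> sofic_M f X \<alpha> \<rho> \<tau> F \<delta> d \<sigma>"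
proof -
  define R where "R = {1..d} - \<Union>(tile \<sigma> ` \<T>)"
  have finR: "finite R" by (simp add: R_def)
  have TL: "\<T> \<subseteq> D0 \<times> Pow L" using T \<S> by blast
  have Tp: "fst p \<in> D0" "snd p \<in> \<S>" "snd p \<subseteq> L" "snd p \<subseteq> carrier G" "finite (snd p)" if "p \<in> \<T>" for p
  proof -
    show "fst p \<in> D0" "snd p \<in> \<S>" using subsetD[OF T(2) that] by (auto simp: mem_Times_iff)
    then show "snd p \<subseteq> L" "snd p \<subseteq> carrier G" "finite (snd p)" using \<S> L by (auto simp: nonempty_finite_subsets_def)
  qed
  have tileD: "\<sigma> s (fst p) \<in> {1..d}" if "p \<in> \<T>" "s \<in> snd p" for p s
    using act Tp[OF that(1)] that(2) unfolding approx_action_def by blast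
  have Fc: "F \<subseteq> carrier G" "finite F" "F \<noteq> {}" using F by (auto simp: nonempty_finite_subsets_def)
  obtain x0 where x0: "x0 \<in> topspace X" using nonempty by blast
  \<comment> \<open>\<open>own a\<close> is the unique \<open>(p, s)\<close> with \<open>a = \<sigma> s c\<close> in the tile \<open>p\<close> with centre \<open>c\<close>; it is
    unique as tiles are disjoint and good points have free orbits.\<close>
  define own where "own a = (SOME ps. fst ps \<in> \<T> \<and> snd ps \<in> snd (fst ps) \<and> a = \<sigma> (snd ps) (fst (fst ps)))" for a
  have own: "own (\<sigma> s (fst p)) = (p, s)" if p: "p \<in> \<T>" and s: "s \<in> snd p" for p s
    unfolding own_def
  proof (rule some_equality)
    show "fst (p, s) \<in> \<T> \<and> snd (p, s) \<in> snd (fst (p, s)) \<and> \<sigma> s (fst p) = \<sigma> (snd (p, s)) (fst (fst (p, s)))"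
      using p s by simp
    fix ps assume ps: "fst ps \<in> \<T> \<and> snd ps \<in> snd (fst ps) \<and> \<sigma> s (fst p) = \<sigma> (snd ps) (fst (fst ps))"
    obtain p' s' where pse: "ps = (p', s')" by (metis surj_pair)
    have p': "p' \<in> \<T>" "s' \<in> snd p'" "\<sigma> s (fst p) = \<sigma> s' (fst p')" using ps by (auto simp: pse)
    have "\<sigma> s (fst p) \<in> tile \<sigma> p" using s unfolding tile_def by (rule imageI)
    moreover have "\<sigma> s (fst p) \<in> tile \<sigma> p'" unfolding p'(3) using p'(2) by (auto simp: tile_def)
    ultimately have "p' = p" using disj p p'(1) unfolding disjoint_family_on_def by blast
    moreover have "inj_on (\<lambda>s. \<sigma> s (fst p)) L" using act Tp[OF p] unfolding approx_action_def by blast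
    ultimately have "s' = s" using p' s Tp[OF p] by (auto dest: inj_onD)
    then show "ps = (p, s)" using \<open>p' = p\<close> pse by simp
  qed
  define \<phi> where "\<phi> y a = (if a \<in> {1..d} then if a \<in> R then x0 else \<alpha> (snd (own a)) (y (fst (own a))) else undefined)"
    for y :: "nat \<times> 'g set \<Rightarrow> 'x" and a
  have \<phi>_tile: "\<phi> y (\<sigma> s (fst p)) = \<alpha> s (y p)" if "p \<in> \<T>" "s \<in> snd p" for y p s
  proof -
    have "\<sigma> s (fst p) \<notin> R" using that by (auto simp: R_def tile_def)
    then show ?thesis using tileD[OF that] own[OF that] by (simp add: \<phi>_def)
  qed
  have \<phi>_rest: "\<phi> y a = x0" if "a \<in> R" for y a using that by (simp add: \<phi>_def R_def)
  define Z where "Z = PiE \<T> (\<lambda>p. Y (snd p))"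
  have finZ: "finite Z" unfolding Z_def using T(1) sep Tp by (intro finite_PiE) auto
  have Zt: "y p \<in> topspace X" if "y \<in> Z" "p \<in> \<T>" for y p
  proof -
    have "y p \<in> Y (snd p)" using that unfolding Z_def by (rule PiE_mem)
    then show ?thesis using sep[OF Tp(2)[OF that(2)]] by blast
  qed
  have \<phi>_top: "\<phi> y a \<in> topspace X" if y: "y \<in> Z" and a: "a \<in> {1..d}" for y a
  proof (cases "a \<in> R")
    case True
    then show ?thesis using \<phi>_rest x0 by simp
  next
    case False
    then obtain p s where p: "p \<in> \<T>" "s \<in> snd p" "a = \<sigma> s (fst p)" using a by (auto simp: R_def tile_def)
    then show ?thesis using \<phi>_tile[OF p(1,2)] Zt[OF y p(1)] Tp(4)[OF p(1)] act_closed by auto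
  qed
  have \<phi>_ext: "\<phi> y \<in> {1..d} \<rightarrow>\<^sub>E topspace X" if "y \<in> Z" for y
    using \<phi>_top[OF that] by (auto simp: PiE_def Pi_def extensional_def \<phi>_def)
  have sum_split: "(\<Sum>a=1..d. q a) = (\<Sum>p\<in>\<T>. \<Sum>s\<in>snd p. q (\<sigma> s (fst p))) + (\<Sum>a\<in>R. q a)" for q :: "nat \<Rightarrow> real"
    unfolding R_def by (rule sum_over_tiles[OF act L(1) T(1) TL disj])
  have cards: "(\<Sum>p\<in>\<T>. real (card (snd p))) = real d - real (card R)"
    using sum_split[of "\<lambda>_. 1"] by simp
  have Map: "\<phi> y \<in> sofic_Map X \<alpha> \<rho> F \<delta> d \<sigma>" if y: "y \<in> Z" for y
  proof -
    have "rho_2 \<rho> d (\<alpha> t \<circ> \<phi> y) (\<phi> y \<circ> \<sigma> t) < \<delta>" if t: "t \<in> F" for t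
    proof -
      let ?q = "\<lambda>a. (\<rho> (\<alpha> t (\<phi> y a)) (\<phi> y (\<sigma> t a)))\<^sup>2"
      have tG: "t \<in> carrier G" using t Fc by auto
      have le: "?q a \<le> M\<^sup>2" if a: "a \<in> {1..d}" for a
      proof -
        have "\<sigma> t a \<in> {1..d}" using permutes_in_image[OF perm[OF t], of a] a by simp
        then have "\<rho> (\<alpha> t (\<phi> y a)) (\<phi> y (\<sigma> t a)) \<le> M" using \<phi>_top[OF y] a act_closed[OF tG] by (intro diam) auto
        then show ?thesis by (intro power_mono) auto
      qed
      have zero: "?q (\<sigma> s (fst p)) = 0" if p: "p \<in> \<T>" and s: "s \<in> snd p" and ts: "t \<otimes> s \<in> snd p" for p s
      proof -
        have sG: "s \<in> carrier G" using s Tp(4)[OF p] by auto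
        have "\<sigma> t (\<sigma> s (fst p)) = \<sigma> (t \<otimes> s) (fst p)"
          using s Tp[OF p] t by (intro mult) auto
        then have "\<phi> y (\<sigma> t (\<sigma> s (fst p))) = \<alpha> (t \<otimes> s) (y p)" using \<phi>_tile[OF p ts] by simp
        also have "\<dots> = \<alpha> t (\<alpha> s (y p))" using act_mult[OF tG sG Zt[OF y p]] .
        also have "\<dots> = \<alpha> t (\<phi> y (\<sigma> s (fst p)))" using \<phi>_tile[OF p s] by simp
        finally have "\<phi> y (\<sigma> t (\<sigma> s (fst p))) = \<alpha> t (\<phi> y (\<sigma> s (fst p)))" .
        moreover have "\<alpha> t (\<phi> y (\<sigma> s (fst p))) \<in> topspace X"
          using act_closed[OF tG] \<phi>_top[OF y tileD[OF p s]] by blast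
        ultimately show ?thesis by simp
      qed
      have "(\<Sum>a=1..d. ?q a) = (\<Sum>p\<in>\<T>. \<Sum>s\<in>snd p. ?q (\<sigma> s (fst p))) + (\<Sum>a\<in>R. ?q a)" by (rule sum_split)
      also have "\<dots> \<le> (\<Sum>p\<in>\<T>. \<zeta> * real (card (snd p)) * M\<^sup>2) + (\<Sum>a\<in>R. M\<^sup>2)"
      proof (intro add_mono sum_mono)
        fix p assume p: "p \<in> \<T>"
        have "(\<Sum>s\<in>snd p. ?q (\<sigma> s (fst p))) \<le> (\<Sum>s\<in>snd p. if t \<otimes> s \<in> snd p then 0 else M\<^sup>2)"
          using zero[OF p] le[OF tileD[OF p]] by (intro sum_mono) auto
        also have "\<dots> = (\<Sum>s\<in>{s\<in>snd p. t \<otimes> s \<notin> snd p}. M\<^sup>2)"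
          using Tp(5)[OF p] by (subst sum.inter_filter) (auto intro: sum.cong)
        also have "\<dots> = real (card {s\<in>snd p. t \<otimes> s \<notin> snd p}) * M\<^sup>2" by simp
        also have "\<dots> \<le> \<zeta> * real (card (snd p)) * M\<^sup>2"
          using inv[OF Tp(2)[OF p] t] by (intro mult_right_mono) auto
        finally show "(\<Sum>s\<in>snd p. ?q (\<sigma> s (fst p))) \<le> \<zeta> * real (card (snd p)) * M\<^sup>2" .
      qed (use le in \<open>auto simp: R_def\<close>)
      also have "\<dots> = \<zeta> * (\<Sum>p\<in>\<T>. real (card (snd p))) * M\<^sup>2 + real (card R) * M\<^sup>2"
        by (simp add: sum_distrib_left sum_distrib_right)
      also have "\<dots> \<le> \<zeta> * real d * M\<^sup>2 + \<zeta> * real d * M\<^sup>2"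
        using rest \<zeta> unfolding cards R_def[symmetric] by (intro add_mono mult_right_mono mult_left_mono) auto
      also have "\<dots> = (2 * \<zeta> * M\<^sup>2) * real d" by simp
      finally have "1 / real d * (\<Sum>a=1..d. ?q a) \<le> 2 * \<zeta> * M\<^sup>2" using d by (simp add: pos_divide_le_eq)
      also have "\<dots> < \<delta>\<^sup>2" by (rule \<zeta>M)
      finally have "sqrt (1 / real d * (\<Sum>a=1..d. ?q a)) < sqrt (\<delta>\<^sup>2)" by (rule real_sqrt_less_mono)
      then show ?thesis using \<delta> by (simp add: rho_2_def)
    qed
    then have "(MAX s\<in>F. rho_2 \<rho> d (\<alpha> s \<circ> \<phi> y) (\<phi> y \<circ> \<sigma> s)) < \<delta>"
      using Fc by (subst Max_less_iff) auto
    then show ?thesis using \<phi>_ext[OF y] by (simp add: sofic_Map_def)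
  qed
  have far: "\<tau> \<le> rho_inf \<rho> d (\<phi> y) (\<phi> z)" if y: "y \<in> Z" and z: "z \<in> Z" and ne: "y \<noteq> z" for y z
  proof -
    obtain p where p: "p \<in> \<T>" "y p \<noteq> z p" using y z ne PiE_ext unfolding Z_def by metis
    have "y p \<in> Y (snd p)" "z p \<in> Y (snd p)" using y z p(1) by (auto simp: Z_def)
    then obtain s where s: "s \<in> snd p" "\<tau> \<le> \<rho> (\<alpha> s (y p)) (\<alpha> s (z p))"
      using sep[OF Tp(2)[OF p(1)]] p(2) by blast
    have "\<rho> (\<phi> y (\<sigma> s (fst p))) (\<phi> z (\<sigma> s (fst p))) \<le> rho_inf \<rho> d (\<phi> y) (\<phi> z)"
      unfolding rho_inf_def using tileD[OF p(1) s(1)] by (intro Max_ge) auto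
    then show ?thesis using s(2) \<phi>_tile[OF p(1) s(1)] by simp
  qed
  have inj: "inj_on \<phi> Z"
  proof (rule inj_onI, rule ccontr)
    fix y z assume yz: "y \<in> Z" "z \<in> Z" "\<phi> y = \<phi> z" "y \<noteq> z"
    have "rho_inf \<rho> d (\<phi> y) (\<phi> z) = (MAX a\<in>{1..d}. 0)"
      unfolding rho_inf_def using \<phi>_top[OF yz(2)] by (auto simp: yz(3) intro!: arg_cong[where f = Max] image_cong)
    also have "\<dots> = 0" using d by simp
    finally show False using far[OF yz(1,2,4)] \<tau> by simp
  qed
  let ?E = "\<phi> ` Z"
  have "separated (rho_inf \<rho> d) \<tau> ?E" using far by (auto simp: separated_def)
  moreover have "?E \<subseteq> sofic_Map X \<alpha> \<rho> F \<delta> d \<sigma>" using Map by blast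
  ultimately have lower: "(\<Sum>\<psi>\<in>?E. ennreal (exp (\<Sum>a=1..d. f (\<psi> a)))) \<le> sofic_M f X \<alpha> \<rho> \<tau> F \<delta> d \<sigma>"
    unfolding sofic_M_def by (intro SUP_upper) auto
  have "(\<Sum>\<psi>\<in>?E. ennreal (exp (\<Sum>a=1..d. f (\<psi> a)))) = ennreal (\<Sum>y\<in>Z. exp (\<Sum>a=1..d. f (\<phi> y a)))"
    by (simp add: sum.reindex[OF inj] sum_ennreal)
  with lower have lower': "ennreal (\<Sum>y\<in>Z. exp (\<Sum>a=1..d. f (\<phi> y a))) \<le> sofic_M f X \<alpha> \<rho> \<tau> F \<delta> d \<sigma>" by simp
  have "exp ((h - (\<bar>h\<bar> + f_bound) * \<zeta>) * real d) \<le> (\<Sum>y\<in>Z. exp (\<Sum>a=1..d. f (\<phi> y a)))"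
  proof -
    have cR: "real (card R) \<le> \<zeta> * real d" using rest by (simp add: R_def)
    have "(h - (\<bar>h\<bar> + f_bound) * \<zeta>) * real d = h * real d - (\<bar>h\<bar> + f_bound) * (\<zeta> * real d)"
      by (simp add: algebra_simps)
    also have "\<dots> \<le> h * real d - (\<bar>h\<bar> + f_bound) * real (card R)"
      using mult_left_mono[OF cR, of "\<bar>h\<bar> + f_bound"] f_bound_nonneg by simp
    also have "\<dots> \<le> h * (real d - real (card R)) - f_bound * real (card R)"
    proof -
      have "h * real (card R) \<le> \<bar>h\<bar> * real (card R)" by (intro mult_right_mono) auto
      then show ?thesis by (simp add: algebra_simps)
    qed
    finally have "exp ((h - (\<bar>h\<bar> + f_bound) * \<zeta>) * real d) \<le> exp (h * (\<Sum>p\<in>\<T>. real (card (snd p)))) * exp (- f_bound * real (card R))"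
      unfolding cards by (simp add: exp_add[symmetric])
    also have "exp (h * (\<Sum>p\<in>\<T>. real (card (snd p)))) = (\<Prod>p\<in>\<T>. exp (h * real (card (snd p))))"
      using T(1) by (simp add: exp_sum sum_distrib_left)
    also have "(\<Prod>p\<in>\<T>. exp (h * real (card (snd p)))) \<le> (\<Prod>p\<in>\<T>. \<Sum>x\<in>Y (snd p). exp (orbit_sum (snd p) x))"
      using big Tp(2) by (intro prod_mono) auto
    also have "\<dots> = (\<Sum>y\<in>Z. \<Prod>p\<in>\<T>. exp (orbit_sum (snd p) (y p)))"
      unfolding Z_def using T(1) sep Tp(2) by (intro prod_sum_PiE) auto
    also have "(\<Sum>y\<in>Z. \<Prod>p\<in>\<T>. exp (orbit_sum (snd p) (y p))) * exp (- f_bound * real (card R))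
        = (\<Sum>y\<in>Z. exp ((\<Sum>p\<in>\<T>. orbit_sum (snd p) (y p)) - f_bound * real (card R)))"
      using T(1) by (simp add: sum_distrib_right exp_sum exp_diff exp_minus divide_inverse)
    also have "\<dots> \<le> (\<Sum>y\<in>Z. exp (\<Sum>a=1..d. f (\<phi> y a)))"
    proof (rule sum_mono)
      fix y assume y: "y \<in> Z"
      have "(\<Sum>a=1..d. f (\<phi> y a)) = (\<Sum>p\<in>\<T>. \<Sum>s\<in>snd p. f (\<alpha> s (y p))) + (\<Sum>a\<in>R. f x0)"
        unfolding sum_split using \<phi>_tile \<phi>_rest by simp
      also have "(\<Sum>a\<in>R. f x0) = f x0 * real (card R)" by simp
      finally have "(\<Sum>a=1..d. f (\<phi> y a)) = (\<Sum>p\<in>\<T>. orbit_sum (snd p) (y p)) + f x0 * real (card R)"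
        by (simp add: orbit_sum_def)
      moreover have "- f_bound * real (card R) \<le> f x0 * real (card R)"
        using f_le[OF x0] by (intro mult_right_mono) auto
      ultimately show "exp ((\<Sum>p\<in>\<T>. orbit_sum (snd p) (y p)) - f_bound * real (card R)) \<le> exp (\<Sum>a=1..d. f (\<phi> y a))"
        by simp
    qed
    finally show ?thesis by simp
  qed
  then show ?thesis by (rule order_trans[OF ennreal_leI lower'])
qed

text \<open>
  Shapes are required to have average at least \<open>v - \<theta>\<close> and to be almost invariant under \<open>F\<close>;
  large subsets of invariant sets have both properties. The glued maps then give the bound, with
  a loss of \<open>\<theta>\<close> each for the choice of shapes, for passing from covers to separated sets and for
  the rest.
\<close>

theorem sofic_M_lower:
  assumes sof: "sofic_approximation_sequence G d \<sigma>" and \<theta>: "\<theta> > 0" and \<tau>: "\<tau> > 0" "2 * \<tau> < \<delta>"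
    and \<tau>f: "\<And>x y. x \<in> topspace X \<Longrightarrow> y \<in> topspace X \<Longrightarrow> \<rho> x y < \<tau> \<Longrightarrow> \<bar>f x - f y\<bar> < \<theta>"
    and freq: "\<exists>\<^sub>F F in left_invariant_filter G. v < avg \<delta> F"
    and F: "F \<in> nonempty_finite_subsets G" and \<delta>': "\<delta>' > 0"
  shows "\<forall>\<^sub>F i in sequentially.
    ennreal (exp ((v - 3 * \<theta>) * real (d i))) \<le> sofic_M f X \<alpha> \<rho> \<tau> F \<delta>' (d i) (\<sigma> i)"
proof -
  have \<delta>: "\<delta> > 0" using \<tau> by simp
  have Fc: "F \<subseteq> carrier G" "finite F" "F \<noteq> {}" using F by (auto simp: nonempty_finite_subsets_def)
  have perm: "\<sigma> i s permutes {1..d i}" if "s \<in> carrier G" for i s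
    using sof that unfolding sofic_approximation_sequence_def by (auto simp: sym_group_carrier)
  obtain M where M: "M > 0" "\<And>x y. x \<in> topspace X \<Longrightarrow> y \<in> topspace X \<Longrightarrow> \<rho> x y \<le> M"
    using diameter_bounded by blast
  define h where "h = v - 2 * \<theta>"
  \<comment> \<open>Equivariance may fail at a proportion \<open>2 \<zeta>\<close> of the points, each with a squared error of at
    most \<open>M\<^sup>2\<close>, so the mean square stays below \<open>\<delta>'\<^sup>2\<close>.\<close>
  obtain \<zeta> where \<zeta>: "0 < \<zeta>" "2 * (\<bar>h\<bar> + f_bound) * \<zeta> \<le> \<theta>" "2 * \<zeta> * M\<^sup>2 < \<delta>'\<^sup>2"
  proof -
    obtain \<zeta>1 where 1: "0 < \<zeta>1" "2 * (\<bar>h\<bar> + f_bound) * \<zeta>1 \<le> \<theta>"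
      using small_eta[of "\<bar>h\<bar> + f_bound" \<theta>] \<theta> f_bound_nonneg by auto
    define \<zeta> where "\<zeta> = min \<zeta>1 (\<delta>'\<^sup>2 / (4 * M\<^sup>2))"
    have "0 < \<zeta>" using 1 M \<delta>' by (simp add: \<zeta>_def)
    moreover have "2 * (\<bar>h\<bar> + f_bound) * \<zeta> \<le> 2 * (\<bar>h\<bar> + f_bound) * \<zeta>1"
      using f_bound_nonneg by (intro mult_left_mono) (auto simp: \<zeta>_def)
    moreover have "2 * \<zeta> * M\<^sup>2 \<le> 2 * (\<delta>'\<^sup>2 / (4 * M\<^sup>2)) * M\<^sup>2"
      by (intro mult_right_mono mult_left_mono) (auto simp: \<zeta>_def)
    moreover have "2 * (\<delta>'\<^sup>2 / (4 * M\<^sup>2)) * M\<^sup>2 < \<delta>'\<^sup>2" using M \<delta>' by simp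
    ultimately show thesis using that[of \<zeta>] 1 by linarith
  qed
  obtain \<eta> where \<eta>: "0 < \<eta>" "\<eta> \<le> 1/2" "2 * (\<bar>v\<bar> + lnP_bound \<delta> + 2) * \<eta> \<le> min \<theta> \<zeta>"
    using small_eta[of "\<bar>v\<bar> + lnP_bound \<delta> + 2" "min \<theta> \<zeta>"] \<theta> \<zeta> lnP_bound_nonneg[of \<delta>] by auto
  have \<eta>1: "2 * (\<bar>v\<bar> + lnP_bound \<delta>) * \<eta> \<le> \<theta>"
  proof -
    have "2 * (\<bar>v\<bar> + lnP_bound \<delta>) * \<eta> \<le> 2 * (\<bar>v\<bar> + lnP_bound \<delta> + 2) * \<eta>" using \<eta> by (intro mult_right_mono) auto
    then show ?thesis using \<eta>(3) by simp
  qed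
  have \<eta>2: "4 * \<eta> \<le> \<zeta>"
  proof -
    have "4 * \<eta> \<le> 2 * (\<bar>v\<bar> + lnP_bound \<delta> + 2) * \<eta>" using \<eta> lnP_bound_nonneg[of \<delta>] by (intro mult_right_mono) auto
    then show ?thesis using \<eta>(3) by simp
  qed
  define Q where "Q T \<longleftrightarrow> (T \<noteq> {} \<longrightarrow> (v - \<theta>) * real (card T) \<le> lnP \<delta> T) \<and>
    (\<forall>t\<in>F. real (card {s\<in>T. t \<otimes> s \<notin> T}) \<le> \<zeta> * real (card T))" for T
  have "\<exists>\<^sub>F A in left_invariant_filter G. v < avg \<delta> A \<and> (A \<in> nonempty_finite_subsets G \<and>
           real (card (sym_diff (F <#> A) A)) \<le> \<eta> * real (card A))"
    using frequently_eventually_conj[OF freq eventually_left_invariant[OF F \<eta>(1)]] by (simp add: conj_commute)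
  then have freqQ: "\<exists>\<^sub>F A in left_invariant_filter G. \<forall>T\<subseteq>A. (1 - \<eta>) * real (card A) \<le> real (card T) \<longrightarrow> Q T"
  proof (rule frequently_elim1, intro allI impI)
    fix A T assume A: "v < avg \<delta> A \<and> (A \<in> nonempty_finite_subsets G \<and>
           real (card (sym_diff (F <#> A) A)) \<le> \<eta> * real (card A))"
      and T: "T \<subseteq> A" and large: "(1 - \<eta>) * real (card A) \<le> real (card T)"
    have finA: "finite A" using A by (auto simp: nonempty_finite_subsets_def)
    have finT: "finite T" using T finA finite_subset by blast
    have "real (card {s\<in>T. t \<otimes> s \<notin> T}) \<le> \<zeta> * real (card T)" if t: "t \<in> F" for t
    proof -
      have "inj_on (\<lambda>s. t \<otimes> s) {s\<in>T. t \<otimes> s \<notin> T}"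
        using t T A Fc by (auto simp: inj_on_def nonempty_finite_subsets_def subset_iff)
      moreover have "(\<lambda>s. t \<otimes> s) ` {s\<in>T. t \<otimes> s \<notin> T} \<subseteq> sym_diff (F <#> A) A \<union> (A - T)"
        using t T by (auto simp: set_mult_def)
      moreover have fin: "finite (sym_diff (F <#> A) A \<union> (A - T))"
        using finA Fc by (simp add: finite_set_mult)
      ultimately have "card {s\<in>T. t \<otimes> s \<notin> T} \<le> card (sym_diff (F <#> A) A \<union> (A - T))"
        by (rule card_inj_on_le)
      also have "\<dots> \<le> card (sym_diff (F <#> A) A) + card (A - T)" by (rule card_Un_le)
      finally have "real (card {s\<in>T. t \<otimes> s \<notin> T}) \<le> real (card (sym_diff (F <#> A) A)) + real (card (A - T))"
        by (simp flip: of_nat_add)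
      also have "real (card (A - T)) = real (card A) - real (card T)"
        using finA T finT by (simp add: card_Diff_subset card_mono)
      finally have "real (card {s\<in>T. t \<otimes> s \<notin> T}) \<le> 2 * \<eta> * real (card A)"
        using A large by (simp add: algebra_simps)
      also have "\<dots> \<le> 2 * \<eta> * (2 * real (card T))"
      proof (rule mult_left_mono)
        have "1/2 * real (card A) \<le> (1 - \<eta>) * real (card A)" using \<eta> by (intro mult_right_mono) auto
        then show "real (card A) \<le> 2 * real (card T)" using large by simp
      qed (use \<eta> in simp)
      also have "\<dots> = 4 * \<eta> * real (card T)" by simp
      also have "\<dots> \<le> \<zeta> * real (card T)" using \<eta>2 by (intro mult_right_mono) auto
      finally show ?thesis .
    qed
    moreover have "(v - \<theta>) * real (card T) \<le> lnP \<delta> T" if "T \<noteq> {}"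
      using A that by (intro lnP_large_subset_lower[OF _ _ T _ large \<delta> \<eta>(1,2) \<eta>1]) auto
    ultimately show "Q T" unfolding Q_def by blast
  qed
  obtain \<S> where \<S>: "finite \<S>" "\<S> \<subseteq> nonempty_finite_subsets G" and QT: "\<forall>T\<in>\<S>. Q T"
    and ev: "\<forall>\<^sub>F i in sequentially. 0 < d i \<and> (\<exists>D0 \<T>. approx_action G (\<Union>\<S>) {1..d i} D0 (\<sigma> i) \<and>
       quasi_tiling (\<sigma> i) {1..d i} D0 \<S> \<zeta> \<T> \<and>
       (\<forall>c\<in>D0. \<forall>t\<in>F. \<forall>s\<in>\<Union>\<S>. \<sigma> i t (\<sigma> i s c) = \<sigma> i (t \<otimes> s) c))"
    by (rule sofic_quasi_tiling_exists[OF freqQ \<eta>(1) \<zeta>(1) sof Fc(1,2)]) blast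
  define L where "L = \<Union>\<S>"
  have L: "finite L" "L \<subseteq> carrier G" using \<S> by (auto simp: nonempty_finite_subsets_def L_def)
  have "\<exists>D. finite D \<and> D \<subseteq> topspace X \<and> (\<forall>x\<in>D. \<forall>y\<in>D. x \<noteq> y \<longrightarrow> (\<exists>s\<in>T. \<tau> \<le> \<rho> (\<alpha> s x) (\<alpha> s y))) \<and>
     exp (h * real (card T)) \<le> (\<Sum>x\<in>D. exp (orbit_sum T x))" if T: "T \<in> \<S>" for T
  proof -
    have ne: "T \<in> nonempty_finite_subsets G" using T \<S> by auto
    obtain D where D: "finite D" "D \<subseteq> topspace X" "\<forall>x\<in>D. \<forall>y\<in>D. x \<noteq> y \<longrightarrow> (\<exists>s\<in>T. \<tau> \<le> \<rho> (\<alpha> s x) (\<alpha> s y))"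
      "exp (lnP \<delta> T - \<theta> * real (card T)) \<le> (\<Sum>x\<in>D. exp (orbit_sum T x))"
      using large_separated_set[OF ne \<tau> \<tau>f] by auto
    have "(v - \<theta>) * real (card T) \<le> lnP \<delta> T" using QT T ne by (auto simp: Q_def nonempty_finite_subsets_def)
    then have "exp (h * real (card T)) \<le> exp (lnP \<delta> T - \<theta> * real (card T))" by (simp add: h_def algebra_simps)
    then show ?thesis using D by (meson order_trans)
  qed
  then obtain Y where Y: "\<And>T. T \<in> \<S> \<Longrightarrow> finite (Y T) \<and> Y T \<subseteq> topspace X \<and>
        (\<forall>x\<in>Y T. \<forall>y\<in>Y T. x \<noteq> y \<longrightarrow> (\<exists>s\<in>T. \<tau> \<le> \<rho> (\<alpha> s x) (\<alpha> s y)))"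
    "\<And>T. T \<in> \<S> \<Longrightarrow> exp (h * real (card T)) \<le> (\<Sum>x\<in>Y T. exp (orbit_sum T x))"
    by metis
  from ev show ?thesis
  proof eventually_elim
    case (elim i)
    define n where "n = d i"
    define \<pi> where "\<pi> = \<sigma> i"
    obtain D0 \<T> where n: "0 < n" and act: "approx_action G L {1..n} D0 \<pi>"
      and T: "finite \<T>" "\<T> \<subseteq> D0 \<times> \<S>" and disj: "disjoint_family_on (tile \<pi>) \<T>"
      and rest: "real (card ({1..n} - \<Union>(tile \<pi> ` \<T>))) \<le> \<zeta> * real n"
      and mult: "\<forall>c\<in>D0. \<forall>t\<in>F. \<forall>s\<in>L. \<pi> t (\<pi> s c) = \<pi> (t \<otimes> s) c"
      using elim by (auto simp: quasi_tiling_def n_def \<pi>_def L_def)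
    have "ennreal (exp ((h - (\<bar>h\<bar> + f_bound) * \<zeta>) * real n)) \<le> sofic_M f X \<alpha> \<rho> \<tau> F \<delta>' n \<pi>"
    proof (rule glued_maps_sum[OF n L act _ F _ T disj \<S>(2) _ _ rest _ M(2) \<zeta>(3) \<delta>' \<tau>(1) Y])
      show "\<pi> t permutes {1..n}" if "t \<in> F" for t using perm that Fc by (auto simp: \<pi>_def n_def)
      show "\<pi> t (\<pi> s c) = \<pi> (t \<otimes> s) c" if "c \<in> D0" "s \<in> L" "t \<in> F" for c s t
        using mult that by blast
      show "T \<subseteq> L" if "T \<in> \<S>" for T using that by (auto simp: L_def)
      show "real (card {s \<in> T. t \<otimes> s \<notin> T}) \<le> \<zeta> * real (card T)" if "T \<in> \<S>" "t \<in> F" for T t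
        using QT that by (auto simp: Q_def)
      show "0 \<le> \<zeta>" using \<zeta> by simp
    qed
    moreover have "ennreal (exp ((v - 3 * \<theta>) * real n)) \<le> ennreal (exp ((h - (\<bar>h\<bar> + f_bound) * \<zeta>) * real n))"
    proof -
      have "0 \<le> (\<bar>h\<bar> + f_bound) * \<zeta>" using f_bound_nonneg \<zeta> by simp
      moreover have "2 * ((\<bar>h\<bar> + f_bound) * \<zeta>) \<le> \<theta>" using \<zeta>(2) by (simp only: mult.assoc)
      ultimately have "v - 3 * \<theta> \<le> h - (\<bar>h\<bar> + f_bound) * \<zeta>" unfolding h_def by linarith
      then have "(v - 3 * \<theta>) * real n \<le> (h - (\<bar>h\<bar> + f_bound) * \<zeta>) * real n" by (rule mult_right_mono) simp
      then show ?thesis by (simp add: ennreal_leI)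
    qed
    ultimately show ?case unfolding n_def \<pi>_def by (rule order_trans[rotated])
  qed
qed

lemma amenable_pressure_le:
  assumes am: "amenable G" and sof: "sofic_approximation_sequence G d \<sigma>"
  shows "amenable_pressure f X G \<alpha> \<rho> \<le> sofic_pressure d \<sigma> f X G \<alpha> \<rho>"
  unfolding amenable_pressure_eq[OF am]
proof (rule SUP_least)
  fix \<delta> :: real assume "\<delta> \<in> {0<..}"
  then have \<delta>: "\<delta> > 0" by simp
  have nb: "left_invariant_filter G \<noteq> bot" by (rule left_invariant_filter_neq_bot[OF am])
  have "ereal (p1 \<delta>) \<le> sofic_pressure d \<sigma> f X G \<alpha> \<rho> + ereal e" if e: "e > 0" for e :: real
  proof -
    define \<theta> where "\<theta> = e / 4"
    have \<theta>: "\<theta> > 0" using e by (simp add: \<theta>_def)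
    obtain \<tau>0 where \<tau>0: "\<tau>0 > 0" "\<And>x y. x \<in> topspace X \<Longrightarrow> y \<in> topspace X \<Longrightarrow> \<rho> x y < \<tau>0 \<Longrightarrow> \<bar>f x - f y\<bar> < \<theta>"
      using f_uniform[OF \<theta>] by blast
    define \<tau> where "\<tau> = min \<tau>0 (\<delta>/3)"
    have "\<tau> \<le> \<delta>/3" by (simp add: \<tau>_def)
    then have \<tau>: "\<tau> > 0" "2 * \<tau> < \<delta>" using \<tau>0 \<delta> by (auto simp: \<tau>_def)
    have \<tau>f: "\<bar>f x - f y\<bar> < \<theta>" if "x \<in> topspace X" "y \<in> topspace X" "\<rho> x y < \<tau>" for x y
      using \<tau>0(2) that by (simp add: \<tau>_def)
    have "\<forall>\<^sub>F F in left_invariant_filter G. p1 \<delta> - \<theta> < avg \<delta> F"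
      using tendsto_p1[OF am \<delta>] \<theta> by (intro order_tendstoD) auto
    then have freq: "\<exists>\<^sub>F F in left_invariant_filter G. p1 \<delta> - \<theta> < avg \<delta> F"
      using nb by (rule eventually_frequently[rotated])
    let ?h = "\<lambda>F \<delta>' i. ereal (1 / real (d i)) * elog (sofic_M f X \<alpha> \<rho> \<tau> F \<delta>' (d i) (\<sigma> i))"
    have "ereal (p1 \<delta> - e) \<le> limsup (?h F \<delta>')"
      if F: "F \<in> nonempty_finite_subsets G" and \<delta>': "\<delta>' > 0" for F \<delta>'
    proof -
      have ev: "\<forall>\<^sub>F i in sequentially. ennreal (exp ((p1 \<delta> - \<theta> - 3 * \<theta>) * real (d i))) \<le> sofic_M f X \<alpha> \<rho> \<tau> F \<delta>' (d i) (\<sigma> i)"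
        by (rule sofic_M_lower[OF sof \<theta> \<tau> \<tau>f freq F \<delta>'])
      from ev eventually_sofic_dim_pos[OF sof] have "\<forall>\<^sub>F i in sequentially. ereal (p1 \<delta> - e) \<le> ?h F \<delta>' i"
      proof eventually_elim
        case (elim i)
        have "p1 \<delta> - \<theta> - 3 * \<theta> = p1 \<delta> - e" by (simp add: \<theta>_def)
        then show ?case using elim normalized_elog_ge[of "d i" "p1 \<delta> - e"] by simp
      qed
      then have "ereal (p1 \<delta> - e) \<le> liminf (?h F \<delta>')"
        by (rule Liminf_bounded)
      also have "\<dots> \<le> limsup (?h F \<delta>')"
        by (rule Liminf_le_Limsup) simp
      finally show ?thesis .
    qed
    then have "ereal (p1 \<delta> - e) \<le> (INF F\<in>nonempty_finite_subsets G. INF \<delta>\<in>{0<..}. limsup (?h F \<delta>))"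
      by (intro INF_greatest) auto
    also have "\<dots> \<le> sofic_pressure d \<sigma> f X G \<alpha> \<rho>"
      unfolding sofic_pressure_def using \<tau>(1) by (intro SUP_upper) auto
    finally have le: "ereal (p1 \<delta> - e) \<le> sofic_pressure d \<sigma> f X G \<alpha> \<rho>" .
    have "ereal (p1 \<delta>) = ereal (p1 \<delta> - e) + ereal e" by (simp only: plus_ereal.simps diff_add_cancel)
    also have "\<dots> \<le> sofic_pressure d \<sigma> f X G \<alpha> \<rho> + ereal e" using le by (rule add_right_mono)
    finally show ?thesis .
  qed
  then show "ereal (p1 \<delta>) \<le> sofic_pressure d \<sigma> f X G \<alpha> \<rho>" by (rule ereal_le_epsilon2)
qed

end

section \<open>Equality of the pressures\<close>

text \<open>
  There are no maps from a nonempty set to the empty space.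
\<close>

lemma sofic_pressure_empty_space:
  assumes G: "group G" and X: "topspace X = {}" and sof: "sofic_approximation_sequence G d \<sigma>"
  shows "sofic_pressure d \<sigma> f X G \<alpha> \<rho> = -\<infinity>"
proof -
  have "\<forall>\<^sub>F i in sequentially. ereal (1 / real (d i)) * elog (sofic_M f X \<alpha> \<rho> \<epsilon> F \<delta> (d i) (\<sigma> i)) = -\<infinity>" for \<epsilon> F \<delta>
    using eventually_sofic_dim_pos[OF sof]
  proof eventually_elim
    case (elim i)
    have "1 \<in> {1..d i}" using elim by simp
    then have "({1..d i} \<rightarrow>\<^sub>E topspace X) = {}" unfolding PiE_eq_empty_iff using X by blast
    then have "sofic_Map X \<alpha> \<rho> F \<delta> (d i) (\<sigma> i) = {}" by (simp add: sofic_Map_def)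
    then have "sofic_M f X \<alpha> \<rho> \<epsilon> F \<delta> (d i) (\<sigma> i) \<le> 0"
      unfolding sofic_M_def by (intro SUP_least) auto
    then have "sofic_M f X \<alpha> \<rho> \<epsilon> F \<delta> (d i) (\<sigma> i) = 0" by simp
    then show ?case using elim by (simp add: elog_def)
  qed
  then have "limsup (\<lambda>i. ereal (1 / real (d i)) * elog (sofic_M f X \<alpha> \<rho> \<epsilon> F \<delta> (d i) (\<sigma> i))) = -\<infinity>" for \<epsilon> F \<delta>
    by (subst Limsup_eq[of _ "\<lambda>_. -\<infinity>"]) (auto simp: Limsup_const)
  moreover have "nonempty_finite_subsets G \<noteq> {}" using group.one_nonempty_finite[OF G] by blast
  ultimately show ?thesis unfolding sofic_pressure_def by simp
qed

text \<open>
  The empty family covers the empty space, and its sum is 0.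
\<close>

lemma amenable_pressure_empty_space:
  assumes G: "group G" and am: "amenable G" and X: "topspace X = {}"
  shows "amenable_pressure f X G \<alpha> \<rho> = -\<infinity>"
proof -
  have zero: "amenable_P1 X \<alpha> \<rho> F f \<delta> = 0" for F \<delta>
  proof -
    have "amenable_P1 X \<alpha> \<rho> F f \<delta> \<le> (\<Sum>U\<in>{}. SUP x\<in>U. ennreal (exp (\<Sum>s\<in>F. f (\<alpha> s x))))"
      unfolding amenable_P1_def using X by (intro INF_lower) (simp add: cover_of_order_def)
    then show ?thesis by simp
  qed
  have "\<forall>\<^sub>F F in left_invariant_filter G. -\<infinity> = ereal (1 / real (card F)) * elog (amenable_P1 X \<alpha> \<rho> F f \<delta>)" for \<delta>
    using group.eventually_nonempty_finite[OF G]
  proof eventually_elim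
    case (elim F)
    then have "0 < card F" by (simp add: nonempty_finite_subsets_def card_gt_0_iff)
    then show ?case by (simp add: zero elog_def)
  qed
  then have lim: "((\<lambda>F. ereal (1 / real (card F)) * elog (amenable_P1 X \<alpha> \<rho> F f \<delta>)) \<longlongrightarrow> -\<infinity>) (left_invariant_filter G)" for \<delta>
    by (rule Lim_transform_eventually[OF tendsto_const])
  have "amenable_p1 f X G \<alpha> \<rho> \<delta> = -\<infinity>" for \<delta>
    unfolding amenable_p1_def
    by (rule tendsto_Lim[OF group.left_invariant_filter_neq_bot[OF G am] lim])
  then show ?thesis by (simp add: amenable_pressure_def)
qed

theorem theorem1p1:
  fixes G :: "('g, 'r) monoid_scheme"
    and X :: "'x topology"
    and \<alpha> :: "'g \<Rightarrow> 'x \<Rightarrow> 'x"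
    and d :: "nat \<Rightarrow> nat"
    and \<sigma> :: "nat \<Rightarrow> 'g \<Rightarrow> nat \<Rightarrow> nat"
    and f :: "'x \<Rightarrow> real"
    and \<rho> \<rho>' :: "'x \<Rightarrow> 'x \<Rightarrow> real"
  assumes "group G" and "countable (carrier G)" and "amenable G"
    and "compact_space X" and "metrizable_space X"
    and "continuous_action G X \<alpha>"
    and "sofic_approximation_sequence G d \<sigma>"
    and "continuous_map X euclideanreal f"
    and "compatible_metric X \<rho>" and "compatible_metric X \<rho>'"
  shows "sofic_pressure d \<sigma> f X G \<alpha> \<rho> = amenable_pressure f X G \<alpha> \<rho>'"
proof (cases "topspace X = {}")
  case True
  then show ?thesis
    using sofic_pressure_empty_space[OF assms(1) True assms(7)]
      amenable_pressure_empty_space[OF assms(1,3) True] by simp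
next
  case False
  interpret group G by fact
  interpret compact_dynamics G X \<alpha> \<rho> f
    by unfold_locales (use assms False in auto)
  have "sofic_pressure d \<sigma> f X G \<alpha> \<rho> = amenable_pressure f X G \<alpha> \<rho>"
    using sofic_pressure_le amenable_pressure_le assms(3,7) by (intro antisym) auto
  also have "\<dots> = amenable_pressure f X G \<alpha> \<rho>'"
    using amenable_pressure_metric_independent assms(3,10) by simp
  finally show ?thesis .
qed

end
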